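(* Let $C$ be a smooth curve, let $\mathfrak{D}$ be a proper $\sigma$-polyhedral divisor on $C$, and let $X=\mathrm{Spec}\,A[C,\mathfrak{D}]$ be the corresponding $T$-variety of complexity one. Suppose that there exists a homogeneous locally nilpotent derivation $\partial$ of horizontal type and of degree zero on $A[C,\mathfrak{D}]$, and consider the corresponding $\mathbb{G}_a$-action on $X$. Then: (1) if $C=\mathbb{A}^1$, then $X\cong Y\times\mathbb{A}^1$, where $Y$ is the affine toric variety corresponding to the cone $\sigma$ and $\mathbb{G}_a$ acts on $\mathbb{A}^1$ by translations; (2) if $C=\mathbb{P}^1$, then there is a $\sigma$-tailed polyhedron $\Delta_\infty\subsetneq\sigma$ such that $A[C,\mathfrak{D}]\cong A[\mathbb{P}^1,\Delta_\infty\cdot[\infty]]$ as $M$-graded algebras and $X$ is the affine toric variety with the cone $\widetilde{\sigma}\subset(N\oplus\mathbb{Z})_{\mathbb{Q}}$ generated by $(\sigma,0)$, $(\Delta_\infty,-1)$ and $(0,1)$; the $\mathbb{G}_a$-action on $X$ is given by the Demazure root $\widetilde{e}=(0,-1)\in M\oplus\mathbb{Z}$ of the cone $\widetilde{\sigma}$.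
   Context: $\mathbb{K}$ is an algebraically closed field of characteristic zero, $\mathbb{G}_a=(\mathbb{K},+)$. $T$ is an algebraic torus with character lattice $M$ and dual lattice $N$ of one-parameter subgroups, with pairing $\langle\cdot,\cdot\rangle$; $N_{\mathbb{Q}}=N\otimes_{\mathbb{Z}}\mathbb{Q}$, $M_{\mathbb{Q}}=M\otimes_{\mathbb{Z}}\mathbb{Q}$. Effective $T$-actions on an affine variety correspond to effective $M$-gradings of its coordinate algebra; complexity one means that a general $T$-orbit has codimension one. Polyhedral divisors: let $\sigma\subset N_{\mathbb{Q}}$ be a strongly convex polyhedral cone with dual cone $\omega\subseteq M_{\mathbb{Q}}$, $\omega_M=\omega\cap M$. A polyhedron in $N_{\mathbb{Q}}$ is $\sigma$-tailed if it is the Minkowski sum of a bounded polyhedron and $\sigma$. A $\sigma$-polyhedral divisor on a smooth curve $C$ is a formal sum $\mathfrak{D}=\sum_{z\in C}\Delta_z\cdot z$ with $\Delta_z$ $\sigma$-tailed polyhedra, only finitely many different from $\sigma$ (terms with $\Delta_z=\sigma$ may be omitted, e.g. $\Delta_\infty\cdot[\infty]$ has $\Delta_z=\sigma$ for $z\ne\infty$). It is proper if either $C$ is affine, or $C$ is projective and $\deg\mathfrak{D}=\sum_{z\in C}\Delta_z$ is a proper subset of $\sigma$. For $m\in\omega_M$ put $\mathfrak{D}(m)=\sum_{z\in C}h_z(m)\cdot z$ with $h_z(m)=\min_{p\in\Delta_z}\langle p,m\rangle$. Define the $M$-graded algebra $A[C,\mathfrak{D}]=\bigoplus_{m\in\omega_M}A_m\chi^m$,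 $A_m=\{f\in\mathbb{K}(C)\mid \mathrm{div} f+\mathfrak{D}(m)\geq 0\}$, with multiplication induced from $\mathbb{K}(C)$ and $\chi^m\chi^{m'}=\chi^{m+m'}$. For proper $\mathfrak{D}$, $\mathrm{Spec}\,A[C,\mathfrak{D}]$ is a normal affine variety with an effective $T$-action of complexity one. Derivations: a derivation $\partial$ of an algebra $A$ is locally nilpotent (LND) if for each $f\in A$ some power $\partial^k$ kills $f$; it defines the $\mathbb{G}_a$-action $s\mapsto\exp(s\partial)$. It is homogeneous if it respects the $M$-grading; its degree is $\deg\partial(f)-\deg f$ for any homogeneous $f\notin\ker\partial$. A homogeneous LND on $\mathbb{K}[X]$ is of horizontal type if its extension to $\mathbb{K}(X)$ does not vanish identically on $\mathbb{K}(X)^T$. Demazure roots of a cone: for a cone $\tau$ in $L_{\mathbb{Q}}$ ($L$ a lattice with dual lattice $L^*$), a Demazure root of $\tau$ with distinguished ray $\rho$ is $e\in L^*$ with $\langle n_\rho,e\rangle=-1$ and $\langle n_{\rho'},e\rangle\ge 0$ for all other rays $\rho'$ of $\tau$, where $n_\rho$ is the primitive lattice vector on $\rho$. It gives the $\mathbb{G}_a$-action on the affine toric variety of $\tau$ corresponding to the LND $\partial_e(\chi^m)=\langle n_\rho,m\rangle\chi^{m+e}$. *)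

theory Defs
  imports
    "HOL-Library.Poly_Mapping"
    "HOL-Library.Function_Algebras"
    "HOL-Library.Set_Algebras"
    "HOL-Computational_Algebra.Polynomial"
    "HOL-Computational_Algebra.Fraction_Field"
begin

section \<open>Lattices, cones and polyhedra\<close>

text \<open>
  Lattices of rank \<open>n\<close> are taken with a basis: a vector is a sequence that vanishes from
  position \<open>n\<close> on. Both \<open>N\<close> and \<open>M\<close> are \<open>int_lattice n\<close> (dual bases), the
  rational vector space of \<open>N\<close> is \<open>rat_space n\<close>, and the lattice \<open>N \<oplus> \<int>\<close> is
  \<open>int_lattice (Suc n)\<close>, the pair \<open>(v, a)\<close> being the vector \<open>v(n := a)\<close>.
\<close>

definition int_lattice :: "nat \<Rightarrow> (nat \<Rightarrow> int) set" where
  "int_lattice n = {m. \<forall>i\<ge>n. m i = 0}"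

definition rat_space :: "nat \<Rightarrow> (nat \<Rightarrow> rat) set" where
  "rat_space n = {v. \<forall>i\<ge>n. v i = 0}"

definition rat_vec :: "(nat \<Rightarrow> int) \<Rightarrow> nat \<Rightarrow> rat" where
  "rat_vec w = (\<lambda>i. of_int (w i))"

definition pairing :: "nat \<Rightarrow> (nat \<Rightarrow> 'a::comm_ring_1) \<Rightarrow> (nat \<Rightarrow> int) \<Rightarrow> 'a" where
  "pairing n v m = (\<Sum>i<n. v i * of_int (m i))"

definition cone_hull :: "(nat \<Rightarrow> rat) set \<Rightarrow> (nat \<Rightarrow> rat) set" where
  "cone_hull G =
    {v. \<exists>S c. finite S \<and> S \<subseteq> G \<and> (\<forall>s\<in>S. c s \<ge> 0) \<and> v = (\<lambda>i. \<Sum>s\<in>S. c s * s i)}"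

definition polyhedral_cone :: "nat \<Rightarrow> (nat \<Rightarrow> rat) set \<Rightarrow> bool" where
  "polyhedral_cone n \<sigma> \<longleftrightarrow> (\<exists>G. finite G \<and> G \<subseteq> rat_space n \<and> \<sigma> = cone_hull G)"

definition strongly_convex :: "(nat \<Rightarrow> rat) set \<Rightarrow> bool" where
  "strongly_convex \<sigma> \<longleftrightarrow> (\<forall>v. v \<in> \<sigma> \<and> - v \<in> \<sigma> \<longrightarrow> v = 0)"

text \<open>The lattice points of the dual cone: for \<open>\<tau> = \<sigma>\<close> this is \<open>\<omega>\<^sub>M\<close>.\<close>

definition dual_lattice :: "nat \<Rightarrow> (nat \<Rightarrow> rat) set \<Rightarrow> (nat \<Rightarrow> int) set" where
  "dual_lattice n \<tau> = {m \<in> int_lattice n. \<forall>v\<in>\<tau>. pairing n v m \<ge> 0}"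

text \<open>Integral normal vectors suffice, since a rational inequality may be scaled.\<close>

definition polyhedron :: "nat \<Rightarrow> (nat \<Rightarrow> rat) set \<Rightarrow> bool" where
  "polyhedron n P \<longleftrightarrow>
    (\<exists>H. finite H \<and> H \<subseteq> int_lattice n \<times> UNIV \<and>
         P = {v \<in> rat_space n. \<forall>(m, b)\<in>H. pairing n v m \<ge> b})"

definition bounded_set :: "nat \<Rightarrow> (nat \<Rightarrow> rat) set \<Rightarrow> bool" where
  "bounded_set n P \<longleftrightarrow> (\<exists>B. \<forall>p\<in>P. \<forall>i<n. \<bar>p i\<bar> \<le> B)"

text \<open>The sum of sets is the Minkowski sum. Polyhedra in polyhedral divisors are nonempty.\<close>

definition tailed :: "nat \<Rightarrow> (nat \<Rightarrow> rat) set \<Rightarrow> (nat \<Rightarrow> rat) set \<Rightarrow> bool" where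
  "tailed n \<sigma> \<Delta> \<longleftrightarrow>
    (\<exists>P. polyhedron n P \<and> bounded_set n P \<and> P \<noteq> {} \<and> \<Delta> = P + \<sigma>)"

section \<open>Smooth curves\<close>

text \<open>
  A smooth (irreducible) curve over the algebraically closed field \<open>\<bbbK>\<close> is given by its
  function field \<open>\<iota> : \<bbbK> \<rightarrow> \<bbbK>(C)\<close> and its set of points, a point being identified with
  the normalized discrete valuation \<open>ord\<close> of its local ring. The smooth curves with a given
  function field are exactly the cofinite sets of places; the full set of places is the projective
  one and all others are affine.
\<close>

definition field_embedding :: "('k::field \<Rightarrow> 'f::field) \<Rightarrow> bool" where
  "field_embedding \<iota> \<longleftrightarrow>
    \<iota> 1 = 1 \<and> (\<forall>a b. \<iota> (a + b) = \<iota> a + \<iota> b) \<and> (\<forall>a b. \<iota> (a * b) = \<iota> a * \<iota> b)"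

definition transcendental_elt :: "('k::field \<Rightarrow> 'f::field) \<Rightarrow> 'f \<Rightarrow> bool" where
  "transcendental_elt \<iota> x \<longleftrightarrow> (\<forall>p. p \<noteq> 0 \<longrightarrow> poly (map_poly \<iota> p) x \<noteq> 0)"

definition simple_ext :: "('k::field \<Rightarrow> 'f::field) \<Rightarrow> 'f \<Rightarrow> 'f set" where
  "simple_ext \<iota> x =
    {poly (map_poly \<iota> p) x / poly (map_poly \<iota> q) x | p q. poly (map_poly \<iota> q) x \<noteq> 0}"

definition function_field :: "('k::field \<Rightarrow> 'f::field) \<Rightarrow> bool" where
  "function_field \<iota> \<longleftrightarrow> field_embedding \<iota> \<and>
    (\<exists>x. transcendental_elt \<iota> x \<and>
      (\<exists>B. finite B \<and> (\<forall>f. \<exists>c. (\<forall>b\<in>B. c b \<in> simple_ext \<iota> x) \<and> f = (\<Sum>b\<in>B. c b * b))))"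

text \<open>The value at \<open>0\<close>, which should be infinite, is set to \<open>0\<close> and never used.\<close>

definition places :: "('k::field \<Rightarrow> 'f::field) \<Rightarrow> ('f \<Rightarrow> int) set" where
  "places \<iota> = {z. z 0 = 0 \<and>
    (\<forall>f g. f \<noteq> 0 \<longrightarrow> g \<noteq> 0 \<longrightarrow> z (f * g) = z f + z g) \<and>
    (\<forall>f g. f \<noteq> 0 \<longrightarrow> g \<noteq> 0 \<longrightarrow> f + g \<noteq> 0 \<longrightarrow> z (f + g) \<ge> min (z f) (z g)) \<and>
    (\<forall>c. c \<noteq> 0 \<longrightarrow> z (\<iota> c) = 0) \<and>
    (\<exists>f. f \<noteq> 0 \<and> z f = 1)}"

definition smooth_curve :: "('k::field \<Rightarrow> 'f::field) \<Rightarrow> ('f \<Rightarrow> int) set \<Rightarrow> bool" where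
  "smooth_curve \<iota> C \<longleftrightarrow> function_field \<iota> \<and> C \<subseteq> places \<iota> \<and> finite (places \<iota> - C)"

definition projective_curve :: "('k::field \<Rightarrow> 'f::field) \<Rightarrow> ('f \<Rightarrow> int) set \<Rightarrow> bool" where
  "projective_curve \<iota> C \<longleftrightarrow> smooth_curve \<iota> C \<and> C = places \<iota>"

definition affine_curve :: "('k::field \<Rightarrow> 'f::field) \<Rightarrow> ('f \<Rightarrow> int) set \<Rightarrow> bool" where
  "affine_curve \<iota> C \<longleftrightarrow> smooth_curve \<iota> C \<and> C \<noteq> places \<iota>"

definition curve_iso ::
    "('k::field \<Rightarrow> 'f::field) \<Rightarrow> ('f \<Rightarrow> int) set \<Rightarrow> ('k \<Rightarrow> 'g::field) \<Rightarrow> ('g \<Rightarrow> int) set \<Rightarrow> bool" where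
  "curve_iso \<iota> C \<iota>' C' \<longleftrightarrow>
    (\<exists>\<phi>. bij \<phi> \<and> field_embedding \<phi> \<and> (\<forall>c. \<phi> (\<iota> c) = \<iota>' c) \<and> C = (\<lambda>z. z \<circ> \<phi>) ` C')"

text \<open>
  The projective and the affine line, with function field the field of rational functions
  \<open>\<bbbK>(t)\<close>, and the point at infinity with \<open>ord\<^sub>\<infinity> (p / q) = deg q - deg p\<close>.
\<close>

definition ratfun_const :: "'k::field \<Rightarrow> 'k poly fract" where
  "ratfun_const c = Fract [:c:] 1"

definition P1 :: "('k::field poly fract \<Rightarrow> int) set" where
  "P1 = places ratfun_const"

definition P1_infinity :: "'k::field poly fract \<Rightarrow> int" where
  "P1_infinity f = (if f = 0 then 0 else
     (THE k. \<exists>p q. p \<noteq> 0 \<and> q \<noteq> 0 \<and> f = Fract p q \<and> k = int (degree q) - int (degree p)))"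

definition A1 :: "('k::field poly fract \<Rightarrow> int) set" where
  "A1 = P1 - {P1_infinity}"

section \<open>Polyhedral divisors and their graded algebras\<close>

definition polyhedral_divisor ::
    "nat \<Rightarrow> (nat \<Rightarrow> rat) set \<Rightarrow> ('f \<Rightarrow> int) set \<Rightarrow> (('f \<Rightarrow> int) \<Rightarrow> (nat \<Rightarrow> rat) set) \<Rightarrow> bool" where
  "polyhedral_divisor n \<sigma> C D \<longleftrightarrow> (\<forall>z\<in>C. tailed n \<sigma> (D z)) \<and> finite {z \<in> C. D z \<noteq> \<sigma>}"

text \<open>All but finitely many summands of the degree equal \<open>\<sigma>\<close>, and \<open>\<sigma> + \<sigma> = \<sigma>\<close>.\<close>

definition pdiv_degree ::
    "(nat \<Rightarrow> rat) set \<Rightarrow> ('f \<Rightarrow> int) set \<Rightarrow> (('f \<Rightarrow> int) \<Rightarrow> (nat \<Rightarrow> rat) set) \<Rightarrow> (nat \<Rightarrow> rat) set" where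
  "pdiv_degree \<sigma> C D = (\<Sum>z\<in>{z \<in> C. D z \<noteq> \<sigma>}. D z) + \<sigma>"

definition proper_pdiv ::
    "('k::field \<Rightarrow> 'f::field) \<Rightarrow> nat \<Rightarrow> (nat \<Rightarrow> rat) set \<Rightarrow> ('f \<Rightarrow> int) set \<Rightarrow>
      (('f \<Rightarrow> int) \<Rightarrow> (nat \<Rightarrow> rat) set) \<Rightarrow> bool" where
  "proper_pdiv \<iota> n \<sigma> C D \<longleftrightarrow> polyhedral_divisor n \<sigma> C D \<and>
    (affine_curve \<iota> C \<or> projective_curve \<iota> C \<and> pdiv_degree \<sigma> C D \<subset> \<sigma>)"

text \<open>The minimum \<open>h\<^sub>z(m)\<close> over \<open>\<Delta>\<^sub>z\<close>; it exists for \<open>m\<close> in the dual of the tail cone.\<close>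

definition support_fun :: "nat \<Rightarrow> (nat \<Rightarrow> rat) set \<Rightarrow> (nat \<Rightarrow> int) \<Rightarrow> rat" where
  "support_fun n \<Delta> m = (LEAST q. \<exists>p\<in>\<Delta>. q = pairing n p m)"

definition pdiv_piece ::
    "nat \<Rightarrow> ('f::field \<Rightarrow> int) set \<Rightarrow> (('f \<Rightarrow> int) \<Rightarrow> (nat \<Rightarrow> rat) set) \<Rightarrow> (nat \<Rightarrow> int) \<Rightarrow> 'f set" where
  "pdiv_piece n C D m = {f. f = 0 \<or> (\<forall>z\<in>C. of_int (z f) + support_fun n (D z) m \<ge> 0)}"

text \<open>
  \<open>A[C, D]\<close> as a subalgebra of the group algebra \<open>\<bbbK>(C)[M]\<close>, whose product is the
  convolution product of finitely supported functions; \<open>f \<chi>\<^sup>m\<close> is \<open>Poly_Mapping.single m f\<close>.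
\<close>

definition pdiv_algebra ::
    "nat \<Rightarrow> (nat \<Rightarrow> rat) set \<Rightarrow> ('f::field \<Rightarrow> int) set \<Rightarrow> (('f \<Rightarrow> int) \<Rightarrow> (nat \<Rightarrow> rat) set) \<Rightarrow>
      ((nat \<Rightarrow> int) \<Rightarrow>\<^sub>0 'f) set" where
  "pdiv_algebra n \<sigma> C D =
    {a. Poly_Mapping.keys a \<subseteq> dual_lattice n \<sigma> \<and>
        (\<forall>m \<in> dual_lattice n \<sigma>. Poly_Mapping.lookup a m \<in> pdiv_piece n C D m)}"

definition group_alg_const :: "('k \<Rightarrow> 'f::zero) \<Rightarrow> 'k \<Rightarrow> ((nat \<Rightarrow> int) \<Rightarrow>\<^sub>0 'f)" where
  "group_alg_const \<iota> c = Poly_Mapping.single 0 (\<iota> c)"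

section \<open>Derivations and additive group actions\<close>

text \<open>
  Algebras over \<open>\<bbbK>\<close> are subsets \<open>A\<close> of an ambient commutative ring, with
  structure map \<open>\<kappa>\<close>; derivations and isomorphisms matter only on \<open>A\<close>.
\<close>

definition derivation_on :: "('k \<Rightarrow> 'r::comm_ring_1) \<Rightarrow> 'r set \<Rightarrow> ('r \<Rightarrow> 'r) \<Rightarrow> bool" where
  "derivation_on \<kappa> A \<delta> \<longleftrightarrow>
    (\<forall>a\<in>A. \<delta> a \<in> A) \<and>
    (\<forall>a\<in>A. \<forall>b\<in>A. \<delta> (a + b) = \<delta> a + \<delta> b) \<and>
    (\<forall>c. \<forall>a\<in>A. \<delta> (\<kappa> c * a) = \<kappa> c * \<delta> a) \<and>
    (\<forall>a\<in>A. \<forall>b\<in>A. \<delta> (a * b) = \<delta> a * b + a * \<delta> b)"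

definition lnd_on :: "('k \<Rightarrow> 'r::comm_ring_1) \<Rightarrow> 'r set \<Rightarrow> ('r \<Rightarrow> 'r) \<Rightarrow> bool" where
  "lnd_on \<kappa> A \<delta> \<longleftrightarrow> derivation_on \<kappa> A \<delta> \<and> (\<forall>a\<in>A. \<exists>k. (\<delta> ^^ k) a = 0)"

definition homogeneous_of_degree ::
    "((nat \<Rightarrow> int) \<Rightarrow>\<^sub>0 'f::zero) set \<Rightarrow> (((nat \<Rightarrow> int) \<Rightarrow>\<^sub>0 'f) \<Rightarrow> ((nat \<Rightarrow> int) \<Rightarrow>\<^sub>0 'f)) \<Rightarrow>
      (nat \<Rightarrow> int) \<Rightarrow> bool" where
  "homogeneous_of_degree A \<delta> e \<longleftrightarrow>
    (\<forall>m f. Poly_Mapping.single m f \<in> A \<longrightarrow>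
       (\<exists>g. \<delta> (Poly_Mapping.single m f) = Poly_Mapping.single (m + e) g))"

definition torus :: "nat \<Rightarrow> (nat \<Rightarrow> 'k::field) set" where
  "torus n = {t. \<forall>i<n. t i \<noteq> 0}"

definition torus_act ::
    "('k::field \<Rightarrow> 'f::field) \<Rightarrow> nat \<Rightarrow> (nat \<Rightarrow> 'k) \<Rightarrow> ((nat \<Rightarrow> int) \<Rightarrow>\<^sub>0 'f) \<Rightarrow> ((nat \<Rightarrow> int) \<Rightarrow>\<^sub>0 'f)" where
  "torus_act \<iota> n t a = Poly_Mapping.mapp (\<lambda>m f. \<iota> (\<Prod>i<n. t i powi m i) * f) a"

text \<open>
  Some \<open>a / b \<in> \<bbbK>(X)\<^sup>T\<close> has \<open>\<delta> (a / b) = (\<delta> a \<cdot> b - a \<cdot> \<delta> b) / b\<^sup>2 \<noteq> 0\<close>, where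
  \<open>\<bbbK>(X)\<close> is the field of fractions of the domain \<open>A\<close>; all denominators are cleared.
\<close>

definition horizontal ::
    "('k::field \<Rightarrow> 'f::field) \<Rightarrow> nat \<Rightarrow> ((nat \<Rightarrow> int) \<Rightarrow>\<^sub>0 'f) set \<Rightarrow>
      (((nat \<Rightarrow> int) \<Rightarrow>\<^sub>0 'f) \<Rightarrow> ((nat \<Rightarrow> int) \<Rightarrow>\<^sub>0 'f)) \<Rightarrow> bool" where
  "horizontal \<iota> n A \<delta> \<longleftrightarrow>
    (\<exists>a\<in>A. \<exists>b\<in>A. b \<noteq> 0 \<and>
      (\<forall>t\<in>torus n. torus_act \<iota> n t a * b = a * torus_act \<iota> n t b) \<and>
      \<delta> a * b \<noteq> a * \<delta> b)"

text \<open>The automorphism \<open>exp (s \<delta>)\<close> of the algebra.\<close>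

definition ga_action :: "('k::field_char_0 \<Rightarrow> 'r::comm_ring_1) \<Rightarrow> ('r \<Rightarrow> 'r) \<Rightarrow> 'k \<Rightarrow> 'r \<Rightarrow> 'r" where
  "ga_action \<kappa> \<delta> s a = (\<Sum>k | (\<delta> ^^ k) a \<noteq> 0. \<kappa> (s ^ k / fact k) * (\<delta> ^^ k) a)"

definition algebra_iso ::
    "('k \<Rightarrow> 'r::comm_ring_1) \<Rightarrow> 'r set \<Rightarrow> ('k \<Rightarrow> 's::comm_ring_1) \<Rightarrow> 's set \<Rightarrow> ('r \<Rightarrow> 's) \<Rightarrow> bool" where
  "algebra_iso \<kappa> A \<kappa>' B \<Phi> \<longleftrightarrow> bij_betw \<Phi> A B \<and>
    (\<forall>a\<in>A. \<forall>b\<in>A. \<Phi> (a + b) = \<Phi> a + \<Phi> b) \<and>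
    (\<forall>a\<in>A. \<forall>b\<in>A. \<Phi> (a * b) = \<Phi> a * \<Phi> b) \<and>
    (\<forall>c. \<Phi> (\<kappa> c) = \<kappa>' c)"

text \<open>Compatibility with the grading, \<open>H m\<close> being the part of degree \<open>m\<close> of the target.\<close>

definition graded_map ::
    "((nat \<Rightarrow> int) \<Rightarrow>\<^sub>0 'f::zero) set \<Rightarrow> ((nat \<Rightarrow> int) \<Rightarrow> 's set) \<Rightarrow> (((nat \<Rightarrow> int) \<Rightarrow>\<^sub>0 'f) \<Rightarrow> 's) \<Rightarrow> bool" where
  "graded_map A H \<Phi> \<longleftrightarrow>
    (\<forall>m f. Poly_Mapping.single m f \<in> A \<longrightarrow> \<Phi> (Poly_Mapping.single m f) \<in> H m)"

section \<open>Affine toric varieties and Demazure roots\<close>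

definition toric_algebra :: "nat \<Rightarrow> (nat \<Rightarrow> rat) set \<Rightarrow> ((nat \<Rightarrow> int) \<Rightarrow>\<^sub>0 'k::zero) set" where
  "toric_algebra r \<tau> = {a. Poly_Mapping.keys a \<subseteq> dual_lattice r \<tau>}"

text \<open>
  The coordinate algebra \<open>\<bbbK>[Y][x]\<close> of \<open>Y \<times> \<bbbA>\<^sup>1\<close>, where \<open>Y\<close> is the toric variety of
  the cone \<open>\<tau>\<close>.
\<close>

definition toric_times_line :: "nat \<Rightarrow> (nat \<Rightarrow> rat) set \<Rightarrow> ((nat \<Rightarrow> int) \<Rightarrow>\<^sub>0 'k::zero) poly set" where
  "toric_times_line r \<tau> = {p. \<forall>i. coeff p i \<in> toric_algebra r \<tau>}"

definition cone_faces :: "nat \<Rightarrow> (nat \<Rightarrow> rat) set \<Rightarrow> (nat \<Rightarrow> rat) set set" where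
  "cone_faces r \<tau> = {{v \<in> \<tau>. pairing r v m = 0} | m. m \<in> dual_lattice r \<tau>}"

text \<open>The primitive lattice vectors on the rays, i.e. on the one-dimensional faces.\<close>

definition ray_generators :: "nat \<Rightarrow> (nat \<Rightarrow> rat) set \<Rightarrow> (nat \<Rightarrow> int) set" where
  "ray_generators r \<tau> =
    {w \<in> int_lattice r. Gcd (w ` {..<r}) = 1 \<and> cone_hull {rat_vec w} \<in> cone_faces r \<tau>}"

definition demazure_root ::
    "nat \<Rightarrow> (nat \<Rightarrow> rat) set \<Rightarrow> (nat \<Rightarrow> int) \<Rightarrow> (nat \<Rightarrow> int) \<Rightarrow> bool" where
  "demazure_root r \<tau> w e \<longleftrightarrow>
    e \<in> int_lattice r \<and> w \<in> ray_generators r \<tau> \<and> pairing r w e = - 1 \<and>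
    (\<forall>w' \<in> ray_generators r \<tau> - {w}. pairing r w' e \<ge> 0)"

definition demazure_lnd ::
    "nat \<Rightarrow> (nat \<Rightarrow> int) \<Rightarrow> (nat \<Rightarrow> int) \<Rightarrow> ((nat \<Rightarrow> int) \<Rightarrow>\<^sub>0 'k::comm_ring_1) \<Rightarrow> ((nat \<Rightarrow> int) \<Rightarrow>\<^sub>0 'k)" where
  "demazure_lnd r w e a =
    (\<Sum>m\<in>Poly_Mapping.keys a.
       Poly_Mapping.single (m + e) (of_int (pairing r w m) * Poly_Mapping.lookup a m))"

definition extended_cone :: "nat \<Rightarrow> (nat \<Rightarrow> rat) set \<Rightarrow> (nat \<Rightarrow> rat) set \<Rightarrow> (nat \<Rightarrow> rat) set" where
  "extended_cone n \<sigma> \<Delta> =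
    cone_hull ((\<lambda>v. v(n := 0)) ` \<sigma> \<union> (\<lambda>p. p(n := - 1)) ` \<Delta> \<union> {0(n := 1)})"

end

theory Submission
  imports Defs
begin

text \<open>
  A homogeneous derivation of degree zero maps the coefficients \<open>P m\<close> of every degree \<open>m\<close> to
  themselves. By the quotient rule it extends to a derivation \<open>E\<close> of \<open>\<bbbK>(C) = \<bbbK>(t)\<close>, which is
  nonzero: an invariant quotient \<open>a / b\<close> has proportional coefficients
  (\<open>invariant_quotient_proportional\<close>), so by horizontality some quotient of two elements of one piece
  is not killed. The kernel of \<open>E\<close> consists of the constants, by a vanishing Wronskian.

  On a suitable piece the derivation is nilpotent and nonzero, so there are \<open>f0\<close>, \<open>f1\<close> with
  \<open>f1 \<mapsto> f0 \<mapsto> 0\<close>, and \<open>q = f1 / f0\<close> is a slice, \<open>E q = 1\<close>. All elements of the piece are \<open>f0\<close> times a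
  polynomial in \<open>q\<close>, which makes \<open>q\<close> a coordinate of \<open>\<bbbK>(t)\<close> (\<open>slice_coordinate\<close>). In this
  coordinate the nonzero pieces are \<open>u m\<close> times all polynomials (affine line) or times the polynomials
  of degree at most \<open>N m\<close> (projective line), where \<open>u m\<close> is the rational function whose orders at the
  finite points are the least admissible ones. On the polynomials the derivation is
  \<open>p \<mapsto> p' + g p\<close> with a polynomial \<open>g\<close> depending on \<open>m\<close>, and it is nilpotent only if \<open>g = 0\<close>
  (\<open>generator_in_kernel\<close>). Hence \<open>E\<close> becomes \<open>d/dq\<close> and all \<open>u m\<close> are killed; a product of two of
  them is killed too, so it differs from the generator of its piece by a constant
  (\<open>product_of_generators\<close>). Comparison of orders shows that the rounded support functions at the
  finite points are additive.

  Over the affine line the slice is taken in degree zero, which makes \<open>q\<close> a coordinate of the curve as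
  well (\<open>affine_coordinate\<close>). Additivity holds for all degrees, so \<open>u m\<close> is multiplicative in \<open>m\<close> and the algebra
  is the polynomial ring in \<open>q\<close> over the semigroup algebra of the dual cone, with \<open>d/dq\<close> acting by
  translations.

  Over the projective line additivity is known only where the pieces are nonzero. Passing to suitable multiples
  \<open>k m\<close>, which are not rounded, and to sums \<open>m + j m1\<close> with a degree \<open>m1\<close> of large piece extends it:
  the support functions at the finite points are integral and additive everywhere (locale
  \<open>rounded_additive\<close>). An additive integral function on the dual cone is the pairing with a lattice
  vector \<open>p\<close> (\<open>additive_function_is_pairing\<close>), so the divisor is equivalent to the one
  concentrated at infinity with \<open>\<Delta> = \<Delta>\<^sub>\<infinity> + p\<close>. Properness gives a nonnegative support
  function, whence \<open>\<Delta> \<subseteq> \<sigma>\<close> by \<open>farkas\<close>, and \<open>\<Delta> \<noteq> \<sigma>\<close> because the piece of degree \<open>m1\<close> is large.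
  The characters in the dual of the extended cone are \<open>(m, k)\<close> with \<open>0 \<le> k\<close> bounded by the support
  function of \<open>\<Delta>\<close> (\<open>dual_extended_cone\<close>). They correspond to the elements \<open>u m q\<^sup>k\<close>, on which
  \<open>d/dq\<close> is the derivation of the Demazure root \<open>(0, - 1)\<close>.

  All algebras that occur are compared with the algebra of families of polynomials \<open>g m\<close>, one for
  each degree (\<open>graded_polys\<close>), in which the product is that of polynomials and degrees, and from
  which every isomorphism is an evaluation (locale \<open>graded_evaluation\<close>).
\<close>

section \<open>Rational polyhedral cones\<close>

definition dot :: "nat \<Rightarrow> (nat \<Rightarrow> rat) \<Rightarrow> (nat \<Rightarrow> rat) \<Rightarrow> rat" where
  "dot n v u = (\<Sum>i<n. v i * u i)"

definition scale_vec :: "rat \<Rightarrow> (nat \<Rightarrow> rat) \<Rightarrow> nat \<Rightarrow> rat" where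
  "scale_vec c v = (\<lambda>i. c * v i)"

lemma scale_vec_apply [simp]: "scale_vec c v i = c * v i"
  by (simp add: scale_vec_def)

lemma scale_vec_simps [simp]:
  "scale_vec 0 v = 0" "scale_vec c 0 = 0" "scale_vec 1 v = v"
  "scale_vec c (scale_vec d v) = scale_vec (c * d) v"
  by (simp_all add: fun_eq_iff)

lemma scale_vec_add: "scale_vec c (v + w) = scale_vec c v + scale_vec c w"
  by (simp add: fun_eq_iff algebra_simps)

lemma scale_vec_add_left: "scale_vec (c + d) v = scale_vec c v + scale_vec d v"
  by (simp add: fun_eq_iff algebra_simps)

lemma dot_simps [simp]:
  "dot n 0 u = 0" "dot n v 0 = 0"
  "dot n (scale_vec c v) u = c * dot n v u" "dot n v (scale_vec c u) = c * dot n v u"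
  by (simp_all add: dot_def sum_distrib_left mult_ac)

lemma dot_add: "dot n (v + w) u = dot n v u + dot n w u" "dot n u (v + w) = dot n u v + dot n u w"
  by (simp_all add: dot_def sum.distrib algebra_simps)

lemma dot_commute: "dot n v u = dot n u v"
  by (simp add: dot_def mult.commute)

lemma dot_sum: "dot n (\<lambda>i. \<Sum>s\<in>S. c s * s i) u = (\<Sum>s\<in>S. c s * dot n s u)"
  unfolding dot_def sum_distrib_right sum_distrib_left
  by (subst sum.swap) (simp add: mult_ac)

lemma pairing_eq_dot: "pairing n v m = dot n v (rat_vec m)"
  by (simp add: pairing_def dot_def rat_vec_def)

lemma rat_space_closed:
  "0 \<in> rat_space n" "v \<in> rat_space n \<Longrightarrow> w \<in> rat_space n \<Longrightarrow> v + w \<in> rat_space n"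
  "v \<in> rat_space n \<Longrightarrow> scale_vec c v \<in> rat_space n"
  by (simp_all add: rat_space_def)

lemma rat_space_uminus: "- v \<in> rat_space n \<longleftrightarrow> v \<in> rat_space n"
  by (simp add: rat_space_def)

text \<open>
  Lattice points can therefore stand in for rational normal vectors of halfspaces, since a positive
  factor does not change the halfspace.
\<close>

lemma rat_vec_clear_denominators:
  assumes "u \<in> rat_space n"
  obtains k m where "k > 0" "m \<in> int_lattice n" "rat_vec m = scale_vec k u"
proof -
  define f where "f i = snd (quotient_of (u i))" for i
  have f_pos: "f i > 0" for i
    by (simp add: f_def quotient_of_denom_pos')
  have u: "u i * of_int (f i) = of_int (fst (quotient_of (u i)))" for i
    using quotient_of_div[of "u i" "fst (quotient_of (u i))" "f i"] f_pos[of i]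
    by (simp add: f_def field_simps)
  define k where "k = (\<Prod>i<n. f i)"
  have k: "k > 0"
    unfolding k_def using f_pos by (intro prod_pos) auto
  have "\<exists>z. u i * of_int k = of_int z" for i
  proof (cases "i < n")
    case True
    then have "f i dvd k"
      unfolding k_def by (intro dvd_prodI) auto
    then obtain l where "k = f i * l" ..
    then have "u i * of_int k = of_int (fst (quotient_of (u i)) * l)"
      using u[of i] by (simp add: mult.assoc[symmetric])
    then show ?thesis ..
  next
    case False
    then have "u i = 0"
      using assms by (auto simp: rat_space_def)
    then show ?thesis
      by (intro exI[of _ 0]) simp
  qed
  then obtain m where m: "u i * of_int k = of_int (m i)" for i
    by metis
  show thesis
  proof
    show "of_int k > (0 :: rat)"
      using k by simp
    show "m \<in> int_lattice n"
      using m assms by (auto simp: int_lattice_def rat_space_def) (metis mult_zero_left of_int_eq_0_iff)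
    show "rat_vec m = scale_vec (of_int k) u"
      by (simp add: fun_eq_iff rat_vec_def m[symmetric] mult.commute)
  qed
qed

lemma cone_hull_closed:
  "0 \<in> cone_hull G" "v \<in> cone_hull G \<Longrightarrow> w \<in> cone_hull G \<Longrightarrow> v + w \<in> cone_hull G"
  "c \<ge> 0 \<Longrightarrow> v \<in> cone_hull G \<Longrightarrow> scale_vec c v \<in> cone_hull G"
proof -
  show "0 \<in> cone_hull G"
    unfolding cone_hull_def by (auto intro!: exI[of _ "{}"] simp: fun_eq_iff)
  show "scale_vec c v \<in> cone_hull G" if "c \<ge> 0" "v \<in> cone_hull G"
  proof -
    from that(2) obtain S d where S: "finite S" "S \<subseteq> G" "\<forall>s\<in>S. d s \<ge> 0" "v = (\<lambda>i. \<Sum>s\<in>S. d s * s i)"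
      unfolding cone_hull_def by blast
    show ?thesis
      unfolding cone_hull_def
      using S that(1)
      by (auto intro!: exI[of _ S] exI[of _ "\<lambda>s. c * d s"] simp: fun_eq_iff sum_distrib_left mult_ac)
  qed
  show "v + w \<in> cone_hull G" if vw: "v \<in> cone_hull G" "w \<in> cone_hull G"
  proof -
    from vw(1) obtain S c where S: "finite S" "S \<subseteq> G" "\<forall>s\<in>S. c s \<ge> 0" "v = (\<lambda>i. \<Sum>s\<in>S. c s * s i)"
      unfolding cone_hull_def by blast
    from vw(2) obtain T d where T: "finite T" "T \<subseteq> G" "\<forall>s\<in>T. d s \<ge> 0" "w = (\<lambda>i. \<Sum>s\<in>T. d s * s i)"
      unfolding cone_hull_def by blast
    let ?c = "\<lambda>s. (if s \<in> S then c s else 0) + (if s \<in> T then d s else 0)"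
    have "v i + w i = (\<Sum>s\<in>S \<union> T. ?c s * s i)" for i
    proof -
      have "v i = (\<Sum>s\<in>S \<union> T. (if s \<in> S then c s else 0) * s i)"
        unfolding S(4) using S T by (intro sum.mono_neutral_cong_left) auto
      moreover have "w i = (\<Sum>s\<in>S \<union> T. (if s \<in> T then d s else 0) * s i)"
        unfolding T(4) using S T by (intro sum.mono_neutral_cong_left) auto
      ultimately show ?thesis
        by (simp add: sum.distrib distrib_right)
    qed
    then show ?thesis
      unfolding cone_hull_def
      using S T by (auto intro!: exI[of _ "S \<union> T"] exI[of _ ?c] simp: fun_eq_iff)
  qed
qed

lemma cone_hull_superset: "G \<subseteq> cone_hull G"
proof
  fix g assume "g \<in> G"
  then show "g \<in> cone_hull G"
    unfolding cone_hull_def by (auto intro!: exI[of _ "{g}"] exI[of _ "\<lambda>_. 1"])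
qed

definition convex_cone :: "(nat \<Rightarrow> rat) set \<Rightarrow> bool" where
  "convex_cone X \<longleftrightarrow> 0 \<in> X \<and> (\<forall>v\<in>X. \<forall>w\<in>X. v + w \<in> X) \<and> (\<forall>c\<ge>0. \<forall>v\<in>X. scale_vec c v \<in> X)"

lemma convex_cone_cone_hull: "convex_cone (cone_hull G)"
  by (simp add: convex_cone_def cone_hull_closed)

lemma cone_hull_minimal:
  assumes "G \<subseteq> X" "convex_cone X"
  shows "cone_hull G \<subseteq> X"
proof
  fix v assume "v \<in> cone_hull G"
  then obtain S c where S: "finite S" "S \<subseteq> G" "\<forall>s\<in>S. c s \<ge> 0" "v = (\<lambda>i. \<Sum>s\<in>S. c s * s i)"
    unfolding cone_hull_def by blast
  from S(1-3) have "(\<lambda>i. \<Sum>s\<in>S. c s * s i) \<in> X"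
  proof (induction S rule: finite_induct)
    case empty
    then show ?case
      using assms by (simp add: convex_cone_def zero_fun_def)
  next
    case (insert s S)
    have "(\<lambda>i. \<Sum>s\<in>insert s S. c s * s i) = scale_vec (c s) s + (\<lambda>i. \<Sum>s\<in>S. c s * s i)"
      using insert by (simp add: fun_eq_iff)
    moreover have "s \<in> X" "(\<lambda>i. \<Sum>s\<in>S. c s * s i) \<in> X" "c s \<ge> 0"
      using insert assms by auto
    ultimately show ?case
      using assms(2) by (simp add: convex_cone_def)
  qed
  then show "v \<in> X"
    by (simp add: S)
qed

lemma convex_cone_rat_space: "convex_cone (rat_space n)"
  by (simp add: convex_cone_def rat_space_closed)

lemma convex_cone_halfspace: "convex_cone {v. dot n v u \<ge> 0}"
  by (auto simp: convex_cone_def dot_add)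

lemma cone_hull_insert:
  "v \<in> cone_hull (insert g G) \<longleftrightarrow> (\<exists>w\<in>cone_hull G. \<exists>t\<ge>0. v = w + scale_vec t g)"
proof
  let ?X = "{v. \<exists>w\<in>cone_hull G. \<exists>t\<ge>0. v = w + scale_vec t g}"
  have X: "w + scale_vec t g \<in> ?X" if "w \<in> cone_hull G" "t \<ge> 0" for w t
    using that by blast
  have "convex_cone ?X"
    unfolding convex_cone_def
  proof (intro conjI ballI allI impI)
    show "0 \<in> ?X"
      using X[of 0 0] by (simp add: cone_hull_closed)
    fix v assume "v \<in> ?X"
    then obtain a t where a: "a \<in> cone_hull G" "t \<ge> 0" "v = a + scale_vec t g"
      by blast
    {
      fix w assume "w \<in> ?X"
      then obtain b s where b: "b \<in> cone_hull G" "s \<ge> 0" "w = b + scale_vec s g"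
        by blast
      show "v + w \<in> ?X"
        using X[of "a + b" "t + s"] a b by (simp add: cone_hull_closed scale_vec_add_left algebra_simps)
    next
      fix c :: rat assume "c \<ge> 0"
      then show "scale_vec c v \<in> ?X"
        using X[of "scale_vec c a" "c * t"] a by (simp add: cone_hull_closed scale_vec_add)
    }
  qed
  moreover have "insert g G \<subseteq> ?X"
  proof -
    have "g \<in> ?X"
      using X[of 0 1] by (simp add: cone_hull_closed)
    moreover have "a \<in> ?X" if "a \<in> G" for a
      using X[of a 0] that cone_hull_superset[of G] by auto
    ultimately show ?thesis
      by blast
  qed
  ultimately have "cone_hull (insert g G) \<subseteq> ?X"
    by (rule cone_hull_minimal[rotated])
  then show "v \<in> cone_hull (insert g G) \<Longrightarrow> \<exists>w\<in>cone_hull G. \<exists>t\<ge>0. v = w + scale_vec t g"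
    by blast
next
  assume "\<exists>w\<in>cone_hull G. \<exists>t\<ge>0. v = w + scale_vec t g"
  then obtain w t where "w \<in> cone_hull G" "t \<ge> 0" "v = w + scale_vec t g"
    by blast
  moreover have "cone_hull G \<subseteq> cone_hull (insert g G)"
    using cone_hull_superset[of "insert g G"] by (intro cone_hull_minimal convex_cone_cone_hull) auto
  ultimately show "v \<in> cone_hull (insert g G)"
    using cone_hull_superset[of "insert g G"] by (simp add: cone_hull_closed subset_iff)
qed

text \<open>
  Weyl: adding a generator \<open>g\<close> means eliminating the coefficient \<open>t\<close> of \<open>g\<close> from the
  inequalities \<open>t \<langle>g, u\<rangle> \<le> \<langle>v, u\<rangle>\<close>, which Fourier--Motzkin elimination does: every lower
  bound for \<open>t\<close> has to lie below every upper bound.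
\<close>

lemma eliminate_generator:
  assumes "finite H"
  shows "(\<exists>t\<ge>0. \<forall>u\<in>H. dot n v u \<ge> t * dot n g u) \<longleftrightarrow>
    (\<forall>u\<in>H. dot n g u \<ge> 0 \<longrightarrow> dot n v u \<ge> 0) \<and>
    (\<forall>u\<in>H. \<forall>w\<in>H. dot n g u > 0 \<longrightarrow> dot n g w < 0 \<longrightarrow>
       dot n v u * dot n g w \<le> dot n v w * dot n g u)" (is "?L \<longleftrightarrow> ?R")
proof
  assume ?L
  then obtain t where t: "t \<ge> 0" "\<And>u. u \<in> H \<Longrightarrow> dot n v u \<ge> t * dot n g u"
    by blast
  show ?R
  proof (intro conjI ballI impI)
    fix u assume "u \<in> H" "dot n g u \<ge> 0"
    then show "dot n v u \<ge> 0"
      using t by (meson mult_nonneg_nonneg order_trans)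
  next
    fix u w assume uw: "u \<in> H" "w \<in> H" "dot n g u > 0" "dot n g w < 0"
    have "dot n v u * dot n g w \<le> (t * dot n g u) * dot n g w"
      using t(2)[OF uw(1)] uw(4) by (intro mult_right_mono_neg) auto
    also have "\<dots> = (t * dot n g w) * dot n g u"
      by simp
    also have "\<dots> \<le> dot n v w * dot n g u"
      using t(2)[OF uw(2)] uw(3) by (intro mult_right_mono) auto
    finally show "dot n v u * dot n g w \<le> dot n v w * dot n g u" .
  qed
next
  assume R: ?R
  \<comment> \<open>The largest of the lower bounds works.\<close>
  define B where "B = insert 0 ((\<lambda>w. dot n v w / dot n g w) ` {w\<in>H. dot n g w < 0})"
  have B: "finite B" "B \<noteq> {}"
    using assms by (auto simp: B_def)
  define t where "t = Max B"
  have t0: "t \<ge> 0"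
    unfolding t_def using B by (intro Max_ge) (auto simp: B_def)
  have tB: "t \<in> B"
    unfolding t_def using B by (rule Max_in)
  have "dot n v u \<ge> t * dot n g u" if u: "u \<in> H" for u
  proof -
    consider "dot n g u < 0" | "dot n g u = 0" | "dot n g u > 0"
      by linarith
    then show ?thesis
    proof cases
      case 1
      then have "dot n v u / dot n g u \<le> t"
        unfolding t_def using B u by (intro Max_ge) (auto simp: B_def)
      then show ?thesis
        using 1 by (simp add: neg_divide_le_eq)
    next
      case 2
      then show ?thesis
        using R u by auto
    next
      case 3
      show ?thesis
      proof (cases "t = 0")
        case True
        then show ?thesis
          using R u 3 by auto
      next
        case False
        then obtain w where w: "w \<in> H" "dot n g w < 0" "t = dot n v w / dot n g w"
          using tB by (auto simp: B_def)
        have "dot n v u * dot n g w \<le> dot n v w * dot n g u"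
          using R u w 3 by auto
        then show ?thesis
          using w(2) by (simp add: w(3) neg_divide_le_eq mult.commute)
      qed
    qed
  qed
  then show ?L
    using t0 by blast
qed

text \<open>
  By induction on the generators: the conditions left over by the elimination of the new coefficient
  are again linear inequalities.
\<close>

theorem finitely_generated_cone_is_intersection_of_halfspaces:
  assumes "finite G" "G \<subseteq> rat_space n"
  shows "\<exists>H. finite H \<and> H \<subseteq> rat_space n \<and> cone_hull G = {v \<in> rat_space n. \<forall>u\<in>H. dot n v u \<ge> 0}"
  using assms
proof (induction G rule: finite_induct)
  case empty
  \<comment> \<open>The zero cone is cut out by the functionals given by plus and minus the unit vectors.\<close>
  define e where "e c = (\<lambda>i::nat. (0 :: nat \<Rightarrow> rat)(i := c))" for c :: rat
  let ?H = "e 1 ` {..<n} \<union> e (-1) ` {..<n}"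
  have dot_e: "dot n v (e c i) = c * v i" if "i < n" for v c i
  proof -
    have "dot n v (e c i) = (\<Sum>j<n. if j = i then c * v i else 0)"
      unfolding dot_def e_def by (rule sum.cong) auto
    then show ?thesis
      using that by simp
  qed
  have "cone_hull {} = {0}"
    using cone_hull_minimal[of "{}" "{0}"] cone_hull_closed(1)[of "{}"] by (auto simp: convex_cone_def)
  also have "\<dots> = {v \<in> rat_space n. \<forall>u\<in>?H. dot n v u \<ge> 0}"
  proof (intro equalityI subsetI)
    fix v assume v: "v \<in> {v \<in> rat_space n. \<forall>u\<in>?H. dot n v u \<ge> 0}"
    have "v i = 0" for i
    proof (cases "i < n")
      case True
      then have "dot n v (e 1 i) \<ge> 0" "dot n v (e (-1) i) \<ge> 0"
        using v by auto
      then show ?thesis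
        using True by (simp add: dot_e)
    next
      case False
      then show ?thesis
        using v by (auto simp: rat_space_def)
    qed
    then show "v \<in> {0}"
      by (auto simp: fun_eq_iff)
  qed (auto simp: rat_space_closed)
  finally show ?case
    by (intro exI[of _ ?H]) (auto simp: rat_space_def e_def)
next
  case (insert g G)
  then obtain H where H: "finite H" "H \<subseteq> rat_space n"
      "cone_hull G = {v \<in> rat_space n. \<forall>u\<in>H. dot n v u \<ge> 0}"
    by auto
  have g: "g \<in> rat_space n"
    using insert by simp
  \<comment> \<open>The halfspace that compares the lower bound of \<open>w\<close> with the upper bound of \<open>u\<close>.\<close>
  define c where "c = (\<lambda>(u, w). scale_vec (dot n g u) w + scale_vec (- dot n g w) u)"
  define P where "P = {(u, w). u \<in> H \<and> w \<in> H \<and> dot n g u > 0 \<and> dot n g w < 0}"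
  let ?H = "{u\<in>H. dot n g u \<ge> 0} \<union> c ` P"
  have finP: "finite P"
    by (rule finite_subset[of _ "H \<times> H"]) (use H in \<open>auto simp: P_def\<close>)
  have cond: "(\<forall>u\<in>?H. dot n v u \<ge> 0) \<longleftrightarrow> (\<exists>t\<ge>0. \<forall>u\<in>H. dot n v u \<ge> t * dot n g u)" for v
  proof -
    have "(\<forall>u\<in>?H. dot n v u \<ge> 0) \<longleftrightarrow> (\<forall>u\<in>H. dot n g u \<ge> 0 \<longrightarrow> dot n v u \<ge> 0) \<and>
        (\<forall>x\<in>P. dot n v (c x) \<ge> 0)"
      by auto
    also have "(\<forall>x\<in>P. dot n v (c x) \<ge> 0) \<longleftrightarrow> (\<forall>u\<in>H. \<forall>w\<in>H. dot n g u > 0 \<longrightarrow> dot n g w < 0 \<longrightarrow>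
       dot n v u * dot n g w \<le> dot n v w * dot n g u)"
      by (simp add: P_def c_def dot_add mult_ac) blast
    finally show ?thesis
      unfolding eliminate_generator[OF H(1)] .
  qed
  have "v \<in> cone_hull (insert g G) \<longleftrightarrow> v \<in> rat_space n \<and> (\<forall>u\<in>?H. dot n v u \<ge> 0)" for v
  proof -
    have "v \<in> cone_hull (insert g G) \<longleftrightarrow> (\<exists>t\<ge>0. v + scale_vec (- t) g \<in> cone_hull G)"
    proof -
      have "v = w + scale_vec t g \<longleftrightarrow> w = v + scale_vec (- t) g" for w t
        by (auto simp: fun_eq_iff)
      then show ?thesis
        unfolding cone_hull_insert by auto
    qed
    also have "\<dots> \<longleftrightarrow> v \<in> rat_space n \<and> (\<exists>t\<ge>0. \<forall>u\<in>H. dot n v u \<ge> t * dot n g u)"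
    proof -
      have "v + scale_vec (- t) g \<in> rat_space n \<longleftrightarrow> v \<in> rat_space n" for t
        using g by (auto simp: rat_space_def)
      then show ?thesis
        by (auto simp: H(3) dot_add)
    qed
    finally show ?thesis
      unfolding cond .
  qed
  then have "cone_hull (insert g G) = {v \<in> rat_space n. \<forall>u\<in>?H. dot n v u \<ge> 0}"
    by blast
  moreover have "c x \<in> rat_space n" if "x \<in> P" for x
    using that H(2) by (auto simp: c_def P_def intro!: rat_space_closed)
  then have "?H \<subseteq> rat_space n"
    using H by auto
  ultimately show ?case
    using H finP by (intro exI[of _ ?H]) simp
qed

text \<open>Minkowski's converse follows from Weyl's theorem, applied to the cone of the normal vectors.\<close>

theorem intersection_of_halfspaces_is_finitely_generated:
  assumes "finite H" "H \<subseteq> rat_space n"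
  shows "\<exists>G. finite G \<and> G \<subseteq> rat_space n \<and> {v \<in> rat_space n. \<forall>u\<in>H. dot n v u \<ge> 0} = cone_hull G"
proof -
  obtain G where G: "finite G" "G \<subseteq> rat_space n"
      "cone_hull H = {v \<in> rat_space n. \<forall>u\<in>G. dot n v u \<ge> 0}"
    using finitely_generated_cone_is_intersection_of_halfspaces[OF assms] by blast
  obtain K where K: "finite K" "K \<subseteq> rat_space n"
      "cone_hull G = {v \<in> rat_space n. \<forall>u\<in>K. dot n v u \<ge> 0}"
    using finitely_generated_cone_is_intersection_of_halfspaces[OF G(1,2)] by blast
  let ?X = "{v \<in> rat_space n. \<forall>u\<in>H. dot n v u \<ge> 0}"
  have "?X \<subseteq> cone_hull G"
  proof
    fix v assume v: "v \<in> ?X"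
    have "dot n v u \<ge> 0" if u: "u \<in> K" for u
    proof -
      have "dot n u g \<ge> 0" if "g \<in> G" for g
        using that u K(3) cone_hull_superset[of G] by (auto simp: dot_commute[of n u])
      then have "u \<in> cone_hull H"
        using u K(2) by (auto simp: G(3))
      moreover have "cone_hull H \<subseteq> {u. dot n u v \<ge> 0}"
        using v by (intro cone_hull_minimal convex_cone_halfspace) (auto simp: dot_commute[of n v])
      ultimately show ?thesis
        by (auto simp: dot_commute[of n v])
    qed
    then show "v \<in> cone_hull G"
      using v K by auto
  qed
  moreover have "cone_hull G \<subseteq> ?X"
  proof (rule cone_hull_minimal)
    show "G \<subseteq> ?X"
    proof
      fix x assume x: "x \<in> G"
      then have "dot n x u \<ge> 0" if "u \<in> H" for u
        using that G(3) cone_hull_superset[of H] by (auto simp: dot_commute[of n x])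
      then show "x \<in> ?X"
        using x G(2) by auto
    qed
    show "convex_cone ?X"
      by (auto simp: convex_cone_def rat_space_closed dot_add)
  qed
  ultimately show ?thesis
    using G by (intro exI[of _ G]) auto
qed

text \<open>
  The cone is an intersection of halfspaces, whose normal vectors, cleared of denominators, are
  lattice points of the dual cone; it suffices to test against those.
\<close>

theorem farkas:
  assumes "polyhedral_cone n \<sigma>" "v \<in> rat_space n" "\<And>m. m \<in> dual_lattice n \<sigma> \<Longrightarrow> pairing n v m \<ge> 0"
  shows "v \<in> \<sigma>"
proof -
  obtain G where G: "finite G" "G \<subseteq> rat_space n" "\<sigma> = cone_hull G"
    using assms(1) unfolding polyhedral_cone_def by blast
  obtain H where H: "finite H" "H \<subseteq> rat_space n" "\<sigma> = {v \<in> rat_space n. \<forall>u\<in>H. dot n v u \<ge> 0}"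
    using finitely_generated_cone_is_intersection_of_halfspaces[OF G(1,2)] G(3) by blast
  have "dot n v u \<ge> 0" if "u \<in> H" for u
  proof -
    obtain k m where m: "k > 0" "m \<in> int_lattice n" "rat_vec m = scale_vec k u"
      using rat_vec_clear_denominators[of u n] \<open>u \<in> H\<close> H by blast
    have "m \<in> dual_lattice n \<sigma>"
      using m \<open>u \<in> H\<close> unfolding dual_lattice_def H(3) pairing_eq_dot by auto
    then have "k * dot n v u \<ge> 0"
      using assms(3)[of m] m(3) by (simp add: pairing_eq_dot)
    then show ?thesis
      using m(1) by (simp add: zero_le_mult_iff)
  qed
  then show ?thesis
    using assms(2) by (auto simp: H(3))
qed

lemma polyhedral_cone_convex:
  assumes "polyhedral_cone n \<sigma>"
  shows "convex_cone \<sigma>" "\<sigma> \<subseteq> rat_space n"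
proof -
  obtain G where G: "G \<subseteq> rat_space n" "\<sigma> = cone_hull G"
    using assms unfolding polyhedral_cone_def by blast
  show "convex_cone \<sigma>"
    by (simp add: G(2) convex_cone_cone_hull)
  show "\<sigma> \<subseteq> rat_space n"
    unfolding G(2) by (rule cone_hull_minimal[OF G(1) convex_cone_rat_space])
qed

lemma convex_coneD:
  assumes "convex_cone X"
  shows "0 \<in> X" "v \<in> X \<Longrightarrow> w \<in> X \<Longrightarrow> v + w \<in> X" "c \<ge> 0 \<Longrightarrow> v \<in> X \<Longrightarrow> scale_vec c v \<in> X"
  using assms by (auto simp: convex_cone_def)

lemma pairing_add_left: "pairing n (v + w) m = pairing n v m + pairing n w m"
  by (simp add: pairing_def sum.distrib algebra_simps)

lemma pairing_diff_left: "pairing n (v - w) m = pairing n v m - pairing n w m"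
  by (simp add: pairing_def sum_subtractf algebra_simps)

lemma pairing_add_right: "pairing n v (m + m') = pairing n v m + pairing n v m'"
  by (simp add: pairing_def sum.distrib algebra_simps)

lemma pairing_scale_left: "pairing n (scale_vec c v) m = c * pairing n v m"
  by (simp add: pairing_eq_dot)

lemma pairing_scale_right: "pairing n v (\<lambda>i. k * m i) = of_int k * pairing n v m"
  by (simp add: pairing_def sum_distrib_left mult_ac)

lemma pairing_zero [simp]: "pairing n 0 m = 0" "pairing n v 0 = 0"
  by (simp_all add: pairing_def)

lemma pairing_rat_vec: "pairing n (rat_vec p) m = of_int (pairing n p m)"
  by (simp add: pairing_def rat_vec_def)

lemma dual_lattice_closed:
  "0 \<in> dual_lattice n \<tau>"
  "m \<in> dual_lattice n \<tau> \<Longrightarrow> m' \<in> dual_lattice n \<tau> \<Longrightarrow> m + m' \<in> dual_lattice n \<tau>"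
  "m \<in> dual_lattice n \<tau> \<Longrightarrow> k \<ge> 0 \<Longrightarrow> (\<lambda>i. k * m i) \<in> dual_lattice n \<tau>"
  by (auto simp: dual_lattice_def int_lattice_def pairing_add_right pairing_scale_right)

lemma dot_Suc_upd: "dot (Suc n) (v(n := s)) (u(n := a)) = dot n v u + s * a"
  by (simp add: dot_def)

section \<open>Polyhedra and support functions\<close>

text \<open>
  The cone over a bounded polyhedron \<open>P\<close> placed at height \<open>- 1\<close> is an intersection of
  halfspaces, hence finitely generated. A generator at height \<open>0\<close> would be a direction in which
  \<open>P\<close> is unbounded, so scaling the generators to height \<open>- 1\<close> gives finitely many points with
  convex hull \<open>P\<close>. Height \<open>- 1\<close> is the one at which the extended cone contains \<open>\<Delta>\<close>.
\<close>

theorem bounded_polyhedron_is_convex_hull: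
  assumes "polyhedron n P" "bounded_set n P"
  obtains V where "finite V" "V \<subseteq> P" "\<forall>p\<in>P. p(n := - 1) \<in> cone_hull ((\<lambda>v. v(n := - 1)) ` V)"
proof -
  obtain H where H: "finite H" "H \<subseteq> int_lattice n \<times> UNIV"
      "P = {v \<in> rat_space n. \<forall>(m, b)\<in>H. pairing n v m \<ge> b}"
    using assms(1) unfolding polyhedron_def by blast
  define K where "K = insert (0(n := - 1)) ((\<lambda>(m, b). (rat_vec m)(n := b)) ` H)"
  have "finite K" "K \<subseteq> rat_space (Suc n)"
    using H(1,2) by (auto simp: K_def rat_space_def rat_vec_def int_lattice_def)
  then obtain G where G: "finite G" "G \<subseteq> rat_space (Suc n)"
      "{w \<in> rat_space (Suc n). \<forall>u\<in>K. dot (Suc n) w u \<ge> 0} = cone_hull G"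
    using intersection_of_halfspaces_is_finitely_generated[of K "Suc n"] by metis
  have X_iff: "v(n := s) \<in> cone_hull G \<longleftrightarrow> s \<le> 0 \<and> (\<forall>(m, b)\<in>H. pairing n v m + s * b \<ge> 0)"
    if "v \<in> rat_space n" for v s
  proof -
    have "v(n := s) \<in> rat_space (Suc n)"
      using that by (auto simp: rat_space_def)
    then show ?thesis
      unfolding G(3)[symmetric] K_def by (auto simp: dot_Suc_upd pairing_eq_dot)
  qed
  have proj: "g(n := 0) \<in> rat_space n" if "g \<in> G" for g
    using that G(2) by (auto simp: rat_space_def Suc_le_eq)
  have G_cone: "g n \<le> 0" "\<forall>(m, b)\<in>H. pairing n (g(n := 0)) m + g n * b \<ge> 0" if "g \<in> G" for g
  proof -
    have "(g(n := 0))(n := g n) \<in> cone_hull G"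
      using that cone_hull_superset[of G] by auto
    then show "g n \<le> 0" "\<forall>(m, b)\<in>H. pairing n (g(n := 0)) m + g n * b \<ge> 0"
      using X_iff[of "g(n := 0)" "g n"] proj[OF that] by blast+
  qed
  define V where "V = (\<lambda>g. scale_vec (1 / - g n) (g(n := 0))) ` {g\<in>G. g n < 0}"
  have "V \<subseteq> P"
  proof
    fix v assume "v \<in> V"
    then obtain g where g: "g \<in> G" "g n < 0" "v = scale_vec (1 / - g n) (g(n := 0))"
      by (auto simp: V_def)
    have "pairing n v m \<ge> b" if "(m, b) \<in> H" for m b
    proof -
      have "pairing n (g(n := 0)) m \<ge> b * - g n"
        using G_cone(2)[OF g(1)] that by (auto simp: algebra_simps)
      then have "b \<le> pairing n (g(n := 0)) m / - g n"
        using g(2) by (subst pos_le_divide_eq) auto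
      then show ?thesis
        by (simp add: g(3) pairing_scale_left)
    qed
    moreover have "v \<in> rat_space n"
      unfolding g(3) using g(1) by (intro rat_space_closed proj)
    ultimately show "v \<in> P"
      by (auto simp: H(3))
  qed
  moreover have "p(n := - 1) \<in> cone_hull ((\<lambda>v. v(n := - 1)) ` V)" if p: "p \<in> P" for p
  proof -
    have zero: "g = 0" if g: "g \<in> G" "g n = 0" for g
    proof
      fix i
      obtain B where B: "\<And>p i. p \<in> P \<Longrightarrow> i < n \<Longrightarrow> \<bar>p i\<bar> \<le> B"
        using assms(2) unfolding bounded_set_def by blast
      have g0: "g(n := 0) = g"
        using g(2) by auto
      then have gr: "g \<in> rat_space n"
        using proj[OF g(1)] by simp
      have line: "p + scale_vec t g \<in> P" if "t \<ge> 0" for t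
      proof -
        have "pairing n g m \<ge> 0" if "(m, b) \<in> H" for m b
          using G_cone(2)[OF g(1)] that g(2) by (auto simp: g0)
        then have "t * pairing n g m \<ge> 0" if "(m, b) \<in> H" for m b
          using that \<open>t \<ge> 0\<close> by (metis mult_nonneg_nonneg)
        then show ?thesis
          using p gr unfolding H(3) by (fastforce simp: rat_space_closed pairing_add_left pairing_scale_left)
      qed
      show "g i = 0 i"
      proof (cases "i < n")
        case True
        have bound: "t * \<bar>g i\<bar> \<le> B + B" if "t \<ge> 0" for t
        proof -
          have "t * \<bar>g i\<bar> = \<bar>t * g i\<bar>"
            using that by (simp add: abs_mult)
          also have "\<dots> \<le> \<bar>p i + t * g i\<bar> + \<bar>p i\<bar>"
            by linarith
          finally show ?thesis
            using B[OF line[OF that] True] B[OF p True] by simp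
        qed
        show ?thesis
        proof (rule ccontr)
          assume "\<not> ?thesis"
          then have "\<bar>g i\<bar> > 0"
            by simp
          moreover have "B \<ge> 0"
            using B[OF p True] by linarith
          ultimately show False
            using bound[of "(B + B + 1) / \<bar>g i\<bar>"] by (simp add: field_simps)
        qed
      qed (use gr in \<open>simp add: rat_space_def\<close>)
    qed
    have "cone_hull G \<subseteq> cone_hull ((\<lambda>v. v(n := - 1)) ` V)"
    proof (rule cone_hull_minimal[OF subsetI convex_cone_cone_hull])
      fix g assume g: "g \<in> G"
      show "g \<in> cone_hull ((\<lambda>v. v(n := - 1)) ` V)"
      proof (cases "g n = 0")
        case True
        then show ?thesis
          using zero[OF g] by (simp add: cone_hull_closed)
      next
        case False
        then have neg: "g n < 0"
          using G_cone(1)[OF g] by simp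
        let ?v = "scale_vec (1 / - g n) (g(n := 0))"
        have "?v \<in> V"
          using g neg by (auto simp: V_def)
        then have "?v(n := - 1) \<in> cone_hull ((\<lambda>v. v(n := - 1)) ` V)"
          by (intro subsetD[OF cone_hull_superset] imageI)
        then have "scale_vec (- g n) (?v(n := - 1)) \<in> cone_hull ((\<lambda>v. v(n := - 1)) ` V)"
          using neg by (intro cone_hull_closed) auto
        moreover have "scale_vec (- g n) (?v(n := - 1)) = g"
          using neg by (simp add: fun_eq_iff)
        ultimately show ?thesis
          by (simp only:)
      qed
    qed
    moreover have "p(n := - 1) \<in> cone_hull G"
      using X_iff[of p "- 1"] p by (simp add: H(3))
    ultimately show ?thesis
      by blast
  qed
  ultimately show thesis
    using that[of V] G(1) by (simp add: V_def)
qed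

lemma tailed_hull:
  assumes "tailed n \<sigma> \<Delta>" "convex_cone \<sigma>"
  obtains V where "finite V" "V \<noteq> {}" "V \<subseteq> \<Delta>"
    "\<forall>p\<in>\<Delta>. \<exists>q s. s \<in> \<sigma> \<and> p = q + s \<and> q(n := - 1) \<in> cone_hull ((\<lambda>v. v(n := - 1)) ` V)"
proof -
  obtain P where P: "polyhedron n P" "bounded_set n P" "P \<noteq> {}" "\<Delta> = P + \<sigma>"
    using assms unfolding tailed_def by blast
  obtain V where V: "finite V" "V \<subseteq> P" "\<forall>p\<in>P. p(n := - 1) \<in> cone_hull ((\<lambda>v. v(n := - 1)) ` V)"
    using bounded_polyhedron_is_convex_hull[OF P(1,2)] .
  show thesis
  proof
    show "finite V"
      by (rule V)
    show "V \<noteq> {}"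
    proof
      assume "V = {}"
      moreover obtain p where "p \<in> P"
        using P(3) by blast
      ultimately have "p(n := - 1) \<in> cone_hull {}"
        using V(3) by auto
      then have "p(n := - 1) = 0"
        using cone_hull_minimal[of "{}" "{0}"] by (auto simp: convex_cone_def)
      from fun_cong[OF this, of n] show False
        by simp
    qed
    show "V \<subseteq> \<Delta>"
    proof
      fix v assume "v \<in> V"
      then have "v + 0 \<in> \<Delta>"
        unfolding P(4) using V(2) convex_coneD(1)[OF assms(2)] by (intro set_plus_intro) auto
      then show "v \<in> \<Delta>"
        by simp
    qed
    show "\<forall>p\<in>\<Delta>. \<exists>q s. s \<in> \<sigma> \<and> p = q + s \<and> q(n := - 1) \<in> cone_hull ((\<lambda>v. v(n := - 1)) ` V)"
    proof
      fix p assume "p \<in> \<Delta>"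
      then obtain q s where "q \<in> P" "s \<in> \<sigma>" "p = q + s"
        unfolding P(4) by (auto elim: set_plus_elim)
      then show "\<exists>q s. s \<in> \<sigma> \<and> p = q + s \<and> q(n := - 1) \<in> cone_hull ((\<lambda>v. v(n := - 1)) ` V)"
        using V(3) by blast
    qed
  qed
qed

text \<open>
  The functional is bounded below on \<open>\<Delta>\<close> by its least value on the finite set \<open>V\<close>: to say
  so is to put the cone over \<open>V\<close> into a halfspace, and the tail only increases the value.
\<close>

lemma tailed_minimum:
  assumes "tailed n \<sigma> \<Delta>" "convex_cone \<sigma>" "m \<in> dual_lattice n \<sigma>"
  obtains p where "p \<in> \<Delta>" "\<And>p'. p' \<in> \<Delta> \<Longrightarrow> pairing n p m \<le> pairing n p' m"
proof -
  obtain V where V: "finite V" "V \<noteq> {}" "V \<subseteq> \<Delta>"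
    "\<forall>p\<in>\<Delta>. \<exists>q s. s \<in> \<sigma> \<and> p = q + s \<and> q(n := - 1) \<in> cone_hull ((\<lambda>v. v(n := - 1)) ` V)"
    using tailed_hull[OF assms(1,2)] .
  define b where "b = Min ((\<lambda>v. pairing n v m) ` V)"
  have "b \<in> (\<lambda>v. pairing n v m) ` V"
    unfolding b_def using V by (intro Min_in) auto
  then obtain p where p: "p \<in> V" "pairing n p m = b"
    by auto
  have "b \<le> pairing n v m" if "v \<in> V" for v
    unfolding b_def using V that by (intro Min_le) auto
  then have hull: "cone_hull ((\<lambda>v. v(n := - 1)) ` V) \<subseteq> {w. dot (Suc n) w ((rat_vec m)(n := b)) \<ge> 0}"
    by (intro cone_hull_minimal convex_cone_halfspace) (auto simp: dot_Suc_upd pairing_eq_dot)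
  show thesis
  proof
    show "p \<in> \<Delta>"
      using p V by auto
    fix p' assume "p' \<in> \<Delta>"
    then obtain q s where q: "s \<in> \<sigma>" "p' = q + s" "q(n := - 1) \<in> cone_hull ((\<lambda>v. v(n := - 1)) ` V)"
      using V(4) by blast
    then have "pairing n q m \<ge> b"
      using hull by (auto simp: dot_Suc_upd pairing_eq_dot)
    then show "pairing n p m \<le> pairing n p' m"
      using assms(3) q(1) by (auto simp: q(2) p(2) pairing_add_left dual_lattice_def)
  qed
qed

lemma support_fun_minimum:
  assumes "p \<in> \<Delta>" "\<And>p'. p' \<in> \<Delta> \<Longrightarrow> pairing n p m \<le> pairing n p' m"
  shows "support_fun n \<Delta> m = pairing n p m"
  unfolding support_fun_def by (rule Least_equality) (use assms in auto)

lemma support_fun_attained: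
  assumes "tailed n \<sigma> \<Delta>" "convex_cone \<sigma>" "m \<in> dual_lattice n \<sigma>"
  obtains p where "p \<in> \<Delta>" "support_fun n \<Delta> m = pairing n p m"
  using tailed_minimum[OF assms] support_fun_minimum by metis

lemma support_fun_le:
  assumes "tailed n \<sigma> \<Delta>" "convex_cone \<sigma>" "m \<in> dual_lattice n \<sigma>" "p \<in> \<Delta>"
  shows "support_fun n \<Delta> m \<le> pairing n p m"
  using tailed_minimum[OF assms(1-3)] support_fun_minimum assms(4) by metis

lemma support_fun_tail_cone:
  assumes "convex_cone \<sigma>" "m \<in> dual_lattice n \<sigma>"
  shows "support_fun n \<sigma> m = 0"
  using support_fun_minimum[of 0 \<sigma> n m] assms by (auto simp: dual_lattice_def convex_cone_def)

lemma support_fun_superadditive: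
  assumes "tailed n \<sigma> \<Delta>" "convex_cone \<sigma>" "m \<in> dual_lattice n \<sigma>" "m' \<in> dual_lattice n \<sigma>"
  shows "support_fun n \<Delta> m + support_fun n \<Delta> m' \<le> support_fun n \<Delta> (m + m')"
proof -
  obtain p where p: "p \<in> \<Delta>" "support_fun n \<Delta> (m + m') = pairing n p (m + m')"
    using support_fun_attained[OF assms(1,2)] dual_lattice_closed(2)[OF assms(3,4)] by metis
  then show ?thesis
    using support_fun_le[OF assms(1,2,3) p(1)] support_fun_le[OF assms(1,2,4) p(1)]
    by (simp add: pairing_add_right)
qed

lemma support_fun_multiple:
  assumes "tailed n \<sigma> \<Delta>" "convex_cone \<sigma>" "m \<in> dual_lattice n \<sigma>" "k \<ge> 0"
  shows "support_fun n \<Delta> (\<lambda>i. k * m i) = of_int k * support_fun n \<Delta> m"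
proof -
  obtain p where p: "p \<in> \<Delta>" "\<And>p'. p' \<in> \<Delta> \<Longrightarrow> pairing n p m \<le> pairing n p' m"
    using tailed_minimum[OF assms(1-3)] by blast
  have "support_fun n \<Delta> (\<lambda>i. k * m i) = pairing n p (\<lambda>i. k * m i)"
    using p assms(4) by (intro support_fun_minimum) (auto simp: pairing_scale_right intro: mult_left_mono)
  then show ?thesis
    using support_fun_minimum[OF p] by (simp add: pairing_scale_right)
qed

lemma support_fun_zero:
  assumes "tailed n \<sigma> \<Delta>" "convex_cone \<sigma>"
  shows "support_fun n \<Delta> 0 = 0"
  using support_fun_attained[OF assms dual_lattice_closed(1)] by (metis pairing_zero(2))

lemma tailed_translate:
  assumes "tailed n \<sigma> \<Delta>" "p \<in> int_lattice n"
  shows "tailed n \<sigma> ((\<lambda>v. v + rat_vec p) ` \<Delta>)"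
proof -
  obtain P where P: "polyhedron n P" "bounded_set n P" "P \<noteq> {}" "\<Delta> = P + \<sigma>"
    using assms unfolding tailed_def by blast
  let ?P = "(\<lambda>v. v + rat_vec p) ` P"
  obtain H where H: "finite H" "H \<subseteq> int_lattice n \<times> UNIV"
      "P = {v \<in> rat_space n. \<forall>(m, b)\<in>H. pairing n v m \<ge> b}"
    using P(1) unfolding polyhedron_def by blast
  define f where "f = (\<lambda>(m :: nat \<Rightarrow> int, b :: rat). (m, b + pairing n (rat_vec p) m))"
  have pr: "rat_vec p \<in> rat_space n"
    using assms(2) by (simp add: rat_space_def rat_vec_def int_lattice_def)
  have in_P: "v \<in> ?P \<longleftrightarrow> v - rat_vec p \<in> P" for v
  proof
    assume "v - rat_vec p \<in> P"
    then have "(v - rat_vec p) + rat_vec p \<in> ?P"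
      by blast
    then show "v \<in> ?P"
      by simp
  next
    assume "v \<in> ?P"
    then obtain q where "q \<in> P" "v = q + rat_vec p"
      by blast
    then show "v - rat_vec p \<in> P"
      by simp
  qed
  have "v \<in> ?P \<longleftrightarrow> v \<in> rat_space n \<and> (\<forall>(m, b)\<in>f ` H. pairing n v m \<ge> b)" for v
  proof -
    have "v - rat_vec p \<in> rat_space n \<longleftrightarrow> v \<in> rat_space n"
      using pr by (auto simp: rat_space_def)
    then show ?thesis
      unfolding in_P unfolding H(3)
      by (simp add: f_def pairing_diff_left case_prod_beta algebra_simps)
  qed
  then have "?P = {v \<in> rat_space n. \<forall>(m, b)\<in>f ` H. pairing n v m \<ge> b}"
    by blast
  moreover have "finite (f ` H)" "f ` H \<subseteq> int_lattice n \<times> UNIV"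
    using H(1,2) by (auto simp: f_def)
  ultimately have "polyhedron n ?P"
    unfolding polyhedron_def by blast
  moreover have "bounded_set n ?P"
  proof -
    obtain B where B: "\<And>p i. p \<in> P \<Longrightarrow> i < n \<Longrightarrow> \<bar>p i\<bar> \<le> B"
      using P(2) unfolding bounded_set_def by blast
    have "\<bar>v i + rat_vec p i\<bar> \<le> B + (\<Sum>i<n. \<bar>rat_vec p i\<bar>)" if "v \<in> P" "i < n" for v i
    proof -
      have "\<bar>rat_vec p i\<bar> \<le> (\<Sum>i<n. \<bar>rat_vec p i\<bar>)"
        using that(2) by (intro member_le_sum) auto
      then show ?thesis
        using B[OF that] by linarith
    qed
    then show ?thesis
      unfolding bounded_set_def by auto
  qed
  moreover have "(\<lambda>v. v + rat_vec p) ` \<Delta> = ?P + \<sigma>"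
  proof (intro equalityI subsetI)
    fix x assume "x \<in> (\<lambda>v. v + rat_vec p) ` \<Delta>"
    then obtain a b where "a \<in> P" "b \<in> \<sigma>" "x = (a + rat_vec p) + b"
      unfolding P(4) by (auto elim!: set_plus_elim simp: algebra_simps)
    then show "x \<in> ?P + \<sigma>"
      by blast
  next
    fix x assume "x \<in> ?P + \<sigma>"
    then obtain a b where "a \<in> P" "b \<in> \<sigma>" "x = (a + b) + rat_vec p"
      by (auto elim!: set_plus_elim simp: algebra_simps)
    then show "x \<in> (\<lambda>v. v + rat_vec p) ` \<Delta>"
      unfolding P(4) by blast
  qed
  ultimately show ?thesis
    unfolding tailed_def using P(3) by blast
qed

lemma support_fun_translate:
  assumes "tailed n \<sigma> \<Delta>" "convex_cone \<sigma>" "m \<in> dual_lattice n \<sigma>"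
  shows "support_fun n ((\<lambda>v. v + rat_vec p) ` \<Delta>) m = support_fun n \<Delta> m + of_int (pairing n p m)"
proof -
  obtain q where q: "q \<in> \<Delta>" "\<And>p'. p' \<in> \<Delta> \<Longrightarrow> pairing n q m \<le> pairing n p' m"
    using tailed_minimum[OF assms] by blast
  have "support_fun n ((\<lambda>v. v + rat_vec p) ` \<Delta>) m = pairing n (q + rat_vec p) m"
    using q by (intro support_fun_minimum) (auto simp: pairing_add_left)
  then show ?thesis
    using support_fun_minimum[OF q] by (simp add: pairing_add_left pairing_rat_vec)
qed

text \<open>
  For a generator \<open>g\<close> the vector \<open>- g\<close> is not in the cone, so some lattice point of the dual
  cone is positive on \<open>g\<close>; the sum of these points is positive on all generators.
\<close>

lemma interior_lattice_point:
  assumes "polyhedral_cone n \<sigma>" "strongly_convex \<sigma>"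
  obtains m where "m \<in> dual_lattice n \<sigma>" "\<And>v. v \<in> \<sigma> \<Longrightarrow> v \<noteq> 0 \<Longrightarrow> pairing n v m > 0"
proof -
  obtain G where G: "finite G" "G \<subseteq> rat_space n" "\<sigma> = cone_hull G"
    using assms(1) unfolding polyhedral_cone_def by blast
  have "\<exists>m. m \<in> dual_lattice n \<sigma> \<and> pairing n g m > 0" if g: "g \<in> G" "g \<noteq> 0" for g
  proof -
    have "- g \<notin> \<sigma>"
      using assms(2) g cone_hull_superset[of G] unfolding strongly_convex_def G(3) by auto
    then obtain m where m: "m \<in> dual_lattice n \<sigma>" "\<not> pairing n (- g) m \<ge> 0"
      using farkas[OF assms(1), of "- g"] g(1) G(2) rat_space_uminus by blast
    then show ?thesis
      by (auto simp: pairing_def sum_negf)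
  qed
  then obtain f where f: "\<And>g. g \<in> G \<Longrightarrow> g \<noteq> 0 \<Longrightarrow> f g \<in> dual_lattice n \<sigma> \<and> pairing n g (f g) > 0"
    by metis
  define m where "m = (\<Sum>g\<in>G - {0}. f g)"
  have pm: "pairing n v m = (\<Sum>g\<in>G - {0}. pairing n v (f g))" for v :: "nat \<Rightarrow> rat"
    unfolding m_def by (induction rule: infinite_finite_induct) 
      (simp_all only: sum.infinite sum.empty sum.insert pairing_add_right pairing_zero not_False_eq_True)
  have mem: "m \<in> dual_lattice n \<sigma>"
  proof -
    have "sum f A \<in> dual_lattice n \<sigma>" if "finite A" "A \<subseteq> G - {0}" for A
      using that
    proof (induction A rule: finite_induct)
      case empty
      then show ?case by (simp only: sum.empty dual_lattice_closed)
    next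
      case (insert a A)
      have "f a \<in> dual_lattice n \<sigma>" "sum f A \<in> dual_lattice n \<sigma>"
        using insert f by blast+
      then have "f a + sum f A \<in> dual_lattice n \<sigma>"
        by (rule dual_lattice_closed)
      then show ?case
        unfolding sum.insert[OF insert(1,2)] .
    qed
    then show ?thesis
      unfolding m_def using G(1) by blast
  qed
  have pos: "pairing n g m > 0" if g: "g \<in> G" "g \<noteq> 0" for g
    unfolding pm
  proof (rule sum_pos2[of _ g])
    show "pairing n g (f h) \<ge> 0" if "h \<in> G - {0}" for h
      using f[of h] that g cone_hull_superset[of G] by (auto simp: dual_lattice_def G(3))
  qed (use f g G(1) in auto)
  show thesis
  proof
    show "m \<in> dual_lattice n \<sigma>" by (rule mem)
    fix v assume v: "v \<in> \<sigma>" "v \<noteq> 0"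
    obtain S c where S: "finite S" "S \<subseteq> G" "\<forall>s\<in>S. c s \<ge> 0" "v = (\<lambda>i. \<Sum>s\<in>S. c s * s i)"
      using v(1) unfolding G(3) cone_hull_def by blast
    have eq: "pairing n v m = (\<Sum>s\<in>S. c s * pairing n s m)"
      by (simp add: S(4) pairing_eq_dot dot_sum)
    have nonneg: "c s * pairing n s m \<ge> 0" if "s \<in> S" for s
      using that S(2,3) pos[of s] by (cases "s = 0") auto
    show "pairing n v m > 0"
    proof (rule ccontr)
      assume "\<not> ?thesis"
      then have "(\<Sum>s\<in>S. c s * pairing n s m) = 0"
        using sum_nonneg[of S "\<lambda>s. c s * pairing n s m"] nonneg eq by fastforce
      then have zero: "c s * pairing n s m = 0" if "s \<in> S" for s
        using sum_nonneg_eq_0_iff[OF S(1), of "\<lambda>s. c s * pairing n s m"] nonneg that by blast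
      have "c s * s i = 0" if "s \<in> S" for s i
        using zero[OF that] pos[of s] that S(2) by (cases "s = 0") auto
      then have "v = 0"
        unfolding S(4) fun_eq_iff by (simp add: sum.neutral)
      then show False
        using v(2) by blast
    qed
  qed
qed

lemma tailed_add_tail:
  assumes "tailed n \<sigma> \<Delta>" "convex_cone \<sigma>" "p \<in> \<Delta>" "s \<in> \<sigma>"
  shows "p + s \<in> \<Delta>"
proof -
  obtain P where P: "\<Delta> = P + \<sigma>"
    using assms(1) unfolding tailed_def by blast
  obtain q t where q: "q \<in> P" "t \<in> \<sigma>" "p = q + t"
    using assms(3) unfolding P by (auto elim: set_plus_elim)
  then have "q + (t + s) \<in> \<Delta>"
    unfolding P using assms(2,4) by (intro set_plus_intro convex_coneD)
  then show ?thesis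
    by (simp add: q(3) add.assoc)
qed

lemma tailed_convex:
  assumes "tailed n \<sigma> \<Delta>" "convex_cone \<sigma>" "p \<in> \<Delta>" "q \<in> \<Delta>" "a \<ge> 0" "b \<ge> 0" "a + b = 1"
  shows "scale_vec a p + scale_vec b q \<in> \<Delta>"
proof -
  obtain P where P: "polyhedron n P" "\<Delta> = P + \<sigma>"
    using assms(1) unfolding tailed_def by blast
  obtain H where H: "P = {v \<in> rat_space n. \<forall>(m, b)\<in>H. pairing n v m \<ge> b}"
    using P(1) unfolding polyhedron_def by blast
  obtain p1 s1 where p1: "p1 \<in> P" "s1 \<in> \<sigma>" "p = p1 + s1"
    using assms(3) unfolding P(2) by (auto elim: set_plus_elim)
  obtain p2 s2 where p2: "p2 \<in> P" "s2 \<in> \<sigma>" "q = p2 + s2"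
    using assms(4) unfolding P(2) by (auto elim: set_plus_elim)
  have "pairing n (scale_vec a p1 + scale_vec b p2) m \<ge> c" if "(m, c) \<in> H" for m c
  proof -
    have "a * pairing n p1 m \<ge> a * c" "b * pairing n p2 m \<ge> b * c"
      using p1(1) p2(1) that assms(5,6) unfolding H by (auto intro: mult_left_mono)
    moreover have "a * c + b * c = c"
      using assms(7) by (simp add: distrib_right[symmetric])
    ultimately show ?thesis
      by (simp add: pairing_add_left pairing_scale_left)
  qed
  then have "scale_vec a p1 + scale_vec b p2 \<in> P"
    using p1(1) p2(1) unfolding H by (auto intro!: rat_space_closed)
  moreover have "scale_vec a s1 + scale_vec b s2 \<in> \<sigma>"
    using assms(2,5,6) p1(2) p2(2) by (intro convex_coneD)
  ultimately have "(scale_vec a p1 + scale_vec b p2) + (scale_vec a s1 + scale_vec b s2) \<in> \<Delta>"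
    unfolding P(2) by (rule set_plus_intro)
  then show ?thesis
    by (simp add: p1(3) p2(3) scale_vec_add add_ac)
qed

section \<open>The cone of the total space\<close>

text \<open>
  The slice of the extended cone below the ray through \<open>(0, 1)\<close>: at height \<open>- c\<close> it is
  \<open>c \<Delta>\<close>, where \<open>0 \<Delta>\<close> has to be read as the tail cone.
\<close>

definition dilate :: "(nat \<Rightarrow> rat) set \<Rightarrow> (nat \<Rightarrow> rat) set \<Rightarrow> rat \<Rightarrow> (nat \<Rightarrow> rat) set" where
  "dilate \<sigma> \<Delta> c = (if c = 0 then \<sigma> else {x. scale_vec (1 / c) x \<in> \<Delta>})"

locale tailed_polyhedron =
  fixes n :: nat and \<sigma> \<Delta> :: "(nat \<Rightarrow> rat) set"
  assumes cone: "polyhedral_cone n \<sigma>" and tail: "tailed n \<sigma> \<Delta>"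
begin

lemma convex_tail: "convex_cone \<sigma>" and tail_rat_space: "\<sigma> \<subseteq> rat_space n"
  using polyhedral_cone_convex[OF cone] by auto

lemma polyhedron_rat_space: "\<Delta> \<subseteq> rat_space n"
proof
  fix p assume "p \<in> \<Delta>"
  moreover obtain P where P: "polyhedron n P" "\<Delta> = P + \<sigma>"
    using tail unfolding tailed_def by blast
  moreover have "P \<subseteq> rat_space n"
    using P(1) unfolding polyhedron_def by auto
  ultimately show "p \<in> rat_space n"
    using tail_rat_space by (auto elim!: set_plus_elim intro!: rat_space_closed)
qed

lemma dilate_add:
  assumes "c \<ge> 0" "d \<ge> 0" "x \<in> dilate \<sigma> \<Delta> c" "y \<in> dilate \<sigma> \<Delta> d"
  shows "x + y \<in> dilate \<sigma> \<Delta> (c + d)"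
proof -
  have shift: "x + y \<in> dilate \<sigma> \<Delta> c" if "c > 0" "x \<in> dilate \<sigma> \<Delta> c" "y \<in> \<sigma>" for c x y
    using that tailed_add_tail[OF tail convex_tail, of "scale_vec (1 / c) x" "scale_vec (1 / c) y"]
    by (auto simp: dilate_def scale_vec_add convex_coneD[OF convex_tail])
  consider "c = 0" "d = 0" | "c = 0" "d > 0" | "c > 0" "d = 0" | "c > 0" "d > 0"
    using assms by linarith
  then show ?thesis
  proof cases
    case 1
    then show ?thesis
      using assms convex_tail by (simp add: dilate_def convex_coneD)
  next
    case 2
    then show ?thesis
      using shift[of d y x] assms by (simp add: dilate_def add.commute)
  next
    case 3
    then show ?thesis
      using shift[of c x y] assms by (simp add: dilate_def)
  next
    case 4
    have "scale_vec (c / (c + d)) (scale_vec (1 / c) x) + scale_vec (d / (c + d)) (scale_vec (1 / d) y) \<in> \<Delta>"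
      using 4 assms by (intro tailed_convex[OF tail convex_tail])
        (auto simp: dilate_def add_divide_distrib[symmetric])
    moreover have "c / (c + d) * (1 / c) = 1 / (c + d)" "d / (c + d) * (1 / d) = 1 / (c + d)"
      using 4 by (auto simp: field_simps)
    ultimately show ?thesis
      using 4 by (simp add: dilate_def scale_vec_add)
  qed
qed

lemma dilate_scale:
  assumes "t \<ge> 0" "c \<ge> 0" "x \<in> dilate \<sigma> \<Delta> c"
  shows "scale_vec t x \<in> dilate \<sigma> \<Delta> (t * c)"
proof (cases "t = 0")
  case True
  then show ?thesis
    using convex_coneD(1)[OF convex_tail] by (simp add: dilate_def)
next
  case False
  then show ?thesis
    using assms convex_coneD(3)[OF convex_tail, of t x] by (auto simp: dilate_def)
qed

lemma upd_add: "(x + y)(n := a + b) = x(n := a) + y(n := b)" for x y :: "nat \<Rightarrow> rat"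
  by (auto simp: fun_eq_iff)

lemma upd_scale: "(scale_vec t x)(n := t * a) = scale_vec t (x(n := a))"
  by (auto simp: fun_eq_iff)

lemma slice_in_extended_cone:
  assumes "c \<ge> 0" "x \<in> dilate \<sigma> \<Delta> c"
  shows "x(n := - c) \<in> extended_cone n \<sigma> \<Delta>"
proof (cases "c = 0")
  case True
  then show ?thesis
    using assms cone_hull_superset[of "(\<lambda>v. v(n := 0)) ` \<sigma> \<union> (\<lambda>p. p(n := - 1)) ` \<Delta> \<union> {0(n := 1)}"]
    unfolding extended_cone_def dilate_def by auto
next
  case False
  then have "(scale_vec (1 / c) x)(n := - 1) \<in> extended_cone n \<sigma> \<Delta>"
    using assms cone_hull_superset[of "(\<lambda>v. v(n := 0)) ` \<sigma> \<union> (\<lambda>p. p(n := - 1)) ` \<Delta> \<union> {0(n := 1)}"]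
    unfolding extended_cone_def dilate_def by auto
  then have "scale_vec c ((scale_vec (1 / c) x)(n := - 1)) \<in> extended_cone n \<sigma> \<Delta>"
    unfolding extended_cone_def using assms(1) by (intro cone_hull_closed)
  then show ?thesis
    using False upd_scale[of c "scale_vec (1 / c) x" "-1"] by simp
qed

lemma vertical_in_extended_cone: "0(n := 1) \<in> extended_cone n \<sigma> \<Delta>"
  using cone_hull_superset[of "(\<lambda>v. v(n := 0)) ` \<sigma> \<union> (\<lambda>p. p(n := - 1)) ` \<Delta> \<union> {0(n := 1)}"]
  unfolding extended_cone_def by auto

text \<open>
  Every point lies above a point of the slice over the same \<open>x\<close>, by the amount \<open>r\<close>.
\<close>

lemma extended_cone_iff:
  "v \<in> extended_cone n \<sigma> \<Delta> \<longleftrightarrow> (\<exists>x c r. c \<ge> 0 \<and> r \<ge> 0 \<and> x \<in> dilate \<sigma> \<Delta> c \<and> v = x(n := r - c))"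
proof
  let ?X = "{v. \<exists>x c r. c \<ge> 0 \<and> r \<ge> 0 \<and> x \<in> dilate \<sigma> \<Delta> c \<and> v = x(n := r - c)}"
  have XI: "x(n := r - c) \<in> ?X" if "c \<ge> 0" "r \<ge> 0" "x \<in> dilate \<sigma> \<Delta> c" for x c r
    using that by blast
  have "extended_cone n \<sigma> \<Delta> \<subseteq> ?X"
    unfolding extended_cone_def
  proof (rule cone_hull_minimal)
    have zero: "0 \<in> dilate \<sigma> \<Delta> 0"
      using convex_coneD(1)[OF convex_tail] by (simp add: dilate_def)
    have "v(n := 0) \<in> ?X" if "v \<in> \<sigma>" for v
      using XI[of 0 0 v] that by (simp add: dilate_def)
    moreover have "p(n := - 1) \<in> ?X" if "p \<in> \<Delta>" for p
      using XI[of 1 0 p] that by (simp add: dilate_def)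
    moreover have "0(n := 1) \<in> ?X"
      using XI[of 0 1 0] zero by simp
    ultimately show "(\<lambda>v. v(n := 0)) ` \<sigma> \<union> (\<lambda>p. p(n := - 1)) ` \<Delta> \<union> {0(n := 1)} \<subseteq> ?X"
      by blast
    show "convex_cone ?X"
      unfolding convex_cone_def
    proof (intro conjI ballI allI impI)
      have "(0 :: nat \<Rightarrow> rat) = 0(n := 0 - 0)"
        by (simp add: fun_eq_iff)
      then show "0 \<in> ?X"
        using XI[of 0 0 0] zero by simp
    next
      fix v w assume "v \<in> ?X" "w \<in> ?X"
      then obtain x c r y d s where "c \<ge> 0" "r \<ge> 0" "x \<in> dilate \<sigma> \<Delta> c" "v = x(n := r - c)"
        "d \<ge> 0" "s \<ge> 0" "y \<in> dilate \<sigma> \<Delta> d" "w = y(n := s - d)"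
        by blast
      then show "v + w \<in> ?X"
        using XI[of "c + d" "r + s" "x + y"] dilate_add[of c d x y] upd_add[of x y "r - c" "s - d"]
        by (simp add: algebra_simps)
    next
      fix t :: rat and v assume "t \<ge> 0" "v \<in> ?X"
      then obtain x c r where "c \<ge> 0" "r \<ge> 0" "x \<in> dilate \<sigma> \<Delta> c" "v = x(n := r - c)"
        by blast
      then show "scale_vec t v \<in> ?X"
        using XI[of "t * c" "t * r" "scale_vec t x"] dilate_scale[of t c x] upd_scale[of t x "r - c"]
          \<open>t \<ge> 0\<close> by (simp add: algebra_simps)
    qed
  qed
  then show "v \<in> extended_cone n \<sigma> \<Delta> \<Longrightarrow> \<exists>x c r. c \<ge> 0 \<and> r \<ge> 0 \<and> x \<in> dilate \<sigma> \<Delta> c \<and> v = x(n := r - c)"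
    by blast
next
  assume "\<exists>x c r. c \<ge> 0 \<and> r \<ge> 0 \<and> x \<in> dilate \<sigma> \<Delta> c \<and> v = x(n := r - c)"
  then obtain x c r where x: "c \<ge> 0" "r \<ge> 0" "x \<in> dilate \<sigma> \<Delta> c" "v = x(n := r - c)"
    by blast
  have "v = x(n := - c) + scale_vec r (0(n := 1))"
    by (auto simp: x(4) fun_eq_iff)
  then show "v \<in> extended_cone n \<sigma> \<Delta>"
    using slice_in_extended_cone[OF x(1,3)] vertical_in_extended_cone x(2)
    unfolding extended_cone_def by (simp add: cone_hull_closed)
qed

text \<open>
  The infinitely many generators in \<open>\<sigma>\<close> and \<open>\<Delta>\<close> are replaced by generators of \<open>\<sigma>\<close>
  and the points whose convex hull, up to the tail, is \<open>\<Delta>\<close>.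
\<close>

lemma polyhedral_extended_cone: "polyhedral_cone (Suc n) (extended_cone n \<sigma> \<Delta>)"
proof -
  obtain G where G: "finite G" "G \<subseteq> rat_space n" "\<sigma> = cone_hull G"
    using cone unfolding polyhedral_cone_def by blast
  obtain V where V: "finite V" "V \<noteq> {}" "V \<subseteq> \<Delta>"
    "\<forall>p\<in>\<Delta>. \<exists>q s. s \<in> \<sigma> \<and> p = q + s \<and> q(n := - 1) \<in> cone_hull ((\<lambda>v. v(n := - 1)) ` V)"
    using tailed_hull[OF tail convex_tail] .
  let ?G = "(\<lambda>v. v(n := 0)) ` G \<union> (\<lambda>p. p(n := - 1)) ` V \<union> {0(n := 1)}"
  have G\<sigma>: "G \<subseteq> \<sigma>"
    by (simp add: G(3) cone_hull_superset)
  have "cone_hull ?G \<subseteq> extended_cone n \<sigma> \<Delta>"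
    unfolding extended_cone_def using G\<sigma> V(3)
    by (intro cone_hull_minimal convex_cone_cone_hull subset_trans[OF _ cone_hull_superset]) auto
  moreover have "extended_cone n \<sigma> \<Delta> \<subseteq> cone_hull ?G"
    unfolding extended_cone_def
  proof (rule cone_hull_minimal[OF _ convex_cone_cone_hull])
    have zero: "(0 :: nat \<Rightarrow> rat)(n := 0) = 0"
      by (simp add: fun_eq_iff)
    have "convex_cone {v. v(n := 0) \<in> cone_hull ?G}"
      unfolding convex_cone_def using upd_add[of _ _ 0 0] upd_scale[of _ _ 0]
      by (auto simp: zero cone_hull_closed)
    moreover have "G \<subseteq> {v. v(n := 0) \<in> cone_hull ?G}"
      using cone_hull_superset[of ?G] by auto
    ultimately have "\<sigma> \<subseteq> {v. v(n := 0) \<in> cone_hull ?G}"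
      unfolding G(3) by (intro cone_hull_minimal)
    then have \<sigma>: "v(n := 0) \<in> cone_hull ?G" if "v \<in> \<sigma>" for v
      using that by blast
    have "cone_hull ((\<lambda>v. v(n := - 1)) ` V) \<subseteq> cone_hull ?G"
      using cone_hull_superset[of ?G] by (intro cone_hull_minimal convex_cone_cone_hull) auto
    then have "p(n := - 1) \<in> cone_hull ?G" if p: "p \<in> \<Delta>" for p
    proof -
      obtain q s where q: "s \<in> \<sigma>" "p = q + s" "q(n := - 1) \<in> cone_hull ((\<lambda>v. v(n := - 1)) ` V)"
        using V(4) p by blast
      have "p(n := - 1) = q(n := - 1) + s(n := 0)"
        unfolding q(2) using upd_add[of q s "- 1" 0] by simp
      moreover have "q(n := - 1) + s(n := 0) \<in> cone_hull ?G"
        using q \<sigma> \<open>cone_hull ((\<lambda>v. v(n := - 1)) ` V) \<subseteq> cone_hull ?G\<close> by (intro cone_hull_closed) auto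
      ultimately show ?thesis
        by (simp only:)
    qed
    then show "(\<lambda>v. v(n := 0)) ` \<sigma> \<union> (\<lambda>p. p(n := - 1)) ` \<Delta> \<union> {0(n := 1)} \<subseteq> cone_hull ?G"
      using \<sigma> cone_hull_superset[of ?G] by auto
  qed
  moreover have "?G \<subseteq> rat_space (Suc n)"
    using G(2) V(3) polyhedron_rat_space by (fastforce simp: rat_space_def)
  moreover have "finite ?G"
    using G(1) V(1) by simp
  ultimately show ?thesis
    unfolding polyhedral_cone_def by (intro exI[of _ ?G]) simp
qed

lemma pairing_Suc: "pairing (Suc n) (v(n := a)) (m(n := k)) = pairing n v m + a * of_int k"
  by (simp add: pairing_def)

text \<open>
  The three kinds of generators give the three conditions: \<open>\<sigma>\<close> gives \<open>m\<close> in the dual cone, the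
  vertical ray gives \<open>k \<ge> 0\<close>, and \<open>\<Delta>\<close> at height \<open>- 1\<close> gives the upper bound on \<open>k\<close>. For a
  coordinate \<open>t\<close> of the projective line these are the monomials \<open>t\<^sup>k\<close> in degree \<open>m\<close> whose pole
  at infinity is bounded by the support function of \<open>\<Delta>\<close>.
\<close>

lemma dual_extended_cone:
  "dual_lattice (Suc n) (extended_cone n \<sigma> \<Delta>) =
    {m(n := k) | m k. m \<in> dual_lattice n \<sigma> \<and> k \<ge> 0 \<and> of_int k \<le> support_fun n \<Delta> m}"
proof (intro equalityI subsetI)
  fix u assume u: "u \<in> dual_lattice (Suc n) (extended_cone n \<sigma> \<Delta>)"
  define m where "m = u(n := 0)"
  have u_eq: "u = m(n := u n)"
    by (simp add: m_def)
  have ge: "pairing (Suc n) v (m(n := u n)) \<ge> 0" if "v \<in> extended_cone n \<sigma> \<Delta>" for v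
    using u that unfolding u_eq[symmetric] dual_lattice_def by auto
  have "m \<in> dual_lattice n \<sigma>"
    unfolding dual_lattice_def
  proof safe
    show "m \<in> int_lattice n"
      using u by (auto simp: m_def dual_lattice_def int_lattice_def Suc_le_eq)
    fix v assume "v \<in> \<sigma>"
    then show "pairing n v m \<ge> 0"
      using ge[OF slice_in_extended_cone[of 0 v]] unfolding pairing_Suc by (simp add: dilate_def)
  qed
  moreover have "u n \<ge> 0"
    using ge[OF vertical_in_extended_cone] unfolding pairing_Suc by simp
  moreover have "of_int (u n) \<le> support_fun n \<Delta> m"
  proof -
    obtain p where "p \<in> \<Delta>" "support_fun n \<Delta> m = pairing n p m"
      using support_fun_attained[OF tail convex_tail \<open>m \<in> dual_lattice n \<sigma>\<close>] by blast
    then show ?thesis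
      using ge[OF slice_in_extended_cone[of 1 p]] unfolding pairing_Suc by (simp add: dilate_def)
  qed
  ultimately show "u \<in> {m(n := k) | m k. m \<in> dual_lattice n \<sigma> \<and> k \<ge> 0 \<and> of_int k \<le> support_fun n \<Delta> m}"
    using u_eq by blast
next
  fix u assume "u \<in> {m(n := k) | m k. m \<in> dual_lattice n \<sigma> \<and> k \<ge> 0 \<and> of_int k \<le> support_fun n \<Delta> m}"
  then obtain m k where m: "m \<in> dual_lattice n \<sigma>" "k \<ge> 0" "of_int k \<le> support_fun n \<Delta> m" "u = m(n := k)"
    by blast
  have "pairing (Suc n) v u \<ge> 0" if v: "v \<in> extended_cone n \<sigma> \<Delta>" for v
  proof -
    obtain x c r where x: "c \<ge> 0" "r \<ge> 0" "x \<in> dilate \<sigma> \<Delta> c" "v = x(n := r - c)"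
      using v unfolding extended_cone_iff by blast
    have "pairing n x m \<ge> c * of_int k"
    proof (cases "c = 0")
      case True
      then show ?thesis
        using x(3) m(1) by (simp add: dilate_def dual_lattice_def)
    next
      case False
      then have "support_fun n \<Delta> m \<le> pairing n (scale_vec (1 / c) x) m"
        using x(3) by (intro support_fun_le[OF tail convex_tail m(1)]) (simp add: dilate_def)
      then have "of_int k \<le> pairing n x m / c"
        using m(3) by (simp add: pairing_scale_left)
      then show ?thesis
        using False x(1) by (simp add: field_simps)
    qed
    moreover have "r * of_int k \<ge> 0"
      using x(2) m(2) by simp
    ultimately show ?thesis
      unfolding x(4) m(4) pairing_Suc by (simp add: algebra_simps)
  qed
  moreover have "u \<in> int_lattice (Suc n)"
    using m(1) by (auto simp: m(4) dual_lattice_def int_lattice_def)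
  ultimately show "u \<in> dual_lattice (Suc n) (extended_cone n \<sigma> \<Delta>)"
    by (simp add: dual_lattice_def)
qed

text \<open>
  If \<open>\<Delta>\<close> contained the origin it would contain \<open>\<sigma>\<close>. So a properly contained
  \<open>\<Delta>\<close> avoids the origin, which makes the vertical ray a face.
\<close>

lemma zero_notin_polyhedron:
  assumes "\<Delta> \<subset> \<sigma>"
  shows "0 \<notin> \<Delta>"
  using assms tailed_add_tail[OF tail convex_tail, of 0] by auto

lemma dilate_subset:
  assumes "\<Delta> \<subset> \<sigma>" "c \<ge> 0" "x \<in> dilate \<sigma> \<Delta> c"
  shows "x \<in> \<sigma>"
proof (cases "c = 0")
  case False
  then have "scale_vec (1 / c) x \<in> \<sigma>"
    using assms by (auto simp: dilate_def)
  then show ?thesis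
    using False convex_coneD(3)[OF convex_tail assms(2), of "scale_vec (1 / c) x"] by simp
qed (use assms in \<open>simp add: dilate_def\<close>)

lemma extended_cone_over_zero:
  assumes "\<Delta> \<subset> \<sigma>" "c \<ge> 0" "0 \<in> dilate \<sigma> \<Delta> c"
  shows "c = 0"
  using assms zero_notin_polyhedron by (auto simp: dilate_def split: if_splits)

lemma strongly_convex_extended_cone:
  assumes "\<Delta> \<subset> \<sigma>" "strongly_convex \<sigma>"
  shows "strongly_convex (extended_cone n \<sigma> \<Delta>)"
  unfolding strongly_convex_def
proof (intro allI impI)
  fix v assume "v \<in> extended_cone n \<sigma> \<Delta> \<and> - v \<in> extended_cone n \<sigma> \<Delta>"
  then obtain x c r y d s where x: "c \<ge> 0" "r \<ge> 0" "x \<in> dilate \<sigma> \<Delta> c" "v = x(n := r - c)"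
      and y: "d \<ge> 0" "s \<ge> 0" "y \<in> dilate \<sigma> \<Delta> d" "- v = y(n := s - d)"
    unfolding extended_cone_iff by blast
  have xy: "x \<in> \<sigma>" "y \<in> \<sigma>"
    using dilate_subset[OF assms(1)] x y by auto
  have eq: "- (x(n := r - c)) = y(n := s - d)"
    using x(4) y(4) by simp
  have "y = - x"
  proof
    fix i
    have "x n = 0" "y n = 0"
      using xy tail_rat_space by (auto simp: rat_space_def)
    then show "y i = (- x) i"
      using fun_cong[OF eq, of i] by (cases "i = n") auto
  qed
  then have "x = 0" "y = 0"
    using assms(2) xy by (auto simp: strongly_convex_def)
  then have "c = 0" "d = 0"
    using extended_cone_over_zero[OF assms(1)] x y by auto
  moreover have "r - c = - (s - d)"
    using fun_cong[OF eq, of n] by simp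
  ultimately have "r = 0"
    using x(2) y(2) by linarith
  then show "v = 0"
    using \<open>x = 0\<close> \<open>c = 0\<close> by (simp add: x(4) fun_eq_iff)
qed

text \<open>
  The vertical ray is the face on which a functional vanishes that is positive on \<open>\<sigma>\<close> outside
  the origin. Any face with a point strictly above the slice contains the vertical ray, so the
  other rays are on the slice, where the last coordinate is at most zero.
\<close>

lemma demazure_root_extended_cone:
  assumes "\<Delta> \<subset> \<sigma>" "strongly_convex \<sigma>"
  shows "demazure_root (Suc n) (extended_cone n \<sigma> \<Delta>) (0(n := 1)) (0(n := - 1))"
  unfolding demazure_root_def
proof (intro conjI ballI)
  let ?w = "0(n := 1) :: nat \<Rightarrow> int"
  have rw: "rat_vec ?w = 0(n := 1)"
    by (auto simp: rat_vec_def fun_eq_iff)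
  have ray: "v \<in> cone_hull {0(n := 1)} \<longleftrightarrow> (\<exists>t\<ge>0. v = 0(n := t))" for v
  proof -
    have "cone_hull {} = {0}"
      using cone_hull_minimal[of "{}" "{0}"] cone_hull_closed(1)[of "{}"] by (auto simp: convex_cone_def)
    moreover have "scale_vec t (0(n := 1)) = 0(n := t)" for t
      by (auto simp: fun_eq_iff)
    ultimately show ?thesis
      unfolding cone_hull_insert by simp
  qed
  show "0(n := - 1) \<in> int_lattice (Suc n)"
    by (auto simp: int_lattice_def)
  have pw: "pairing (Suc n) w (0(n := - 1)) = - w n" for w :: "nat \<Rightarrow> int"
    by (simp add: pairing_def)
  show "pairing (Suc n) ?w (0(n := - 1)) = - 1"
    by (simp add: pw)
  obtain m where m: "m \<in> dual_lattice n \<sigma>" "\<And>v. v \<in> \<sigma> \<Longrightarrow> v \<noteq> 0 \<Longrightarrow> pairing n v m > 0"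
    using interior_lattice_point[OF cone assms(2)] by blast
  show "?w \<in> ray_generators (Suc n) (extended_cone n \<sigma> \<Delta>)"
    unfolding ray_generators_def
  proof (intro CollectI conjI)
    show "?w \<in> int_lattice (Suc n)"
      by (auto simp: int_lattice_def)
    have "Gcd (?w ` {..<Suc n}) dvd ?w n"
      by (intro Gcd_dvd) auto
    then show "Gcd (?w ` {..<Suc n}) = 1"
      by (metis Gcd_int_greater_eq_0 fun_upd_same abs_of_nonneg zdvd1_eq)
    let ?m = "m(n := 0)"
    have mem: "?m \<in> dual_lattice (Suc n) (extended_cone n \<sigma> \<Delta>)"
      unfolding dual_extended_cone
    proof (intro CollectI exI[of _ m] exI[of _ 0] conjI)
      obtain p where "p \<in> \<Delta>" "support_fun n \<Delta> m = pairing n p m"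
        using support_fun_attained[OF tail convex_tail m(1)] by blast
      then show "of_int 0 \<le> support_fun n \<Delta> m"
        using m(1) assms(1) by (auto simp: dual_lattice_def)
    qed (use m in auto)
    have "cone_hull {rat_vec ?w} = {v \<in> extended_cone n \<sigma> \<Delta>. pairing (Suc n) v ?m = 0}"
    proof (intro equalityI subsetI)
      fix v assume "v \<in> cone_hull {rat_vec ?w}"
      then obtain t where t: "t \<ge> 0" "v = 0(n := t)"
        unfolding rw ray by blast
      have "0 \<in> dilate \<sigma> \<Delta> 0"
        using convex_coneD(1)[OF convex_tail] by (simp add: dilate_def)
      then have "v \<in> extended_cone n \<sigma> \<Delta>"
        unfolding extended_cone_iff using t by (intro exI[of _ 0] exI[of _ t]) auto
      then show "v \<in> {v \<in> extended_cone n \<sigma> \<Delta>. pairing (Suc n) v ?m = 0}"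
        by (simp add: t(2) pairing_Suc)
    next
      fix v assume v: "v \<in> {v \<in> extended_cone n \<sigma> \<Delta>. pairing (Suc n) v ?m = 0}"
      then obtain x c r where x: "c \<ge> 0" "r \<ge> 0" "x \<in> dilate \<sigma> \<Delta> c" "v = x(n := r - c)"
        unfolding extended_cone_iff by blast
      have "pairing n x m = 0"
        using v unfolding x(4) by (simp add: pairing_Suc)
      then have "x = 0"
        using m(2)[of x] dilate_subset[OF assms(1) x(1,3)] by fastforce
      moreover from this have "c = 0"
        using extended_cone_over_zero[OF assms(1)] x by blast
      ultimately show "v \<in> cone_hull {rat_vec ?w}"
        unfolding rw ray using x by auto
    qed
    then show "cone_hull {rat_vec ?w} \<in> cone_faces (Suc n) (extended_cone n \<sigma> \<Delta>)"
      unfolding cone_faces_def using mem by blast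
  qed
  fix w' assume w': "w' \<in> ray_generators (Suc n) (extended_cone n \<sigma> \<Delta>) - {?w}"
  then have prim: "Gcd (w' ` {..<Suc n}) = 1" and face: "cone_hull {rat_vec w'} \<in> cone_faces (Suc n) (extended_cone n \<sigma> \<Delta>)"
    and ne: "w' \<noteq> ?w" and lat: "w' \<in> int_lattice (Suc n)"
    unfolding ray_generators_def by auto
  obtain u where u: "u \<in> dual_lattice (Suc n) (extended_cone n \<sigma> \<Delta>)"
      "cone_hull {rat_vec w'} = {v \<in> extended_cone n \<sigma> \<Delta>. pairing (Suc n) v u = 0}"
    using face unfolding cone_faces_def by blast
  have "rat_vec w' \<in> cone_hull {rat_vec w'}"
    using cone_hull_superset by blast
  then have w'_in: "rat_vec w' \<in> extended_cone n \<sigma> \<Delta>" "pairing (Suc n) (rat_vec w') u = 0"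
    unfolding u(2) by auto
  then obtain x c r where x: "c \<ge> 0" "r \<ge> 0" "x \<in> dilate \<sigma> \<Delta> c" "rat_vec w' = x(n := r - c)"
    unfolding extended_cone_iff by blast
  have "r = 0"
  proof (rule ccontr)
    assume "r \<noteq> 0"
    then have r: "r > 0"
      using x(2) by simp
    have sum0: "pairing (Suc n) (x(n := - c)) u + r * pairing (Suc n) (0(n := 1)) u = 0"
    proof -
      have "rat_vec w' = x(n := - c) + scale_vec r (0(n := 1))"
        unfolding x(4) by (auto simp: fun_eq_iff)
      then show ?thesis
        using w'_in(2) by (simp add: pairing_add_left pairing_scale_left)
    qed
    have ge: "pairing (Suc n) (x(n := - c)) u \<ge> 0" "pairing (Suc n) (0(n := 1)) u \<ge> (0 :: rat)"
      using u(1) slice_in_extended_cone[OF x(1,3)] vertical_in_extended_cone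
      by (auto simp: dual_lattice_def)
    have "r * pairing (Suc n) (0(n := 1)) u \<ge> 0"
      using r ge(2) by simp
    then have "r * pairing (Suc n) (0(n := 1)) u = 0"
      using sum0 ge(1) by linarith
    then have "pairing (Suc n) (0(n := 1 :: rat)) u = 0"
      using r by simp
    then have "0(n := 1) \<in> cone_hull {rat_vec w'}"
      unfolding u(2) using vertical_in_extended_cone by auto
    then obtain t where t: "t \<ge> 0" "0(n := 1) = scale_vec t (rat_vec w')"
    proof -
      have "cone_hull {} = {0}"
        using cone_hull_minimal[of "{}" "{0}"] cone_hull_closed(1)[of "{}"] by (auto simp: convex_cone_def)
      then show thesis
        using \<open>0(n := 1) \<in> cone_hull {rat_vec w'}\<close> that unfolding cone_hull_insert by auto
    qed
    have tn: "t * of_int (w' n) = 1"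
      using fun_cong[OF t(2), of n] by (simp add: rat_vec_def)
    then have "t > 0"
      using t(1) by (cases "t = 0") auto
    then have pos: "w' n > 0"
      using zero_less_mult_pos[of t "of_int (w' n)"] by (simp add: tn)
    have others: "w' i = 0" if "i \<noteq> n" for i
      using fun_cong[OF t(2), of i] that \<open>t > 0\<close> by (simp add: rat_vec_def)
    have "w' n dvd Gcd (w' ` {..<Suc n})"
      by (rule Gcd_greatest) (use others in \<open>metis dvd_0_right dvd_refl imageE\<close>)
    then have "w' n = 1"
      using pos by (simp add: prim zdvd1_eq)
    then have "w' = ?w"
      using others by (auto simp: fun_eq_iff)
    then show False
      using ne by blast
  qed
  then have "rat_of_int (w' n) = - c"
    using fun_cong[OF x(4), of n] by (simp add: rat_vec_def)
  then have "w' n \<le> 0"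
    using x(1) by (metis neg_le_0_iff_le of_int_le_0_iff)
  then show "0 \<le> pairing (Suc n) w' (0(n := - 1))"
    by (simp add: pw)
qed

end

section \<open>Evaluation of polynomials along a homomorphism of coefficients\<close>

locale coefficient_hom =
  fixes \<kappa> :: "'k::comm_ring_1 \<Rightarrow> 's::comm_ring_1"
  assumes hom_one: "\<kappa> 1 = 1"
    and hom_add: "\<kappa> (a + b) = \<kappa> a + \<kappa> b"
    and hom_mult: "\<kappa> (a * b) = \<kappa> a * \<kappa> b"
begin

lemma hom_zero [simp]: "\<kappa> 0 = 0"
  using hom_add[of 0 0] by simp

definition eval_at :: "'s \<Rightarrow> 'k poly \<Rightarrow> 's" where
  "eval_at x p = poly (map_poly \<kappa> p) x"

lemma eval_at_zero [simp]: "eval_at x 0 = 0"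
  by (simp add: eval_at_def)

lemma eval_at_pCons: "eval_at x (pCons c p) = \<kappa> c + x * eval_at x p"
  by (simp add: eval_at_def map_poly_pCons)

lemma eval_at_const [simp]: "eval_at x [:c:] = \<kappa> c"
  by (simp add: eval_at_pCons)

lemma eval_at_var [simp]: "eval_at x [:0, 1:] = x"
  by (simp add: eval_at_pCons hom_one)

lemma eval_at_one [simp]: "eval_at x 1 = 1"
  by (simp add: eval_at_def hom_one)

lemma eval_at_add: "eval_at x (p + q) = eval_at x p + eval_at x q"
  by (induction p q rule: poly_induct2) (simp_all add: eval_at_pCons hom_add algebra_simps)

lemma eval_at_smult: "eval_at x (smult c p) = \<kappa> c * eval_at x p"
  by (induction p) (simp_all add: eval_at_pCons hom_mult algebra_simps)

lemma eval_at_mult: "eval_at x (p * q) = eval_at x p * eval_at x q"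
  by (induction p) (simp_all add: eval_at_pCons eval_at_add eval_at_smult algebra_simps)

lemma eval_at_uminus: "eval_at x (- p) = - eval_at x p"
  using eval_at_add[of x p "- p"] by (simp add: add_eq_0_iff)

lemma eval_at_diff: "eval_at x (p - q) = eval_at x p - eval_at x q"
  using eval_at_add[of x p "- q"] by (simp add: eval_at_uminus)

end

lemma coefficient_hom_embedding: "field_embedding \<iota> \<Longrightarrow> coefficient_hom \<iota>"
  by (simp add: coefficient_hom_def field_embedding_def)

lemma embedding_eq_0_iff:
  assumes "field_embedding \<iota>"
  shows "\<iota> c = 0 \<longleftrightarrow> c = 0"
proof
  assume "\<iota> c = 0"
  show "c = 0"
  proof (rule ccontr)
    assume "c \<noteq> 0"
    then have "\<iota> c * \<iota> (inverse c) = 1"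
      using assms unfolding field_embedding_def by (metis right_inverse)
    then show False
      using \<open>\<iota> c = 0\<close> by simp
  qed
next
  assume "c = 0"
  then show "\<iota> c = 0"
    using assms unfolding field_embedding_def by (metis add.right_neutral add_left_cancel)
qed

section \<open>Places\<close>

context
  fixes \<iota> :: "'k::field \<Rightarrow> 'f::field" and z
  assumes z: "z \<in> places \<iota>"
begin

lemma place_zero: "z 0 = 0"
  using z by (simp add: places_def)

lemma place_mult: "f \<noteq> 0 \<Longrightarrow> g \<noteq> 0 \<Longrightarrow> z (f * g) = z f + z g"
  using z by (simp add: places_def)

lemma place_add: "f \<noteq> 0 \<Longrightarrow> g \<noteq> 0 \<Longrightarrow> f + g \<noteq> 0 \<Longrightarrow> z (f + g) \<ge> min (z f) (z g)"
  using z by (simp add: places_def)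

lemma place_const: "field_embedding \<iota> \<Longrightarrow> z (\<iota> c) = 0"
  using z embedding_eq_0_iff[of \<iota> c] by (cases "c = 0") (auto simp: places_def)

lemma place_uniformizer: obtains f where "f \<noteq> 0" "z f = 1"
  using z unfolding places_def by blast

lemma place_one: "z 1 = 0"
  using place_mult[of 1 1] by simp

lemma place_inverse: "z (inverse f) = - z f"
proof (cases "f = 0")
  case False
  then show ?thesis
    using place_mult[of f "inverse f"] place_one by simp
qed (simp add: place_zero)

lemma place_divide: "f \<noteq> 0 \<Longrightarrow> g \<noteq> 0 \<Longrightarrow> z (f / g) = z f - z g"
  using place_mult[of f "inverse g"] place_inverse[of g] by (simp add: divide_inverse)

lemma place_power: "f \<noteq> 0 \<Longrightarrow> z (f ^ k) = int k * z f"
  by (induction k) (simp_all add: place_one place_mult algebra_simps)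

lemma place_powi: "f \<noteq> 0 \<Longrightarrow> z (f powi k) = k * z f"
  by (simp add: power_int_def place_power place_inverse)

lemma place_prod:
  assumes "finite I" "\<And>i. i \<in> I \<Longrightarrow> f i \<noteq> 0"
  shows "z (\<Prod>i\<in>I. f i) = (\<Sum>i\<in>I. z (f i))"
  using assms by (induction I rule: finite_induct) (simp_all add: place_one place_mult)

lemma place_nonneg_add:
  assumes "z f \<ge> 0" "z g \<ge> 0"
  shows "z (f + g) \<ge> 0"
  using assms place_add[of f g] place_zero by (cases "f = 0"; cases "g = 0"; cases "f + g = 0") auto

lemma place_nonneg_mult:
  assumes "z f \<ge> 0" "z g \<ge> 0"
  shows "z (f * g) \<ge> 0"
  using assms place_mult[of f g] place_zero by (cases "f = 0"; cases "g = 0") auto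

end

lemma place_eval_nonneg:
  assumes "field_embedding \<iota>" "z \<in> places \<iota>" "z x \<ge> 0"
  shows "z (coefficient_hom.eval_at \<iota> x p) \<ge> 0"
proof -
  interpret coefficient_hom \<iota>
    using assms(1) by (rule coefficient_hom_embedding)
  show ?thesis
    by (induction p)
      (use assms place_zero[OF assms(2)] place_const[OF assms(2,1)] in
        \<open>auto simp: eval_at_pCons intro!: place_nonneg_add[OF assms(2)] place_nonneg_mult[OF assms(2)]\<close>)
qed

lemma place_minus:
  assumes "field_embedding \<iota>" "z \<in> places \<iota>"
  shows "z (- f) = z f"
proof (cases "f = 0")
  case False
  have "\<iota> 1 + \<iota> (- 1) = \<iota> 0" "\<iota> 0 = 0" "\<iota> 1 = 1"
    using assms(1) embedding_eq_0_iff[OF assms(1)] unfolding field_embedding_def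
    by (metis add.right_inverse, blast+)
  then have "\<iota> (- 1) = - 1"
    by (simp add: add_eq_0_iff)
  then have "z (- 1) = 0"
    using place_const[OF assms(2,1), of "- 1"] by simp
  then show ?thesis
    using False place_mult[OF assms(2), of "- 1" f] by simp
qed simp

text \<open>The ultrametric inequality is an equality when the two values differ.\<close>

lemma place_add_less:
  assumes "field_embedding \<iota>" "z \<in> places \<iota>" "f \<noteq> 0" "g = 0 \<or> z f < z g"
  shows "f + g \<noteq> 0 \<and> z (f + g) = z f"
proof (cases "g = 0")
  case False
  then have less: "z f < z g"
    using assms(4) by blast
  have ne: "f + g \<noteq> 0"
  proof
    assume "f + g = 0"
    then have "g = - f"
      by (simp add: add_eq_0_iff)
    then show False
      using less place_minus[OF assms(1,2)] by simp
  qed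
  have "z f \<ge> min (z (f + g)) (z g)"
    using place_add[OF assms(2) ne, of "- g"] False assms(3) place_minus[OF assms(1,2), of g] by simp
  then show ?thesis
    using place_add[OF assms(2,3) False ne] less ne by simp
qed (use assms in simp)

section \<open>The places of the rational function field\<close>

text \<open>The common shape of the point at infinity and of the points of the affine line.\<close>

definition fract_val :: "('k::field poly \<Rightarrow> int) \<Rightarrow> 'k poly fract \<Rightarrow> int" where
  "fract_val w f = (if f = 0 then 0 else
     (THE k. \<exists>p q. p \<noteq> 0 \<and> q \<noteq> 0 \<and> f = Fract p q \<and> k = w p - w q))"

lemma fract_val_Fract:
  assumes w: "\<And>p q. p \<noteq> 0 \<Longrightarrow> q \<noteq> 0 \<Longrightarrow> w (p * q) = w p + w q" and "p \<noteq> 0" "q \<noteq> 0"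
  shows "fract_val w (Fract p q) = w p - w q"
proof -
  have "w p' - w q' = w p - w q" if "p' \<noteq> 0" "q' \<noteq> 0" "Fract p q = Fract p' q'" for p' q'
  proof -
    have "p * q' = p' * q"
      using that assms by (simp add: eq_fract)
    then have "w p + w q' = w p' + w q"
      using w[of p q'] w[of p' q] that assms(2,3) by simp
    then show ?thesis
      by simp
  qed
  then have "(THE k. \<exists>p' q'. p' \<noteq> 0 \<and> q' \<noteq> 0 \<and> Fract p q = Fract p' q' \<and> k = w p' - w q') = w p - w q"
    using assms(2,3) by (intro the_equality) blast+
  moreover have "Fract p q \<noteq> 0"
    using assms(2,3) by (simp add: Zero_fract_def eq_fract)
  ultimately show ?thesis
    by (simp add: fract_val_def)
qed

lemma fract_nonzero_cases:
  assumes "f \<noteq> (0 :: 'k::field poly fract)"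
  obtains p q where "p \<noteq> 0" "q \<noteq> 0" "f = Fract p q"
  using assms by (cases f rule: Fract_cases_nonzero) auto

lemma fract_val_place:
  assumes w: "\<And>p q. p \<noteq> 0 \<Longrightarrow> q \<noteq> 0 \<Longrightarrow> w (p * q) = w p + w q"
    and add: "\<And>p q. p \<noteq> 0 \<Longrightarrow> q \<noteq> 0 \<Longrightarrow> p + q \<noteq> 0 \<Longrightarrow> w (p + q) \<ge> min (w p) (w q)"
    and const: "\<And>c. c \<noteq> 0 \<Longrightarrow> w [:c:] = 0"
    and one: "p1 \<noteq> 0" "q1 \<noteq> 0" "w p1 - w q1 = 1"
  shows "fract_val w \<in> P1"
  unfolding P1_def places_def
proof (intro CollectI conjI allI impI)
  note val = fract_val_Fract[of w, OF w]
  show "fract_val w 0 = 0"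
    by (simp add: fract_val_def)
  {
    fix f g :: "'a poly fract" assume "f \<noteq> 0" "g \<noteq> 0"
    then obtain p q r s where f: "p \<noteq> 0" "q \<noteq> 0" "f = Fract p q" and g: "r \<noteq> 0" "s \<noteq> 0" "g = Fract r s"
      by (metis fract_nonzero_cases)
    show "fract_val w (f * g) = fract_val w f + fract_val w g"
      using f g by (simp add: val w)
    assume "f + g \<noteq> 0"
    then have ne: "p * s + r * q \<noteq> 0"
      using f g by (auto simp: Zero_fract_def eq_fract)
    have "w (p * s + r * q) \<ge> min (w (p * s)) (w (r * q))"
      using ne f g by (intro add) auto
    then show "fract_val w (f + g) \<ge> min (fract_val w f) (fract_val w g)"
      using f g ne by (simp add: val w)
  }
  have w1: "w 1 = 0"
    using w[of 1 1] by simp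
  show "fract_val w (ratfun_const c) = 0" if "c \<noteq> 0" for c
    using that by (simp add: ratfun_const_def val const w1)
  show "\<exists>f. f \<noteq> 0 \<and> fract_val w f = 1"
    using one by (intro exI[of _ "Fract p1 q1"]) (simp add: val Zero_fract_def eq_fract)
qed

definition ord_at :: "'k::field \<Rightarrow> 'k poly fract \<Rightarrow> int" where
  "ord_at a = fract_val (\<lambda>p. int (order a p))"

lemma P1_infinity_fract_val: "P1_infinity = fract_val (\<lambda>p. - int (degree p))"
  by (simp add: fun_eq_iff P1_infinity_def fract_val_def)

lemma ord_at_Fract:
  assumes "p \<noteq> 0" "q \<noteq> 0"
  shows "ord_at a (Fract p q) = int (order a p) - int (order a q)"
  unfolding ord_at_def using assms by (intro fract_val_Fract) (auto simp: order_mult)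

lemma P1_infinity_Fract:
  assumes "p \<noteq> 0" "q \<noteq> 0"
  shows "P1_infinity (Fract p q) = int (degree q) - int (degree p)"
  unfolding P1_infinity_fract_val using fract_val_Fract[of "\<lambda>p. - int (degree p)" p q] assms
  by (simp add: degree_mult_eq)

lemma ord_at_P1: "ord_at a \<in> P1"
  unfolding ord_at_def
proof (rule fract_val_place[of _ "[:- a, 1:]" 1])
  fix p q :: "'a poly" assume pq: "p \<noteq> 0" "q \<noteq> 0" "p + q \<noteq> 0"
  define k where "k = min (order a p) (order a q)"
  have "[:- a, 1:] ^ k dvd p" "[:- a, 1:] ^ k dvd q"
    by (simp_all add: order_divides k_def)
  then have "[:- a, 1:] ^ k dvd p + q"
    by (rule dvd_add)
  then show "min (int (order a p)) (int (order a q)) \<le> int (order a (p + q))"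
    using pq by (simp add: order_divides k_def)
qed (use order_power_n_n[of a 1] in \<open>auto simp: order_mult order_0I\<close>)

lemma P1_infinity_P1: "P1_infinity \<in> P1"
  unfolding P1_infinity_fract_val
proof (rule fract_val_place[of _ 1 "[:0, 1:]"])
  fix p q :: "'a poly" assume "p \<noteq> 0" "q \<noteq> 0" "p + q \<noteq> 0"
  then show "min (- int (degree p)) (- int (degree q)) \<le> - int (degree (p + q))"
    using degree_add_le_max[of p q] by (simp add: max_def split: if_splits)
qed (auto simp: degree_mult_eq)

text \<open>
  On the polynomials a place is a multiple of a known valuation; as the place takes the value \<open>1\<close>, the
  factor is \<open>1\<close>.
\<close>

lemma place_eq_fract_val:
  assumes w: "\<And>p q. p \<noteq> 0 \<Longrightarrow> q \<noteq> 0 \<Longrightarrow> w (p * q) = w p + w q"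
    and z: "z \<in> P1" and e: "e > 0" "\<And>p. p \<noteq> 0 \<Longrightarrow> z (Fract p 1) = e * w p"
  shows "z = fract_val w"
proof -
  have z': "z \<in> places ratfun_const"
    using z by (simp add: P1_def)
  have val: "z f = e * fract_val w f" for f
  proof (cases "f = 0")
    case True
    then show ?thesis
      using place_zero[OF z'] by (simp add: fract_val_def)
  next
    case False
    then obtain p q where f: "p \<noteq> 0" "q \<noteq> 0" "f = Fract p q"
      by (rule fract_nonzero_cases)
    have ne: "Fract p 1 \<noteq> 0" "Fract q 1 \<noteq> 0"
      using f by (simp_all add: Zero_fract_def eq_fract)
    have "f = Fract p 1 / Fract q 1"
      by (simp add: f)
    then have "z f = z (Fract p 1) - z (Fract q 1)"
      using place_divide[OF z' ne] by simp
    then show ?thesis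
      using f by (simp add: e(2) fract_val_Fract[of w, OF w] algebra_simps)
  qed
  obtain f where "z f = 1"
    using place_uniformizer[OF z'] by blast
  then have "e = 1"
    using e(1) val[of f] by (metis pos_zmult_eq_1_iff)
  then show ?thesis
    using val by auto
qed

lemma field_embedding_ratfun_const: "field_embedding ratfun_const"
  by (simp add: field_embedding_def ratfun_const_def One_fract_def pCons_one mult.commute)

lemma Fract_pCons: "Fract (pCons c p) 1 = ratfun_const c + Fract [:0, 1:] 1 * Fract p 1"
  by (simp add: ratfun_const_def)

lemma eval_at_ratfun: "coefficient_hom.eval_at ratfun_const (Fract [:0, 1:] 1) p = Fract p 1"
proof -
  interpret coefficient_hom ratfun_const
    by (rule coefficient_hom_embedding[OF field_embedding_ratfun_const])
  show ?thesis
  proof (induction p)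
    case (pCons a p)
    then show ?case
      by (simp only: eval_at_pCons Fract_pCons[of a p])
  qed (simp add: Zero_fract_def)
qed

text \<open>
  A place at which the coordinate has a pole is determined by the leading term; at all other
  places the polynomials are integral, and some linear polynomial has to vanish there.
\<close>

theorem places_of_ratfun:
  assumes "z \<in> (P1 :: ('k::alg_closed_field poly fract \<Rightarrow> int) set)"
  shows "z (Fract [:0, 1:] 1) < 0 \<Longrightarrow> z = P1_infinity"
    and "z (Fract [:0, 1:] 1) \<ge> 0 \<Longrightarrow> \<exists>a. z = ord_at a"
proof -
  let ?t = "Fract [:0, 1:] 1 :: 'k poly fract"
  have z: "z \<in> places ratfun_const"
    using assms by (simp add: P1_def)
  note emb = field_embedding_ratfun_const
  have ne: "Fract p 1 \<noteq> 0" if "p \<noteq> 0" for p :: "'k poly"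
    using that by (simp add: Zero_fract_def eq_fract)
  have zmult: "z (Fract (p * q) 1) = z (Fract p 1) + z (Fract q 1)" if "p \<noteq> 0" "q \<noteq> 0" for p q
    using place_mult[OF z ne[OF that(1)] ne[OF that(2)]] by simp
  have zconst: "z (Fract [:c:] 1) = 0" for c
    using place_const[OF z emb, of c] by (simp add: ratfun_const_def)
  have split: "Fract (pCons c p) 1 = Fract ([:0, 1:] * p) 1 + Fract [:c:] 1" for c and p :: "'k poly"
    by simp
  show "z = P1_infinity" if neg: "z ?t < 0"
    unfolding P1_infinity_fract_val
  proof (rule place_eq_fract_val[OF _ assms, of _ "- z ?t"])
    show "z (Fract p 1) = - z ?t * - int (degree p)" if "p \<noteq> 0" for p
      using that
    proof (induction p)
      case (pCons c p)
      show ?case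
      proof (cases "p = 0")
        case False
        then have top: "z (Fract ([:0, 1:] * p) 1) = z ?t + z ?t * int (degree p)"
          using zmult[of "[:0, 1:]" p] pCons.IH[OF False] by simp
        have "z (Fract (pCons c p) 1) = z (Fract ([:0, 1:] * p) 1)"
          unfolding split[of c p]
        proof (rule conjunct2[OF place_add_less[OF emb z]])
          have "z ?t * int (degree p) \<le> 0"
            using neg by (simp add: mult_nonpos_nonneg)
          then show "Fract [:c:] 1 = 0 \<or> z (Fract ([:0, 1:] * p) 1) < z (Fract [:c:] 1)"
            using neg unfolding top zconst by linarith
        qed (use ne False in auto)
        then show ?thesis
          using False top by (simp add: algebra_simps)
      qed (use zconst in simp)
    qed simp
  qed (use neg in \<open>auto simp: degree_mult_eq\<close>)
  show "\<exists>a. z = ord_at a" if nonneg: "z ?t \<ge> 0"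
  proof -
    have int: "z (Fract p 1) \<ge> 0" for p
      using place_eval_nonneg[OF emb z nonneg, of p] by (simp add: eval_at_ratfun)
    have root: "\<exists>a. z (Fract [:- a, 1:] 1) > 0" if "p \<noteq> 0" "z (Fract p 1) > 0" for p
      using that
    proof (induction "degree p" arbitrary: p rule: less_induct)
      case less
      have "degree p \<noteq> 0"
      proof
        assume "degree p = 0"
        then obtain c where "p = [:c:]"
          by (rule degree_eq_zeroE)
        then show False
          using less.prems zconst by simp
      qed
      then obtain a where "poly p a = 0"
        using alg_closed_imp_poly_has_root by blast
      then obtain r where r: "p = [:- a, 1:] * r"
        by (auto simp: poly_eq_0_iff_dvd elim: dvdE)
      then have r0: "r \<noteq> 0"
        using less.prems by auto
      show ?case
      proof (cases "z (Fract r 1) > 0")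
        case True
        have "degree p = 1 + degree r"
          unfolding r using r0 by (subst degree_mult_eq) auto
        then have "degree r < degree p"
          by simp
        then show ?thesis
          using less.hyps r0 True by blast
      next
        case False
        then have "z (Fract [:- a, 1:] 1) > 0"
          using less.prems zmult[of "[:- a, 1:]" r] r0 by (simp add: r)
        then show ?thesis ..
      qed
    qed
    obtain f where f: "f \<noteq> 0" "z f = 1"
      using place_uniformizer[OF z] by blast
    then obtain p q where pq: "p \<noteq> 0" "q \<noteq> 0" "f = Fract p q"
      using fract_nonzero_cases by metis
    have "f = Fract p 1 / Fract q 1"
      by (simp add: pq)
    then have "z (Fract p 1) = 1 + z (Fract q 1)"
      using place_divide[OF z ne ne, OF pq(1,2)] f by simp
    then obtain a where a: "z (Fract [:- a, 1:] 1) > 0"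
      using root[OF pq(1)] int[of q] by auto
    have unit: "z (Fract r 1) = 0" if "poly r a \<noteq> 0" for r
    proof -
      have "poly (r - [:poly r a:]) a = 0"
        by simp
      then obtain s where "r - [:poly r a:] = [:- a, 1:] * s"
        by (metis poly_eq_0_iff_dvd dvdE)
      then have r: "r = [:poly r a:] + [:- a, 1:] * s"
        by (simp add: algebra_simps)
      have "z (Fract [:poly r a:] 1 + Fract ([:- a, 1:] * s) 1) = z (Fract [:poly r a:] 1)"
      proof (rule conjunct2[OF place_add_less[OF emb z]])
        show "Fract ([:- a, 1:] * s) 1 = 0 \<or> z (Fract [:poly r a:] 1) < z (Fract ([:- a, 1:] * s) 1)"
        proof (cases "s = 0")
          case False
          then have "z (Fract ([:- a, 1:] * s) 1) > 0"
            using zmult[of "[:- a, 1:]" s] a int[of s] by simp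
          then show ?thesis
            by (simp add: zconst)
        qed (simp add: Zero_fract_def)
      qed (use that ne in auto)
      moreover have "Fract [:poly r a:] 1 + Fract ([:- a, 1:] * s) 1 = Fract r 1"
        using arg_cong[OF r, of "\<lambda>r. Fract r 1"] by simp
      ultimately show ?thesis
        using zconst by simp
    qed
    have "z = ord_at a"
      unfolding ord_at_def
    proof (rule place_eq_fract_val[OF _ assms a])
      show "z (Fract p 1) = z (Fract [:- a, 1:] 1) * int (order a p)" if p: "p \<noteq> 0" for p
      proof -
        obtain r where r: "p = [:- a, 1:] ^ order a p * r" "\<not> [:- a, 1:] dvd r"
          using order_decomp[OF p] by blast
        then have r0: "r \<noteq> 0" "poly r a \<noteq> 0"
          using poly_eq_0_iff_dvd by auto
        have pow: "z (Fract ([:- a, 1:] ^ k) 1) = int k * z (Fract [:- a, 1:] 1)" for k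
        proof (induction k)
          case 0
          then show ?case
            using place_one[OF z] by (simp add: One_fract_def)
        next
          case (Suc k)
          then show ?case
            using zmult[of "[:- a, 1:]" "[:- a, 1:] ^ k"] by (simp add: algebra_simps)
        qed
        have "z (Fract p 1) = z (Fract ([:- a, 1:] ^ order a p) 1) + z (Fract r 1)"
          using arg_cong[OF r(1), of "\<lambda>p. z (Fract p 1)"] zmult[of "[:- a, 1:] ^ order a p" r] r0 by simp
        then show ?thesis
          unfolding pow unit[OF r0(2)] by simp
      qed
    qed (auto simp: order_mult)
    then show ?thesis ..
  qed
qed

lemma ord_at_coordinate: "ord_at a (Fract [:0, 1:] 1) \<ge> 0"
  by (simp add: ord_at_Fract)

lemma P1_infinity_coordinate: "P1_infinity (Fract [:0, 1:] 1) = - 1"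
  by (simp add: P1_infinity_Fract)

lemma ord_at_neq_P1_infinity: "ord_at (a :: 'k::field) \<noteq> P1_infinity"
proof
  assume "ord_at a = P1_infinity"
  then have "ord_at a (Fract [:0, 1:] 1) = P1_infinity (Fract [:0, 1:] (1 :: 'k poly))"
    by (rule fun_cong)
  then show False
    using ord_at_coordinate[of a] by (simp add: P1_infinity_coordinate)
qed

corollary P1_eq: "(P1 :: ('k::alg_closed_field poly fract \<Rightarrow> int) set) = insert P1_infinity (range ord_at)"
proof (intro equalityI subsetI)
  fix z :: "'k poly fract \<Rightarrow> int" assume "z \<in> P1"
  then show "z \<in> insert P1_infinity (range ord_at)"
    using places_of_ratfun[of z] by (cases "z (Fract [:0, 1:] 1) < 0") auto
qed (use P1_infinity_P1 ord_at_P1 in auto)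

corollary A1_eq: "(A1 :: ('k::alg_closed_field poly fract \<Rightarrow> int) set) = range ord_at"
  unfolding A1_def P1_eq using ord_at_neq_P1_infinity by auto

corollary A1_eq_integral:
  "(A1 :: ('k::alg_closed_field poly fract \<Rightarrow> int) set) = {z \<in> P1. z (Fract [:0, 1:] 1) \<ge> 0}"
  unfolding A1_eq using places_of_ratfun(2) ord_at_P1 ord_at_coordinate by blast

lemma inj_ord_at: "inj ord_at"
proof
  fix a b :: 'a assume eq: "ord_at a = ord_at b"
  have "ord_at a (Fract [:- a, 1:] 1) = 1"
    using order_power_n_n[of a 1] by (simp add: ord_at_Fract)
  then have "order b [:- a, 1:] \<noteq> 0"
    unfolding eq by (simp add: ord_at_Fract)
  then show "a = b"
  proof -
    have "poly [:- a, 1:] b = 0"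
      using order_0I[of "[:- a, 1:]" b] \<open>order b [:- a, 1:] \<noteq> 0\<close> by blast
    then show ?thesis
      by simp
  qed
qed

lemma ord_at_linear: "ord_at b (Fract [:- a, 1:] 1) = (if b = a then 1 else 0)"
  using order_power_n_n[of a 1] by (auto simp: ord_at_Fract order_0I)

text \<open>Over an algebraically closed field, poles of a reduced fraction are roots of its denominator.\<close>

lemma ratfun_without_finite_poles:
  fixes f :: "'k::alg_closed_field poly fract"
  assumes "f \<noteq> 0" "\<And>a. ord_at a f \<ge> 0"
  obtains p where "p \<noteq> 0" "f = Fract p 1"
proof -
  obtain p q where "p \<noteq> 0" "q \<noteq> 0" "f = Fract p q"
    using assms(1) by (rule fract_nonzero_cases)
  then have "\<exists>p. p \<noteq> 0 \<and> f = Fract p 1"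
  proof (induction "degree q" arbitrary: p q rule: less_induct)
    case less
    show ?case
    proof (cases "degree q = 0")
      case True
      then obtain c where c: "q = [:c:]"
        by (rule degree_eq_zeroE)
      then have "c \<noteq> 0"
        using less.prems by auto
      then have "f = Fract (smult (inverse c) p) 1"
        using less.prems by (simp add: c eq_fract)
      then show ?thesis
        using \<open>c \<noteq> 0\<close> less.prems(1) by (intro exI[of _ "smult (inverse c) p"]) simp
    next
      case False
      then obtain a where a: "poly q a = 0"
        using alg_closed_imp_poly_has_root by blast
      then have "order a q > 0"
        using less.prems order_gt_0_iff by blast
      moreover have "int (order a p) \<ge> int (order a q)"
        using assms(2)[of a] less.prems by (simp add: ord_at_Fract)
      ultimately have "poly p a = 0"
        using less.prems(1) order_gt_0_iff[of p a] by auto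
      then obtain p' q' where pq: "p = [:- a, 1:] * p'" "q = [:- a, 1:] * q'"
        using a by (metis poly_eq_0_iff_dvd dvdE)
      then have ne: "p' \<noteq> 0" "q' \<noteq> 0"
        using less.prems by auto
      have "f = Fract p' q'"
        unfolding less.prems(3) pq by (rule mult_fract_cancel) auto
      moreover have "degree q = 1 + degree q'"
        unfolding pq using ne by (subst degree_mult_eq) auto
      then have "degree q' < degree q"
        by simp
      ultimately show ?thesis
        using less.hyps ne by blast
    qed
  qed
  then show thesis
    using that by blast
qed

section \<open>Rational functions with prescribed orders on the affine line\<close>

definition ratfun_with_orders :: "('k::field \<Rightarrow> int) \<Rightarrow> 'k poly fract" where
  "ratfun_with_orders e = (\<Prod>a | e a \<noteq> 0. Fract [:- a, 1:] 1 powi e a)"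

context
  fixes e :: "'k::alg_closed_field \<Rightarrow> int"
  assumes fin: "finite {a. e a \<noteq> 0}"
begin

lemma linear_nonzero: "Fract [:- a, 1:] 1 \<noteq> (0 :: 'k poly fract)"
  by (simp add: Zero_fract_def eq_fract)

lemma ratfun_with_orders_nonzero: "ratfun_with_orders e \<noteq> 0"
  unfolding ratfun_with_orders_def using fin linear_nonzero by simp

lemma ord_at_ratfun_with_orders: "ord_at b (ratfun_with_orders e) = e b"
proof -
  have z: "ord_at b \<in> places ratfun_const"
    using ord_at_P1 by (simp add: P1_def)
  have "ord_at b (ratfun_with_orders e) = (\<Sum>a | e a \<noteq> 0. e a * ord_at b (Fract [:- a, 1:] 1))"
    unfolding ratfun_with_orders_def using fin linear_nonzero
    by (subst place_prod[OF z]) (auto simp: place_powi[OF z])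
  also have "\<dots> = (\<Sum>a | e a \<noteq> 0. if b = a then e a else 0)"
    by (rule sum.cong) (auto simp: ord_at_linear)
  also have "\<dots> = e b"
    using fin by simp
  finally show ?thesis .
qed

lemma P1_infinity_ratfun_with_orders: "P1_infinity (ratfun_with_orders e) = - (\<Sum>a | e a \<noteq> 0. e a)"
proof -
  have z: "P1_infinity \<in> places ratfun_const"
    using P1_infinity_P1 by (simp add: P1_def)
  have "P1_infinity (ratfun_with_orders e) = (\<Sum>a | e a \<noteq> 0. e a * P1_infinity (Fract [:- a, 1:] 1))"
    unfolding ratfun_with_orders_def using fin linear_nonzero
    by (subst place_prod[OF z]) (auto simp: place_powi[OF z])
  also have "\<dots> = (\<Sum>a | e a \<noteq> 0. - e a)"
    by (simp add: P1_infinity_Fract)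
  finally show ?thesis
    by (simp add: sum_negf)
qed

text \<open>
  Dividing by the function with the prescribed orders leaves a function without poles on the affine
  line, which is a polynomial.
\<close>

theorem ratfun_orders_bounded_iff:
  "f = 0 \<or> (\<forall>a. ord_at a f \<ge> e a) \<longleftrightarrow> (\<exists>p. f = ratfun_with_orders e * Fract p 1)"
proof
  let ?u = "ratfun_with_orders e"
  assume L: "f = 0 \<or> (\<forall>a. ord_at a f \<ge> e a)"
  show "\<exists>p. f = ?u * Fract p 1"
  proof (cases "f = 0")
    case True
    then show ?thesis
      by (intro exI[of _ 0]) (simp add: Zero_fract_def)
  next
    case False
    have "ord_at a (f / ?u) \<ge> 0" for a
      using L False ratfun_with_orders_nonzero ord_at_P1[of a]
      by (simp add: P1_def place_divide ord_at_ratfun_with_orders)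
    then obtain p where "f / ?u = Fract p 1"
      using ratfun_without_finite_poles[of "f / ?u"] False ratfun_with_orders_nonzero by auto
    then show ?thesis
      using ratfun_with_orders_nonzero by (intro exI[of _ p]) (simp add: field_simps)
  qed
next
  assume "\<exists>p. f = ratfun_with_orders e * Fract p 1"
  then obtain p where p: "f = ratfun_with_orders e * Fract p 1"
    by blast
  have "ord_at a f \<ge> e a" if "f \<noteq> 0" for a
  proof -
    have "p \<noteq> 0"
      using that p by (auto simp: Zero_fract_def[symmetric])
    then have "Fract p 1 \<noteq> 0"
      by (simp add: Zero_fract_def eq_fract)
    then have "ord_at a f = e a + ord_at a (Fract p 1)"
      using ord_at_P1[of a] ratfun_with_orders_nonzero
      by (simp add: p P1_def place_mult ord_at_ratfun_with_orders)
    then show ?thesis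
      using \<open>p \<noteq> 0\<close> by (simp add: ord_at_Fract)
  qed
  then show "f = 0 \<or> (\<forall>a. ord_at a f \<ge> e a)"
    by blast
qed

lemma P1_infinity_with_orders_mult:
  assumes "p \<noteq> 0"
  shows "P1_infinity (ratfun_with_orders e * Fract p 1) = - (\<Sum>a | e a \<noteq> 0. e a) - int (degree p)"
proof -
  have "P1_infinity \<in> places ratfun_const" "Fract p 1 \<noteq> 0"
    using assms P1_infinity_P1 by (simp_all add: P1_def Zero_fract_def eq_fract)
  then have "P1_infinity (ratfun_with_orders e * Fract p 1) =
      P1_infinity (ratfun_with_orders e) + P1_infinity (Fract p 1)"
    using ratfun_with_orders_nonzero by (intro place_mult)
  then show ?thesis
    using assms by (simp add: P1_infinity_ratfun_with_orders P1_infinity_Fract)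
qed

end

section \<open>Polynomials in characteristic zero\<close>

lemma exists_antiderivative:
  fixes p :: "'k::field_char_0 poly"
  shows "\<exists>a. pderiv a = p"
proof -
  have "pderiv (\<Sum>i\<le>degree p. monom (coeff p i / of_nat (Suc i)) (Suc i)) = (\<Sum>i\<le>degree p. monom (coeff p i) i)"
    by (simp add: higher_pderiv_sum[of 1, simplified] pderiv_monom del: of_nat_Suc)
  then show ?thesis
    by (metis poly_as_sum_of_monoms)
qed

text \<open>
  A vanishing Wronskian means proportionality: subtracting a multiple of \<open>r\<close> makes the degrees
  differ, and then the leading coefficients of \<open>p' r\<close> and \<open>p r'\<close> differ as well.
\<close>

lemma wronskian_zero:
  fixes p r :: "'k::field_char_0 poly"
  assumes "r \<noteq> 0" "pderiv p * r = p * pderiv r"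
  shows "\<exists>c. p = smult c r"
proof -
  have zero: "p = 0" if eq: "pderiv p * r = p * pderiv r" and deg: "p = 0 \<or> degree p \<noteq> degree r" for p :: "'k poly"
  proof (rule ccontr)
    assume p: "p \<noteq> 0"
    then have deg: "degree p \<noteq> degree r"
      using deg by blast
    let ?N = "degree p + degree r - 1"
    have top: "coeff (pderiv a * b) (degree a + degree b - 1) =
        of_nat (degree a) * lead_coeff a * lead_coeff b" if "degree a + degree b > 0" for a b :: "'k poly"
    proof (cases "degree a = 0")
      case True
      then show ?thesis
        using pderiv_eq_0_iff[of a] by simp
    next
      case False
      then have "degree a + degree b - 1 = degree (pderiv a) + degree b"
        by (simp add: degree_pderiv)
      then have "coeff (pderiv a * b) (degree a + degree b - 1) = lead_coeff (pderiv a) * lead_coeff b"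
        by (simp only: coeff_mult_degree_sum)
      also have "lead_coeff (pderiv a) = of_nat (degree a) * lead_coeff a"
        using False by (simp add: degree_pderiv coeff_pderiv)
      finally show ?thesis .
    qed
    have pos: "degree p + degree r > 0"
      using deg by auto
    have "coeff (pderiv p * r) ?N = of_nat (degree p) * lead_coeff p * lead_coeff r"
      by (rule top[OF pos])
    moreover have "coeff (pderiv r * p) ?N = of_nat (degree r) * lead_coeff r * lead_coeff p"
      using top[of r p] pos by (simp only: add.commute)
    moreover have "pderiv p * r = pderiv r * p"
      using eq by (simp only: mult.commute)
    ultimately have "of_nat (degree p) * lead_coeff p * lead_coeff r = of_nat (degree r) * lead_coeff r * lead_coeff p"
      by simp
    then have "of_nat (degree p) = (of_nat (degree r) :: 'k)"
      using p assms(1) by (simp add: mult.commute)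
    then show False
      using deg by simp
  qed
  show ?thesis
  proof (cases "p = 0 \<or> degree p \<noteq> degree r")
    case True
    then show ?thesis
      using zero[OF assms(2)] by (intro exI[of _ 0]) auto
  next
    case False
    define c where "c = lead_coeff p / lead_coeff r"
    define p1 where "p1 = p - smult c r"
    have "degree p1 < degree r" if "p1 \<noteq> 0"
    proof -
      have "degree p1 \<le> degree r"
        unfolding p1_def using False by (intro degree_diff_le) (auto intro: degree_smult_le)
      moreover have "coeff p1 (degree r) = 0"
        using False assms(1) by (simp add: p1_def c_def)
      ultimately show ?thesis
        using that by (metis leading_coeff_0_iff le_neq_implies_less)
    qed
    moreover have "pderiv p1 * r = p1 * pderiv r"
      using assms(2) by (simp add: p1_def pderiv_diff pderiv_smult algebra_simps)
    ultimately have "p1 = 0"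
      using zero[of p1] by fastforce
    then show ?thesis
      by (auto simp: p1_def)
  qed
qed

section \<open>Coordinates of a rational function field\<close>

definition coordinate :: "('k::field \<Rightarrow> 'f::field) \<Rightarrow> 'f \<Rightarrow> bool" where
  "coordinate \<iota> x \<longleftrightarrow> transcendental_elt \<iota> x \<and> simple_ext \<iota> x = UNIV"

context
  fixes \<iota> :: "'k::field \<Rightarrow> 'f::field"
  assumes emb: "field_embedding \<iota>"
begin

interpretation coefficient_hom \<iota>
  by (rule coefficient_hom_embedding[OF emb])

lemma transcendental_eval: "transcendental_elt \<iota> x \<Longrightarrow> eval_at x p = 0 \<longleftrightarrow> p = 0"
  by (auto simp: transcendental_elt_def eval_at_def)

lemma simple_ext_eval: "y \<in> simple_ext \<iota> x \<longleftrightarrow> (\<exists>p r. y = eval_at x p / eval_at x r \<and> eval_at x r \<noteq> 0)"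
  by (auto simp: simple_ext_def eval_at_def)

lemma simple_ext_closed:
  assumes "y \<in> simple_ext \<iota> x" "w \<in> simple_ext \<iota> x"
  shows "y + w \<in> simple_ext \<iota> x" "y * w \<in> simple_ext \<iota> x" "y / w \<in> simple_ext \<iota> x"
proof -
  obtain p r where y: "y = eval_at x p / eval_at x r" "eval_at x r \<noteq> 0"
    using assms(1) unfolding simple_ext_eval by blast
  obtain p' r' where w: "w = eval_at x p' / eval_at x r'" "eval_at x r' \<noteq> 0"
    using assms(2) unfolding simple_ext_eval by blast
  show "y + w \<in> simple_ext \<iota> x"
    unfolding simple_ext_eval y(1) w(1)
    by (rule exI[of _ "p * r' + p' * r"], rule exI[of _ "r * r'"])
      (use y(2) w(2) in \<open>simp add: eval_at_add eval_at_mult add_frac_eq\<close>)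
  show "y * w \<in> simple_ext \<iota> x"
    unfolding simple_ext_eval
    by (rule exI[of _ "p * p'"], rule exI[of _ "r * r'"]) (use y w in \<open>simp add: eval_at_mult\<close>)
  show "y / w \<in> simple_ext \<iota> x"
  proof (cases "eval_at x p' = 0")
    case True
    then show ?thesis
      unfolding simple_ext_eval by (intro exI[of _ 0] exI[of _ 1]) (simp add: w)
  next
    case False
    then show ?thesis
      unfolding simple_ext_eval
      by (intro exI[of _ "p * r'"] exI[of _ "r * p'"]) (use y w in \<open>simp add: eval_at_mult\<close>)
  qed
qed

lemma eval_in_simple_ext: "eval_at x p \<in> simple_ext \<iota> x"
  unfolding simple_ext_eval by (intro exI[of _ p] exI[of _ 1]) simp

lemma simple_ext_mono:
  assumes "x \<in> simple_ext \<iota> q"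
  shows "simple_ext \<iota> x \<subseteq> simple_ext \<iota> q"
proof
  have "eval_at x p \<in> simple_ext \<iota> q" for p
  proof (induction p)
    case 0
    then show ?case
      using eval_in_simple_ext[of q 0] by simp
  next
    case (pCons c p)
    have "\<iota> c \<in> simple_ext \<iota> q"
      using eval_in_simple_ext[of q "[:c:]"] by simp
    then show ?case
      unfolding eval_at_pCons using pCons.IH assms by (intro simple_ext_closed)
  qed
  then show "y \<in> simple_ext \<iota> q" if "y \<in> simple_ext \<iota> x" for y
    using that unfolding simple_ext_eval[of y x] by (auto intro: simple_ext_closed)
qed

text \<open>A coordinate identifies the field with the rational functions, polynomials being evaluated.\<close>

theorem coordinate_isomorphism:
  assumes "coordinate \<iota> q"
  obtains \<psi> where "bij \<psi>" "field_embedding \<psi>" "\<And>c. \<psi> (ratfun_const c) = \<iota> c"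
    "\<And>p. \<psi> (Fract p 1) = eval_at q p"
proof -
  have ne: "eval_at q p = 0 \<longleftrightarrow> p = 0" for p
    using assms transcendental_eval by (simp add: coordinate_def)
  define \<psi> where "\<psi> f = (SOME y. \<exists>p r. r \<noteq> 0 \<and> f = Fract p r \<and> y = eval_at q p / eval_at q r)" for f
  have \<psi>: "\<psi> (Fract p r) = eval_at q p / eval_at q r" if r: "r \<noteq> 0" for p r
  proof -
    have "\<exists>p' r'. r' \<noteq> 0 \<and> Fract p r = Fract p' r' \<and> \<psi> (Fract p r) = eval_at q p' / eval_at q r'"
      unfolding \<psi>_def by (rule someI_ex) (use r in blast)
    then obtain p' r' where p': "r' \<noteq> 0" "Fract p r = Fract p' r'"
        "\<psi> (Fract p r) = eval_at q p' / eval_at q r'"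
      by blast
    then have "p * r' = p' * r"
      using r by (simp add: eq_fract)
    then have "eval_at q p * eval_at q r' = eval_at q p' * eval_at q r"
      by (metis eval_at_mult)
    then show ?thesis
      unfolding p'(3) using p'(1) r ne by (simp add: frac_eq_eq)
  qed
  have add: "\<psi> (f + g) = \<psi> f + \<psi> g" and mult: "\<psi> (f * g) = \<psi> f * \<psi> g" for f g
  proof -
    obtain p r where f: "r \<noteq> 0" "f = Fract p r"
      by (cases f) auto
    obtain p' r' where g: "r' \<noteq> 0" "g = Fract p' r'"
      by (cases g) auto
    show "\<psi> (f + g) = \<psi> f + \<psi> g"
      using f g ne by (simp add: \<psi> eval_at_add eval_at_mult field_simps)
    show "\<psi> (f * g) = \<psi> f * \<psi> g"
      using f g ne by (simp add: \<psi> eval_at_mult)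
  qed
  have one: "\<psi> 1 = 1"
    by (simp add: One_fract_def \<psi>)
  then have femb: "field_embedding \<psi>"
    using add mult by (simp add: field_embedding_def)
  have "inj \<psi>"
  proof
    fix f g assume "\<psi> f = \<psi> g"
    then have "\<psi> (f - g) = 0"
      using add[of "f - g" g] by simp
    then show "f = g"
      using embedding_eq_0_iff[OF femb, of "f - g"] by simp
  qed
  moreover have "\<exists>f. y = \<psi> f" for y
  proof -
    obtain p r where "y = eval_at q p / eval_at q r" "eval_at q r \<noteq> 0"
      using assms simple_ext_eval[of y q] by (auto simp: coordinate_def)
    then show ?thesis
      using \<psi>[of r p] ne by metis
  qed
  ultimately have "bij \<psi>"
    by (auto simp: bij_def surj_def)
  moreover have "\<psi> (ratfun_const c) = \<iota> c" "\<psi> (Fract p 1) = eval_at q p" for c p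
    by (simp_all add: ratfun_const_def \<psi>)
  ultimately show thesis
    using that femb by blast
qed

end

lemma field_embedding_inv:
  assumes "field_embedding \<phi>" "bij \<phi>"
  shows "field_embedding (inv \<phi>)"
  unfolding field_embedding_def
proof (intro conjI allI)
  have surj: "\<phi> (inv \<phi> y) = y" for y
    using assms(2) by (simp add: bij_is_surj surj_f_inv_f)
  have inj: "a = b" if "\<phi> a = \<phi> b" for a b
    using that assms(2) by (metis bij_inv_eq_iff)
  show "inv \<phi> 1 = 1"
    by (rule inj) (use assms(1) surj in \<open>simp add: field_embedding_def\<close>)
  fix a b
  show "inv \<phi> (a + b) = inv \<phi> a + inv \<phi> b" "inv \<phi> (a * b) = inv \<phi> a * inv \<phi> b"
    by (rule inj; use assms(1) surj in \<open>simp add: field_embedding_def\<close>)+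
qed

lemma places_comp:
  fixes \<iota> :: "'k::field \<Rightarrow> 'f::field" and \<iota>' :: "'k \<Rightarrow> 'g::field"
  assumes "field_embedding \<phi>" "\<And>c. \<phi> (\<iota> c) = \<iota>' c" "surj \<phi>" "z \<in> places \<iota>'"
  shows "z \<circ> \<phi> \<in> places \<iota>"
proof -
  have ne: "\<phi> f = 0 \<longleftrightarrow> f = 0" for f
    by (rule embedding_eq_0_iff[OF assms(1)])
  have hom: "\<phi> (f + g) = \<phi> f + \<phi> g" "\<phi> (f * g) = \<phi> f * \<phi> g" for f g
    using assms(1) by (simp_all add: field_embedding_def)
  obtain f where f: "f \<noteq> 0" "z f = 1"
    using place_uniformizer[OF assms(4)] .
  obtain g where g: "f = \<phi> g"
    using assms(3) by (auto simp: surj_def)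
  show ?thesis
    unfolding places_def
  proof (intro CollectI conjI allI impI)
    show "(z \<circ> \<phi>) 0 = 0"
      using place_zero[OF assms(4)] ne[of 0] by simp
    show "\<exists>f. f \<noteq> 0 \<and> (z \<circ> \<phi>) f = 1"
      using f g ne by (intro exI[of _ g]) auto
    show "(z \<circ> \<phi>) (\<iota> c) = 0" if "c \<noteq> 0" for c
      using assms(4) that by (simp add: assms(2) places_def)
  next
    fix f g :: 'f assume "f \<noteq> 0" "g \<noteq> 0"
    then show "(z \<circ> \<phi>) (f * g) = (z \<circ> \<phi>) f + (z \<circ> \<phi>) g"
      using place_mult[OF assms(4)] ne by (simp add: hom)
  next
    fix f g :: 'f assume fg: "f \<noteq> 0" "g \<noteq> 0" "f + g \<noteq> 0"
    then have "\<phi> f + \<phi> g \<noteq> 0"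
      using ne[of "f + g"] by (simp add: hom)
    then show "min ((z \<circ> \<phi>) f) ((z \<circ> \<phi>) g) \<le> (z \<circ> \<phi>) (f + g)"
      using place_add[OF assms(4), of "\<phi> f" "\<phi> g"] fg ne by (simp add: hom)
  qed
qed

section \<open>Graded derivations of degree zero\<close>

text \<open>
  A homogeneous derivation of degree zero, seen on the coefficients: \<open>P m\<close> are the coefficients
  that occur in degree \<open>m\<close>, and \<open>d m\<close> is the derivation on them.
\<close>

locale graded_lnd =
  fixes \<iota> :: "'k::field_char_0 \<Rightarrow> 'f::field"
    and S :: "(nat \<Rightarrow> int) set"
    and P :: "(nat \<Rightarrow> int) \<Rightarrow> 'f set"
    and d :: "(nat \<Rightarrow> int) \<Rightarrow> 'f \<Rightarrow> 'f"
  assumes emb: "field_embedding \<iota>"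
    and S_zero: "0 \<in> S"
    and S_add: "m \<in> S \<Longrightarrow> m' \<in> S \<Longrightarrow> m + m' \<in> S"
    and P_add: "m \<in> S \<Longrightarrow> f \<in> P m \<Longrightarrow> g \<in> P m \<Longrightarrow> f + g \<in> P m"
    and P_smult: "m \<in> S \<Longrightarrow> f \<in> P m \<Longrightarrow> \<iota> c * f \<in> P m"
    and P_mult: "m \<in> S \<Longrightarrow> m' \<in> S \<Longrightarrow> f \<in> P m \<Longrightarrow> g \<in> P m' \<Longrightarrow> f * g \<in> P (m + m')"
    and P_one: "1 \<in> P 0"
    and d_mem: "m \<in> S \<Longrightarrow> f \<in> P m \<Longrightarrow> d m f \<in> P m"
    and d_add: "m \<in> S \<Longrightarrow> f \<in> P m \<Longrightarrow> g \<in> P m \<Longrightarrow> d m (f + g) = d m f + d m g"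
    and d_smult: "m \<in> S \<Longrightarrow> f \<in> P m \<Longrightarrow> d m (\<iota> c * f) = \<iota> c * d m f"
    and d_mult: "m \<in> S \<Longrightarrow> m' \<in> S \<Longrightarrow> f \<in> P m \<Longrightarrow> g \<in> P m' \<Longrightarrow>
      d (m + m') (f * g) = d m f * g + f * d m' g"
    and d_nilpotent: "m \<in> S \<Longrightarrow> f \<in> P m \<Longrightarrow> \<exists>k. (d m ^^ k) f = 0"
begin

sublocale coefficient_hom \<iota>
  by (rule coefficient_hom_embedding[OF emb])

lemma d_zero: "m \<in> S \<Longrightarrow> f \<in> P m \<Longrightarrow> d m 0 = 0"
  using d_smult[of m f 0] by simp

lemma P_nonzero_zero: "m \<in> S \<Longrightarrow> f \<in> P m \<Longrightarrow> 0 \<in> P m"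
  using P_smult[of m f 0] by simp

lemma d_funpow_mem: "m \<in> S \<Longrightarrow> f \<in> P m \<Longrightarrow> (d m ^^ k) f \<in> P m"
  by (induction k) (simp_all add: d_mem)

text \<open>
  A way to write \<open>y\<close> as a quotient of two elements of one piece, which makes it an invariant
  rational function.
\<close>

definition denominator :: "'f \<Rightarrow> (nat \<Rightarrow> int) \<Rightarrow> 'f \<Rightarrow> bool" where
  "denominator y m f \<longleftrightarrow> m \<in> S \<and> f \<noteq> 0 \<and> f \<in> P m \<and> y * f \<in> P m"

text \<open>The extension of the derivation to the invariant rational functions, by the quotient rule.\<close>

definition E :: "'f \<Rightarrow> 'f" where
  "E y = (SOME e. \<exists>m f. denominator y m f \<and> e = (d m (y * f) - y * d m f) / f)"

lemma E_denominator:
  assumes "denominator y m f"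
  shows "d m (y * f) = E y * f + y * d m f"
proof -
  have "\<exists>m f. denominator y m f \<and> E y = (d m (y * f) - y * d m f) / f"
    unfolding E_def by (rule someI_ex) (use assms in blast)
  then obtain m' g where g: "denominator y m' g" "E y = (d m' (y * g) - y * d m' g) / g"
    by blast
  \<comment> \<open>Both ways of differentiating \<open>y f g\<close> agree.\<close>
  have "d (m + m') ((y * f) * g) = d m (y * f) * g + y * f * d m' g"
    using assms g(1) by (intro d_mult) (auto simp: denominator_def)
  moreover have "d (m + m') (f * (y * g)) = d m f * (y * g) + f * d m' (y * g)"
    using assms g(1) by (intro d_mult) (auto simp: denominator_def)
  moreover have "(y * f) * g = f * (y * g)"
    by simp
  ultimately have "d m (y * f) * g + y * f * d m' g = d m f * (y * g) + f * d m' (y * g)"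
    by simp
  moreover have g0: "g \<noteq> 0"
    using g(1) by (simp add: denominator_def)
  then have "d m' (y * g) = E y * g + y * d m' g"
    using g(2) by (simp add: field_simps)
  ultimately have "d m (y * f) * g = (E y * f + y * d m f) * g"
    by (simp add: algebra_simps)
  then show ?thesis
    using g0 by simp
qed

lemma denominator_mult:
  assumes "denominator y m f" "denominator w m' g"
  shows "denominator y (m + m') (f * g)" "denominator w (m + m') (f * g)"
    "denominator (y + w) (m + m') (f * g)" "denominator (y * w) (m + m') (f * g)"
proof -
  have mem: "m \<in> S" "m' \<in> S" "m + m' \<in> S" "f \<noteq> 0" "g \<noteq> 0" "f \<in> P m" "g \<in> P m'" "y * f \<in> P m" "w * g \<in> P m'"
    using assms S_add by (auto simp: denominator_def)
  have prods: "f * g \<in> P (m + m')" "(y * f) * g \<in> P (m + m')" "f * (w * g) \<in> P (m + m')"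
      "(y * f) * (w * g) \<in> P (m + m')"
    using mem by (auto intro: P_mult)
  show y: "denominator y (m + m') (f * g)" and w: "denominator w (m + m') (f * g)"
    and "denominator (y * w) (m + m') (f * g)"
    using mem prods by (auto simp: denominator_def mult_ac)
  show "denominator (y + w) (m + m') (f * g)"
    using y w by (auto simp: denominator_def distrib_right intro: P_add)
qed

lemma powers_in_graded_pieces:
  assumes "m0 \<in> S" "u \<in> P m0" "x * u \<in> P m0"
  shows "\<exists>m\<in>S. \<forall>i\<le>k. x ^ i * u ^ k \<in> P m"
proof (induction k)
  case 0
  then show ?case
    using S_zero P_one by auto
next
  case (Suc k)
  then obtain m where m: "m \<in> S" "\<And>i. i \<le> k \<Longrightarrow> x ^ i * u ^ k \<in> P m"
    by blast
  have "x ^ i * u ^ Suc k \<in> P (m + m0)" if "i \<le> Suc k" for i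
  proof (cases i)
    case 0
    then show ?thesis
      using P_mult[OF m(1) assms(1) m(2)[of 0] assms(2)] by (simp add: mult_ac)
  next
    case (Suc j)
    then show ?thesis
      using P_mult[OF m(1) assms(1) m(2)[of j] assms(3)] that by (simp add: mult_ac)
  qed
  then show ?case
    using S_add[OF m(1) assms(1)] by blast
qed

lemma eval_mult_in_graded_piece:
  assumes "m \<in> S" "\<And>i. i \<le> k \<Longrightarrow> x ^ i * v \<in> P m" "degree p \<le> k"
  shows "eval_at x p * v \<in> P m"
  using assms(2,3)
proof (induction p arbitrary: v k)
  case 0
  then show ?case
    using P_nonzero_zero[OF assms(1) 0(1)[of 0]] by simp
next
  case (pCons c p)
  have "\<iota> c * v \<in> P m"
    using P_smult[OF assms(1) pCons.prems(1)[of 0]] by simp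
  moreover have "eval_at x p * (x * v) \<in> P m"
  proof (cases "p = 0")
    case True
    then show ?thesis
      using P_nonzero_zero[OF assms(1) pCons.prems(1)[of 0]] by simp
  next
    case False
    then obtain k' where k: "k = Suc k'" "degree p \<le> k'"
      using pCons.prems(2) by (cases k) auto
    show ?thesis
    proof (rule pCons.IH[OF _ k(2)])
      show "x ^ i * (x * v) \<in> P m" if "i \<le> k'" for i
        using pCons.prems(1)[of "Suc i"] that by (simp add: k(1) mult_ac)
    qed
  qed
  ultimately have "\<iota> c * v + eval_at x p * (x * v) \<in> P m"
    by (rule P_add[OF assms(1)])
  then show ?case
    by (simp add: eval_at_pCons algebra_simps)
qed

text \<open>
  If \<open>u\<close> and \<open>x u\<close> occur in one degree, then \<open>p(x) u\<^sup>k\<close> occurs in a multiple of that degree for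
  every polynomial \<open>p\<close> of degree at most \<open>k\<close>. Numerator and denominator of a rational function of
  \<open>x\<close> therefore occur, up to the same factor, in a common degree.
\<close>

lemma denominators_exist:
  assumes "coordinate \<iota> x" "m0 \<in> S" "u \<noteq> 0" "u \<in> P m0" "x * u \<in> P m0"
  shows "\<exists>m f. denominator y m f"
proof -
  obtain p r where y: "y = eval_at x p / eval_at x r" "eval_at x r \<noteq> 0"
    using assms(1) simple_ext_eval[OF emb, of y x] by (auto simp: coordinate_def)
  define k where "k = max (degree p) (degree r)"
  obtain m where m: "m \<in> S" "\<And>i. i \<le> k \<Longrightarrow> x ^ i * u ^ k \<in> P m"
    using powers_in_graded_pieces[OF assms(2,4,5)] by blast
  have "eval_at x s * u ^ k \<in> P m" if "degree s \<le> k" for s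
    using m(2) that by (rule eval_mult_in_graded_piece[OF m(1)])
  then have "eval_at x p * u ^ k \<in> P m" "eval_at x r * u ^ k \<in> P m"
    by (simp_all add: k_def)
  moreover have "eval_at x p * u ^ k = y * (eval_at x r * u ^ k)"
    using y by simp
  ultimately have "denominator y m (eval_at x r * u ^ k)"
    using m(1) y(2) assms(3) by (simp add: denominator_def)
  then show ?thesis
    by blast
qed

end

text \<open>
  Every element of the field is such a quotient, so the quotient rule gives a derivation of the
  whole field.
\<close>

locale graded_lnd_full = graded_lnd +
  assumes full: "\<exists>m f. denominator y m f"
begin

lemma d_quotient:
  assumes "m \<in> S" "f \<in> P m" "y * f \<in> P m"
  shows "d m (y * f) = E y * f + y * d m f"
proof (cases "f = 0")
  case True
  then show ?thesis
    using d_zero[OF assms(1,2)] by simp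
next
  case False
  then show ?thesis
    using assms by (intro E_denominator) (simp add: denominator_def)
qed

lemma E_add: "E (y + w) = E y + E w"
proof -
  obtain m f m' g where fg: "denominator y m f" "denominator w m' g"
    using full by metis
  let ?m = "m + m'" and ?h = "f * g"
  note den = denominator_mult[OF fg]
  have mem: "?m \<in> S" "?h \<noteq> 0" "y * ?h \<in> P ?m" "w * ?h \<in> P ?m"
    using den by (auto simp: denominator_def)
  have "E (y + w) * ?h + (y + w) * d ?m ?h = d ?m (y * ?h + w * ?h)"
    using E_denominator[OF den(3)] by (simp add: distrib_right)
  also have "\<dots> = (E y * ?h + y * d ?m ?h) + (E w * ?h + w * d ?m ?h)"
    using mem by (simp add: d_add E_denominator[OF den(1)] E_denominator[OF den(2)])
  finally have "E (y + w) * ?h = (E y + E w) * ?h"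
    by (simp add: algebra_simps)
  then show ?thesis
    using mem(2) by simp
qed

lemma E_mult: "E (y * w) = E y * w + y * E w"
proof -
  obtain m f m' g where fg: "denominator y m f" "denominator w m' g"
    using full by metis
  let ?m = "m + m'" and ?h = "f * g"
  note den = denominator_mult[OF fg]
  have mem: "m \<in> S" "m' \<in> S" "f \<noteq> 0" "g \<noteq> 0" "f \<in> P m" "g \<in> P m'" "y * f \<in> P m" "w * g \<in> P m'"
    using fg by (auto simp: denominator_def)
  have "E (y * w) * ?h + (y * w) * d ?m ?h = d ?m ((y * f) * (w * g))"
    using E_denominator[OF den(4)] by (simp add: mult_ac)
  also have "\<dots> = d m (y * f) * (w * g) + (y * f) * d m' (w * g)"
    using mem by (intro d_mult)
  also have "\<dots> = (E y * f + y * d m f) * (w * g) + (y * f) * (E w * g + w * d m' g)"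
    by (simp add: E_denominator[OF fg(1)] E_denominator[OF fg(2)])
  finally have "E (y * w) * ?h + (y * w) * (d m f * g + f * d m' g) =
      (E y * f + y * d m f) * (w * g) + (y * f) * (E w * g + w * d m' g)"
    using mem by (simp add: d_mult)
  then have "E (y * w) * ?h = (E y * w + y * E w) * ?h"
    by (simp add: algebra_simps)
  then show ?thesis
    using mem by simp
qed

lemma E_const [simp]: "E (\<iota> c) = 0"
proof -
  obtain m f where f: "denominator (\<iota> c) m f"
    using full by blast
  then have "d m (\<iota> c * f) = \<iota> c * d m f" "f \<noteq> 0"
    by (auto simp: denominator_def d_smult)
  then show ?thesis
    using E_denominator[OF f] by simp
qed

lemma E_zero [simp]: "E 0 = 0"
  using E_const[of 0] by simp

lemma E_minus: "E (- y) = - E y"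
  using E_add[of y "- y"] by (simp add: add_eq_0_iff)

lemma E_diff: "E (y - w) = E y - E w"
  using E_add[of y "- w"] by (simp add: E_minus)

lemma E_eval: "E (eval_at x p) = eval_at x (pderiv p) * E x"
  by (induction p) (simp_all add: eval_at_pCons pderiv_pCons E_add E_mult eval_at_add algebra_simps)

lemma E_divide:
  assumes "w \<noteq> 0" "E (y / w) = 0"
  shows "E y * w = y * E w"
  using E_mult[of "y / w" w] assms by simp

lemma E_nonzero:
  assumes "m \<in> S" "f \<in> P m" "g \<in> P m" "d m f * g \<noteq> f * d m g"
  obtains y where "E y \<noteq> 0"
proof -
  have "g \<noteq> 0"
    using assms(4) d_zero[OF assms(1,2)] by auto
  then have "d m f = E (f / g) * g + (f / g) * d m g"
    using d_quotient[OF assms(1,3), of "f / g"] assms(2) by simp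
  then have "E (f / g) \<noteq> 0"
    using assms(4) \<open>g \<noteq> 0\<close> by auto
  then show thesis
    using that by blast
qed

lemma E_coordinate_nonzero:
  assumes "coordinate \<iota> x" "E y \<noteq> 0"
  shows "E x \<noteq> 0"
proof
  assume "E x = 0"
  obtain p r where y: "y = eval_at x p / eval_at x r" "eval_at x r \<noteq> 0"
    using assms(1) simple_ext_eval[OF emb, of y x] by (auto simp: coordinate_def)
  then have "E (eval_at x p) = E y * eval_at x r + y * E (eval_at x r)"
    using E_mult[of y "eval_at x r"] by simp
  then show False
    using assms(2) y(2) \<open>E x = 0\<close> by (simp add: E_eval)
qed

text \<open>
  For a quotient of polynomials in \<open>x\<close> the numerator of the derivative is the Wronskian.
\<close>

lemma E_kernel:
  assumes "coordinate \<iota> x" "E x \<noteq> 0" "E y = 0"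
  obtains c where "y = \<iota> c"
proof -
  obtain p r where y: "y = eval_at x p / eval_at x r" "eval_at x r \<noteq> 0"
    using assms(1) simple_ext_eval[OF emb, of y x] by (auto simp: coordinate_def)
  have "E (eval_at x p) * eval_at x r = eval_at x p * E (eval_at x r)"
    using E_divide[OF y(2), of "eval_at x p"] y assms(3) by simp
  then have "eval_at x (pderiv p * r - p * pderiv r) = 0"
    using assms(2) by (simp add: E_eval eval_at_diff eval_at_mult)
  then have "pderiv p * r = p * pderiv r"
    using transcendental_eval[OF emb] assms(1) by (auto simp: coordinate_def)
  moreover have "r \<noteq> 0"
    using y(2) by auto
  ultimately obtain c where "p = smult c r"
    using wronskian_zero by blast
  then have "y = \<iota> c"
    using y by (simp add: eval_at_smult)
  then show thesis
    using that by blast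
qed

text \<open>In a coordinate with derivative \<open>1\<close>, the nilpotent elements are the polynomials.\<close>

lemma E_nilpotent_imp_polynomial:
  assumes ker: "\<And>y. E y = 0 \<Longrightarrow> \<exists>c. y = \<iota> c" and q: "E q = 1"
  shows "(E ^^ k) y = 0 \<Longrightarrow> \<exists>p. y = eval_at q p"
proof (induction k arbitrary: y)
  case 0
  then show ?case
    by (intro exI[of _ 0]) simp
next
  case (Suc k)
  then have "(E ^^ k) (E y) = 0"
    by (simp add: funpow_swap1)
  then obtain p where p: "E y = eval_at q p"
    using Suc.IH by blast
  obtain a where "pderiv a = p"
    using exists_antiderivative by blast
  then have "E (y - eval_at q a) = 0"
    using p q by (simp add: E_diff E_eval)
  then obtain c where "y - eval_at q a = \<iota> c"
    using ker by blast
  then have "y = eval_at q (a + [:c:])"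
    by (simp add: eval_at_add algebra_simps)
  then show ?case
    by blast
qed

text \<open>
  A nonzero nilpotent operator has a Jordan block of length two: \<open>d f1 = f0 \<noteq> 0\<close> and
  \<open>d f0 = 0\<close>. The quotient \<open>q = f1 / f0\<close> then has derivative \<open>1\<close>. Every other quotient by
  \<open>f0\<close> is nilpotent, hence a polynomial in \<open>q\<close>, so \<open>q\<close> generates the field as soon as the
  piece contains two elements with quotient a coordinate.
\<close>

theorem slice_coordinate:
  assumes x: "coordinate \<iota> x" and ne: "E y0 \<noteq> 0"
    and m: "m \<in> S" and u: "u \<noteq> 0" "u \<in> P m" "x * u \<in> P m"
  obtains q f where "coordinate \<iota> q" "E q = 1" "f \<noteq> 0" "f \<in> P m" "q * f \<in> P m" "d m f = 0"
    "\<And>v. v \<in> P m \<Longrightarrow> \<exists>p. v = f * eval_at q p"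
proof -
  have Ex: "E x \<noteq> 0"
    by (rule E_coordinate_nonzero[OF x ne])
  have ker: "\<exists>c. y = \<iota> c" if "E y = 0" for y
    using E_kernel[OF x Ex that] by blast
  have "\<exists>v\<in>P m. d m v \<noteq> 0"
  proof (rule ccontr)
    assume "\<not> ?thesis"
    then have "E x * u = 0"
      using d_quotient[OF m u(2,3)] u by auto
    then show False
      using Ex u(1) by simp
  qed
  then obtain v where v: "v \<in> P m" "d m v \<noteq> 0"
    by blast
  \<comment> \<open>The last two nonzero iterates of \<open>v\<close> form the Jordan block.\<close>
  define k where "k = (LEAST k. (d m ^^ k) v = 0)"
  have k: "(d m ^^ k) v = 0"
    unfolding k_def using d_nilpotent[OF m v(1)] by (rule LeastI_ex)
  have less: "(d m ^^ i) v \<noteq> 0" if "i < k" for i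
    using that not_less_Least unfolding k_def by blast
  have "k \<noteq> 0"
    using k v d_zero[OF m v(1)] by (metis funpow_0)
  moreover have "k \<noteq> 1"
    using k v by auto
  ultimately obtain j where j: "k = Suc (Suc j)"
    by (metis One_nat_def old.nat.exhaust)
  define f1 where "f1 = (d m ^^ j) v"
  define f where "f = d m f1"
  have f1: "f1 \<in> P m"
    unfolding f1_def by (rule d_funpow_mem[OF m v(1)])
  then have f: "f \<in> P m"
    unfolding f_def by (rule d_mem[OF m])
  have f0: "f \<noteq> 0"
    using less[of "Suc j"] j by (simp add: f_def f1_def)
  have df: "d m f = 0"
    using k by (simp add: f_def f1_def j)
  define q where "q = f1 / f"
  have qf: "q * f = f1"
    using f0 by (simp add: q_def)
  have Eq: "E q = 1"
    using d_quotient[OF m f, of q] f1 df f0 by (simp add: qf f_def[symmetric])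
  have poly: "\<exists>p. w = f * eval_at q p" if w: "w \<in> P m" for w
  proof -
    have iter: "(d m ^^ i) w = (E ^^ i) (w / f) * f" for i
    proof (induction i)
      case 0
      then show ?case using f0 by simp
    next
      case (Suc i)
      have "(E ^^ i) (w / f) * f \<in> P m"
        using d_funpow_mem[OF m w, of i] Suc by simp
      then show ?case
        using d_quotient[OF m f, of "(E ^^ i) (w / f)"] df Suc by simp
    qed
    obtain i where "(d m ^^ i) w = 0"
      using d_nilpotent[OF m w] by blast
    then have "(E ^^ i) (w / f) = 0"
      using iter[of i] f0 by simp
    then obtain p where "w / f = eval_at q p"
      using E_nilpotent_imp_polynomial[OF ker Eq] by blast
    then show ?thesis
      using f0 by (intro exI[of _ p]) (simp add: field_simps)
  qed
  have "transcendental_elt \<iota> q"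
  proof -
    have "p = 0" if "eval_at q p = 0" for p
      using that
    proof (induction "degree p" arbitrary: p rule: less_induct)
      case less
      show ?case
      proof (cases "degree p = 0")
        case True
        then obtain c where "p = [:c:]"
          by (rule degree_eq_zeroE)
        then show ?thesis
          using less.prems embedding_eq_0_iff[OF emb] by simp
      next
        case False
        have "eval_at q (pderiv p) = 0"
          using E_eval[of q p] less.prems Eq by simp
        then have "pderiv p = 0"
          using less.hyps False by (simp add: degree_pderiv)
        then show ?thesis
          using False by (simp add: pderiv_eq_0_iff)
      qed
    qed
    then show ?thesis
      by (auto simp: transcendental_elt_def eval_at_def)
  qed
  moreover have "simple_ext \<iota> q = UNIV"
  proof -
    obtain p r where p: "x * u = f * eval_at q p" and r: "u = f * eval_at q r"
      using poly u by metis
    have "x = eval_at q p / eval_at q r"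
      using p u(1) f0 unfolding r by (simp add: field_simps)
    then have "x \<in> simple_ext \<iota> q"
      by (auto intro: simple_ext_closed[OF emb] eval_in_simple_ext[OF emb])
    then show ?thesis
      using simple_ext_mono[OF emb] x by (auto simp: coordinate_def)
  qed
  ultimately have "coordinate \<iota> q"
    by (simp add: coordinate_def)
  then show thesis
    using that Eq f0 f f1 df poly unfolding qf[symmetric] by blast
qed

end

text \<open>The situation after the choice of such a coordinate \<open>q\<close>.\<close>

locale graded_lnd_coordinate = graded_lnd_full +
  fixes q
  assumes q: "coordinate \<iota> q" "E q = 1"
begin

abbreviation ev where "ev \<equiv> eval_at q"

lemma ev_eq_0_iff: "ev p = 0 \<longleftrightarrow> p = 0"
  using q(1) transcendental_eval[OF emb] by (simp add: coordinate_def)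

lemma ev_inject: "ev p = ev r \<longleftrightarrow> p = r"
  using ev_eq_0_iff[of "p - r"] by (simp add: eval_at_diff)

lemma d_constant_generator:
  assumes "m \<in> S" "u \<in> P m" "d m u = 0" "u * ev p \<in> P m"
  shows "d m (u * ev p) = u * ev (pderiv p)"
  using d_quotient[OF assms(1,2), of "ev p"] assms(3,4) q(2) by (simp add: E_eval mult.commute)

text \<open>
  If \<open>u\<close> generates its piece, the derivation acts on the polynomials by \<open>p' + g p\<close>, which does
  not lower the degree unless \<open>g = 0\<close>.
\<close>

theorem generator_in_kernel:
  assumes m: "m \<in> S" and u: "u \<in> P m" "u \<noteq> 0" and gen: "\<And>f. f \<in> P m \<Longrightarrow> \<exists>p. f = u * ev p"
  shows "d m u = 0"
proof -
  obtain g where g: "d m u = u * ev g"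
    using gen d_mem[OF m u(1)] by blast
  have "g = 0"
  proof (rule ccontr)
    assume g0: "g \<noteq> 0"
    have ne: "pderiv p + g * p \<noteq> 0" if "p \<noteq> 0" for p
    proof
      assume eq: "pderiv p + g * p = 0"
      then have deg: "degree (pderiv p) = degree g + degree p"
        using that g0 by (metis add_eq_0_iff degree_minus degree_mult_eq)
      have "pderiv p \<noteq> 0"
        using eq that g0 by auto
      then have "degree p \<noteq> 0"
        by (simp add: pderiv_eq_0_iff)
      then show False
        using deg by (simp add: degree_pderiv)
    qed
    have "\<exists>p. p \<noteq> 0 \<and> (d m ^^ k) u = u * ev p" for k
    proof (induction k)
      case 0
      then show ?case
        by (intro exI[of _ 1]) simp
    next
      case (Suc k)
      then obtain p where p: "p \<noteq> 0" "(d m ^^ k) u = u * ev p"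
        by blast
      have "u * ev p \<in> P m"
        using d_funpow_mem[OF m u(1), of k] p by simp
      then have "d m (u * ev p) = u * ev (pderiv p + g * p)"
        using d_quotient[OF m u(1), of "ev p"] q(2) g
        by (simp add: E_eval eval_at_add eval_at_mult algebra_simps)
      then show ?case
        using ne[OF p(1)] p(2) by auto
    qed
    moreover obtain k where "(d m ^^ k) u = 0"
      using d_nilpotent[OF m u(1)] by blast
    ultimately obtain p where "p \<noteq> 0" "u * ev p = 0"
      by metis
    then show False
      using u(2) ev_eq_0_iff by simp
  qed
  then show ?thesis
    by (simp add: g)
qed

text \<open>
  The product of the generators is a polynomial multiple of the generator \<open>w\<close>; as the derivation
  kills both, the polynomial is constant.
\<close>

theorem product_of_generators:
  assumes m: "m \<in> S" "m' \<in> S" and u: "u \<in> P m" "d m u = 0" and u': "u' \<in> P m'" "d m' u' = 0"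
    and w: "w \<in> P (m + m')" "d (m + m') w = 0" "w \<noteq> 0" and gen: "\<And>f. f \<in> P (m + m') \<Longrightarrow> \<exists>p. f = w * ev p"
  obtains c where "u * u' = w * \<iota> c"
proof -
  have mem: "u * u' \<in> P (m + m')"
    using m u u' by (intro P_mult)
  then obtain p where p: "u * u' = w * ev p"
    using gen by blast
  have "w * ev (pderiv p) = d (m + m') (u * u')"
    using d_constant_generator[of "m + m'" w p] w m mem by (simp add: p S_add)
  also have "\<dots> = 0"
    using d_mult[OF m u(1) u'(1)] u u' by simp
  finally have "pderiv p = 0"
    using w(3) ev_eq_0_iff by simp
  then have "degree p = 0"
    by (simp add: pderiv_eq_0_iff)
  then obtain c where "p = [:c:]"
    by (rule degree_eq_zeroE)
  then show thesis
    using that[of c] p by simp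
qed

end

section \<open>Isomorphisms of algebras and additive group actions\<close>

lemma algebra_iso_inverse:
  assumes "algebra_iso \<kappa> A \<kappa>' B \<Phi>"
    and closed: "\<And>a b. a \<in> A \<Longrightarrow> b \<in> A \<Longrightarrow> a + b \<in> A" "\<And>a b. a \<in> A \<Longrightarrow> b \<in> A \<Longrightarrow> a * b \<in> A"
      "\<And>c. \<kappa> c \<in> A"
  shows "algebra_iso \<kappa>' B \<kappa> A (inv_into A \<Phi>)"
proof -
  have bij: "bij_betw \<Phi> A B" and hom: "\<And>a b. a \<in> A \<Longrightarrow> b \<in> A \<Longrightarrow> \<Phi> (a + b) = \<Phi> a + \<Phi> b"
      "\<And>a b. a \<in> A \<Longrightarrow> b \<in> A \<Longrightarrow> \<Phi> (a * b) = \<Phi> a * \<Phi> b" "\<And>c. \<Phi> (\<kappa> c) = \<kappa>' c"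
    using assms(1) by (auto simp: algebra_iso_def)
  have left: "inv_into A \<Phi> (\<Phi> a) = a" if "a \<in> A" for a
    using bij that by (simp add: bij_betw_inv_into_left)
  show ?thesis
    unfolding algebra_iso_def
  proof (intro conjI ballI allI)
    show "bij_betw (inv_into A \<Phi>) B A"
      by (rule bij_betw_inv_into[OF bij])
    show "inv_into A \<Phi> (\<kappa>' c) = \<kappa> c" for c
      using left[OF closed(3)] hom(3) by metis
    fix b b' assume "b \<in> B" "b' \<in> B"
    then obtain a a' where a: "a \<in> A" "b = \<Phi> a" "a' \<in> A" "b' = \<Phi> a'"
      using bij by (auto simp: bij_betw_def)
    show "inv_into A \<Phi> (b + b') = inv_into A \<Phi> b + inv_into A \<Phi> b'"
      using a left closed(1) by (simp add: hom(1)[symmetric])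
    show "inv_into A \<Phi> (b * b') = inv_into A \<Phi> b * inv_into A \<Phi> b'"
      using a left closed(2) by (simp add: hom(2)[symmetric])
  qed
qed

lemma algebra_iso_comp:
  assumes "algebra_iso \<kappa> A \<kappa>' B \<Phi>" "algebra_iso \<kappa>' B \<kappa>'' C \<Psi>"
  shows "algebra_iso \<kappa> A \<kappa>'' C (\<Psi> \<circ> \<Phi>)"
proof -
  have "\<Phi> a \<in> B" if "a \<in> A" for a
    using assms(1) that by (auto simp: algebra_iso_def bij_betw_def)
  then show ?thesis
    using assms unfolding algebra_iso_def by (auto intro: bij_betw_trans)
qed

text \<open>Extending the exponential sum by vanishing terms makes it comparable on both sides.\<close>

lemma ga_action_eq_sum:
  assumes "(\<delta> ^^ N) a = 0" "\<delta> 0 = 0"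
  shows "ga_action \<kappa> \<delta> s a = (\<Sum>k<N. \<kappa> (s ^ k / fact k) * (\<delta> ^^ k) a)"
proof -
  have zero: "(\<delta> ^^ (j + N)) a = 0" for j
    by (induction j) (simp_all add: assms)
  have "k < N" if "(\<delta> ^^ k) a \<noteq> 0" for k
    using zero[of "k - N"] that by (metis le_add_diff_inverse2 not_le)
  then show ?thesis
    unfolding ga_action_def by (intro sum.mono_neutral_left) auto
qed

lemma ga_action_intertwined:
  assumes iso: "algebra_iso \<kappa> A \<kappa>' B \<Phi>"
    and closed: "\<And>a b. a \<in> A \<Longrightarrow> b \<in> A \<Longrightarrow> a + b \<in> A" "\<And>a b. a \<in> A \<Longrightarrow> b \<in> A \<Longrightarrow> a * b \<in> A"
      "\<And>c. \<kappa> c \<in> A" "0 \<in> A"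
    and lnd: "lnd_on \<kappa> A \<delta>" and comm: "\<And>a. a \<in> A \<Longrightarrow> \<delta>' (\<Phi> a) = \<Phi> (\<delta> a)" and a: "a \<in> A"
  shows "\<Phi> (ga_action \<kappa> \<delta> s a) = ga_action \<kappa>' \<delta>' s (\<Phi> a)"
proof -
  have hom: "\<And>a b. a \<in> A \<Longrightarrow> b \<in> A \<Longrightarrow> \<Phi> (a + b) = \<Phi> a + \<Phi> b"
      "\<And>a b. a \<in> A \<Longrightarrow> b \<in> A \<Longrightarrow> \<Phi> (a * b) = \<Phi> a * \<Phi> b" "\<And>c. \<Phi> (\<kappa> c) = \<kappa>' c"
    using iso by (auto simp: algebra_iso_def)
  have der: "\<And>a. a \<in> A \<Longrightarrow> \<delta> a \<in> A" "\<And>a b. a \<in> A \<Longrightarrow> b \<in> A \<Longrightarrow> \<delta> (a + b) = \<delta> a + \<delta> b"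
    using lnd by (auto simp: lnd_on_def derivation_on_def)
  have \<Phi>0: "\<Phi> 0 = 0"
    using hom(1)[OF closed(4) closed(4)] by simp
  have \<delta>0: "\<delta> 0 = 0"
    using der(2)[OF closed(4) closed(4)] by simp
  have mem: "(\<delta> ^^ k) a \<in> A" for k
    using a by (induction k) (simp_all add: der)
  have iter: "(\<delta>' ^^ k) (\<Phi> a) = \<Phi> ((\<delta> ^^ k) a)" for k
    by (induction k) (simp_all add: comm mem)
  obtain N where N: "(\<delta> ^^ N) a = 0"
    using lnd a by (auto simp: lnd_on_def)
  have sum_hom: "\<Phi> (\<Sum>k\<in>I. f k) = (\<Sum>k\<in>I. \<Phi> (f k)) \<and> (\<Sum>k\<in>I. f k) \<in> A"
    if "finite I" "\<And>k. f k \<in> A" for I and f :: "nat \<Rightarrow> 'b"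
    using that(1) by (induction I rule: finite_induct) (simp_all add: \<Phi>0 closed that(2) hom)
  have "\<Phi> (ga_action \<kappa> \<delta> s a) = \<Phi> (\<Sum>k<N. \<kappa> (s ^ k / fact k) * (\<delta> ^^ k) a)"
    by (simp add: ga_action_eq_sum[OF N \<delta>0])
  also have "\<dots> = (\<Sum>k<N. \<Phi> (\<kappa> (s ^ k / fact k) * (\<delta> ^^ k) a))"
    by (rule conjunct1[OF sum_hom]) (auto intro: closed mem)
  also have "\<dots> = (\<Sum>k<N. \<kappa>' (s ^ k / fact k) * (\<delta>' ^^ k) (\<Phi> a))"
    by (simp add: hom closed mem iter)
  also have "\<dots> = ga_action \<kappa>' \<delta>' s (\<Phi> a)"
    using comm[OF closed(4)] by (intro ga_action_eq_sum[symmetric]) (simp_all add: iter N \<Phi>0 \<delta>0)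
  finally show ?thesis .
qed

text \<open>
  Taylor's formula. For the induction step, the \<open>k\<close>-th derivative of \<open>x p\<close> is \<open>x\<close> times that of
  \<open>p\<close> plus \<open>k\<close> times the derivative of \<open>p\<close> before it; these terms add up to \<open>s p(x + s)\<close>.
\<close>

lemma taylor_translation:
  fixes p :: "'k::field_char_0 poly"
  assumes "degree p < N"
  shows "(\<Sum>k<N. smult (s ^ k / fact k) ((pderiv ^^ k) p)) = pcompose p [:s, 1:]"
  using assms
proof (induction p arbitrary: N)
  case 0
  have "(pderiv ^^ k) (0 :: 'k poly) = 0" for k
    by (induction k) simp_all
  then show ?case
    by simp
next
  case (pCons c p)
  show ?case
  proof (cases "p = 0")
    case True
    have "(pderiv ^^ k) [:c:] = 0" if "k > 0" for k
      using that
    proof (induction k)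
      case (Suc k)
      then show ?case
        by (cases k) (simp_all add: pderiv_pCons)
    qed simp
    then have "(\<Sum>k<N. smult (s ^ k / fact k) ((pderiv ^^ k) [:c:])) = (\<Sum>k<N. if k = 0 then [:c:] else 0)"
      by (intro sum.cong) auto
    also have "\<dots> = [:c:]"
      using pCons.prems by simp
    finally show ?thesis
      using True by simp
  next
    case False
    then obtain M where M: "N = Suc M" "degree p < M"
      using pCons.prems by (cases N) auto
    have iter: "(pderiv ^^ Suc k) (pCons c p) = pCons 0 ((pderiv ^^ Suc k) p) + smult (of_nat (Suc k)) ((pderiv ^^ k) p)" for k
    proof (induction k)
      case 0
      then show ?case
        by (simp add: pderiv_pCons)
    next
      case (Suc k)
      have "(pderiv ^^ Suc (Suc k)) (pCons c p) = pderiv (pCons 0 ((pderiv ^^ Suc k) p) + smult (of_nat (Suc k)) ((pderiv ^^ k) p))"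
        using Suc by simp
      also have "\<dots> = pCons 0 ((pderiv ^^ Suc (Suc k)) p) + smult (of_nat (Suc (Suc k))) ((pderiv ^^ Suc k) p)"
        unfolding of_nat_Suc[of "Suc k"] smult_add_left
        by (simp add: pderiv_add pderiv_pCons pderiv_smult del: of_nat_Suc)
      finally show ?case .
    qed
    have shift: "s ^ Suc k / fact (Suc k) * of_nat (Suc k) = s * (s ^ k / fact k)" for k
      by (simp add: field_simps del: of_nat_Suc)
    have "(\<Sum>k<N. smult (s ^ k / fact k) ((pderiv ^^ k) (pCons c p))) =
        pCons c p + (\<Sum>k<M. smult (s ^ Suc k / fact (Suc k)) ((pderiv ^^ Suc k) (pCons c p)))"
      unfolding M(1) sum.lessThan_Suc_shift by simp
    also have "\<dots> = pCons c p + (\<Sum>k<M. smult (s ^ Suc k / fact (Suc k)) (pCons 0 ((pderiv ^^ Suc k) p))) +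
        (\<Sum>k<M. smult (s * (s ^ k / fact k)) ((pderiv ^^ k) p))"
      by (simp only: iter smult_add_right smult_smult shift sum.distrib add.assoc)
    also have "(\<Sum>k<M. smult (s * (s ^ k / fact k)) ((pderiv ^^ k) p)) = smult s (pcompose p [:s, 1:])"
    proof -
      have "smult s (\<Sum>k\<in>I. f k) = (\<Sum>k\<in>I. smult s (f k))" for I and f :: "nat \<Rightarrow> 'k poly"
        by (induction I rule: infinite_finite_induct) (simp_all add: smult_add_right)
      then show ?thesis
        unfolding pCons.IH[OF M(2), symmetric] by simp
    qed
    also have "pCons c p + (\<Sum>k<M. smult (s ^ Suc k / fact (Suc k)) (pCons 0 ((pderiv ^^ Suc k) p))) =
        [:c:] + pCons 0 (pcompose p [:s, 1:])"
    proof -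
      have p0: "pCons 0 (\<Sum>k\<in>I. f k) = (\<Sum>k\<in>I. pCons 0 (f k))" for I and f :: "nat \<Rightarrow> 'k poly"
        by (intro poly_eqI) (simp add: coeff_pCons coeff_sum split: nat.split)
      have "pCons 0 (pcompose p [:s, 1:]) = (\<Sum>k<N. pCons 0 (smult (s ^ k / fact k) ((pderiv ^^ k) p)))"
        using pCons.IH[of N] M by (simp add: p0[symmetric])
      also have "\<dots> = pCons 0 p + (\<Sum>k<M. pCons 0 (smult (s ^ Suc k / fact (Suc k)) ((pderiv ^^ Suc k) p)))"
        unfolding M(1) sum.lessThan_Suc_shift by simp
      finally show ?thesis
        by simp
    qed
    also have "[:c:] + pCons 0 (pcompose p [:s, 1:]) + smult s (pcompose p [:s, 1:]) = pcompose (pCons c p) [:s, 1:]"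
      by (simp add: pcompose_pCons add.assoc add.commute)
    finally show ?thesis .
  qed
qed

section \<open>Algebras of graded polynomials\<close>

abbreviation (input) "lookup \<equiv> Poly_Mapping.lookup"
abbreviation (input) "single \<equiv> Poly_Mapping.single"
abbreviation (input) "keys \<equiv> Poly_Mapping.keys"

lemma poly_mapping_expand: "a = (\<Sum>m\<in>keys a. single m (lookup a m))"
proof (rule poly_mapping_eqI)
  fix k
  have "lookup (\<Sum>m\<in>keys a. single m (lookup a m)) k =
      (\<Sum>m\<in>keys a. if m = k then lookup a k else 0)"
    unfolding lookup_sum by (rule sum.cong) (auto simp: lookup_single when_def)
  then show "lookup a k = lookup (\<Sum>m\<in>keys a. single m (lookup a m)) k"
    by (simp add: in_keys_iff)
qed

text \<open>
  A common source for all isomorphisms: the algebra of polynomials \<open>g m\<close> attached to the degrees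
  \<open>m \<in> S\<close>, with \<open>g m\<close> constrained to lie in \<open>Q m\<close>.
\<close>

definition graded_polys :: "(nat \<Rightarrow> int) set \<Rightarrow> ((nat \<Rightarrow> int) \<Rightarrow> 'k::comm_ring_1 poly set) \<Rightarrow>
    ((nat \<Rightarrow> int) \<Rightarrow>\<^sub>0 'k poly) set" where
  "graded_polys S Q = {g. keys g \<subseteq> S \<and> (\<forall>m\<in>S. lookup g m \<in> Q m)}"

definition poly_const :: "'k::comm_ring_1 \<Rightarrow> (nat \<Rightarrow> int) \<Rightarrow>\<^sub>0 'k poly" where
  "poly_const c = single 0 [:c:]"

locale graded_poly_data =
  fixes S :: "(nat \<Rightarrow> int) set" and Q :: "(nat \<Rightarrow> int) \<Rightarrow> 'k::field_char_0 poly set"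
  assumes S_zero: "0 \<in> S" and S_add: "m \<in> S \<Longrightarrow> m' \<in> S \<Longrightarrow> m + m' \<in> S"
    and Q_zero: "0 \<in> Q m"
    and Q_add: "p \<in> Q m \<Longrightarrow> r \<in> Q m \<Longrightarrow> p + r \<in> Q m"
    and Q_mult: "m \<in> S \<Longrightarrow> m' \<in> S \<Longrightarrow> p \<in> Q m \<Longrightarrow> r \<in> Q m' \<Longrightarrow> p * r \<in> Q (m + m')"
    and Q_const: "[:c:] \<in> Q 0"
    and Q_pderiv: "p \<in> Q m \<Longrightarrow> pderiv p \<in> Q m"
begin

abbreviation "G \<equiv> graded_polys S Q"

lemma G_lookup: "g \<in> G \<Longrightarrow> lookup g m \<in> Q m"
  using Q_zero by (cases "m \<in> keys g") (auto simp: graded_polys_def in_keys_iff)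

lemma G_keys: "g \<in> G \<Longrightarrow> m \<in> keys g \<Longrightarrow> m \<in> S"
  by (auto simp: graded_polys_def)

lemma G_I:
  assumes "\<And>m. lookup g m \<noteq> 0 \<Longrightarrow> m \<in> S \<and> lookup g m \<in> Q m"
  shows "g \<in> G"
proof -
  have "lookup g m \<in> Q m" for m
    using assms Q_zero by (cases "lookup g m = 0") auto
  then show ?thesis
    using assms by (auto simp: graded_polys_def in_keys_iff)
qed

lemma G_zero: "0 \<in> G"
  by (rule G_I) simp

lemma G_add:
  assumes "g \<in> G" "h \<in> G"
  shows "g + h \<in> G"
  unfolding graded_polys_def
proof (intro CollectI conjI ballI)
  show "keys (g + h) \<subseteq> S"
    using Poly_Mapping.keys_add[of g h] assms by (auto simp: graded_polys_def)
  show "lookup (g + h) m \<in> Q m" for m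
    unfolding lookup_add by (intro Q_add G_lookup assms)
qed

lemma G_single: "m \<in> S \<Longrightarrow> p \<in> Q m \<Longrightarrow> single m p \<in> G"
  by (rule G_I) (auto simp: lookup_single when_def split: if_splits)

lemma G_sum: "(\<And>i. i \<in> I \<Longrightarrow> f i \<in> G) \<Longrightarrow> (\<Sum>i\<in>I. f i) \<in> G"
  by (induction I rule: infinite_finite_induct) (simp_all add: G_zero G_add)

lemma mult_expand:
  "g * h = (\<Sum>m\<in>keys g. \<Sum>m'\<in>keys h.
    single (m + m') (lookup g m * lookup h m'))"
  by (subst poly_mapping_expand[of g], subst poly_mapping_expand[of h])
    (simp add: sum_product mult_single)

lemma G_mult:
  assumes "g \<in> G" "h \<in> G"
  shows "g * h \<in> G"
  unfolding mult_expand[of g h]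
  using assms by (intro G_sum G_single S_add Q_mult G_lookup) (auto intro: G_keys)

lemma G_const: "poly_const c \<in> G"
  unfolding poly_const_def by (intro G_single S_zero Q_const)

definition coeff_deriv :: "((nat \<Rightarrow> int) \<Rightarrow>\<^sub>0 'k poly) \<Rightarrow> ((nat \<Rightarrow> int) \<Rightarrow>\<^sub>0 'k poly)" where
  "coeff_deriv = Poly_Mapping.map pderiv"

lemma lookup_map_zero:
  assumes "f 0 = 0"
  shows "lookup (Poly_Mapping.map f g) m = f (lookup g m)"
  using assms by (simp add: Poly_Mapping.map.rep_eq when_def)

lemma lookup_coeff_deriv: "lookup (coeff_deriv g) m = pderiv (lookup g m)"
  unfolding coeff_deriv_def by (rule lookup_map_zero) simp

lemma lookup_coeff_deriv_iter:
  "lookup ((coeff_deriv ^^ k) g) m = (pderiv ^^ k) (lookup g m)"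
  by (induction k) (simp_all add: lookup_coeff_deriv)

lemma G_coeff_deriv:
  assumes "g \<in> G"
  shows "coeff_deriv g \<in> G"
proof (rule G_I)
  fix m assume "lookup (coeff_deriv g) m \<noteq> 0"
  then have "m \<in> keys g"
    by (auto simp: lookup_coeff_deriv in_keys_iff)
  then show "m \<in> S \<and> lookup (coeff_deriv g) m \<in> Q m"
    using G_keys[OF assms] Q_pderiv G_lookup[OF assms] by (auto simp: lookup_coeff_deriv)
qed

lemma ga_action_coeff_deriv:
  "ga_action poly_const coeff_deriv s g = Poly_Mapping.map (\<lambda>p. pcompose p [:s, 1:]) g"
proof -
  define N where "N = Suc (\<Sum>m\<in>keys g. degree (lookup g m))"
  have deg: "degree (lookup g m) < N" for m
  proof (cases "m \<in> keys g")
    case True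
    then have "degree (lookup g m) \<le> (\<Sum>m\<in>keys g. degree (lookup g m))"
      by (intro member_le_sum) auto
    then show ?thesis
      by (simp add: N_def)
  qed (simp add: in_keys_iff N_def)
  have kill: "(pderiv ^^ k) p = 0" if "degree p < k" for k and p :: "'k poly"
    using that
  proof (induction k arbitrary: p)
    case (Suc k)
    show ?case
    proof (cases "degree p = 0")
      case True
      then have "pderiv p = 0"
        by (simp add: pderiv_eq_0_iff)
      moreover have "(pderiv ^^ k) (0 :: 'k poly) = 0"
        by (induction k) simp_all
      ultimately show ?thesis
        by (simp add: funpow_swap1)
    next
      case False
      then show ?thesis
        using Suc.IH[of "pderiv p"] Suc.prems by (simp add: funpow_swap1 degree_pderiv)
    qed
  qed simp
  have "(coeff_deriv ^^ N) g = 0"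
    by (rule poly_mapping_eqI) (simp add: lookup_coeff_deriv_iter kill deg)
  moreover have "coeff_deriv 0 = 0"
    by (rule poly_mapping_eqI) (simp add: lookup_coeff_deriv)
  ultimately have sum: "ga_action poly_const coeff_deriv s g =
      (\<Sum>k<N. poly_const (s ^ k / fact k) * (coeff_deriv ^^ k) g)"
    by (rule ga_action_eq_sum)
  have mult: "lookup (poly_const c * h) m = smult c (lookup h m)"
    for c m and h :: "(nat \<Rightarrow> int) \<Rightarrow>\<^sub>0 'k poly"
  proof -
    have "poly_const c * h = Poly_Mapping.map ((*) [:c:]) h"
      unfolding poly_const_def by (rule mult_map_scale_conv_mult[symmetric])
    then show ?thesis
      by (simp add: lookup_map_zero)
  qed
  show ?thesis
    unfolding sum
    by (rule poly_mapping_eqI)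
      (simp add: lookup_sum mult lookup_coeff_deriv_iter lookup_map_zero taylor_translation deg)
qed

end

text \<open>
  Evaluating the polynomials at \<open>X\<close> and marking the degree \<open>m\<close> by \<open>U m\<close>: a homomorphism as
  soon as \<open>U\<close> is multiplicative on the degrees that occur.
\<close>

locale graded_evaluation = graded_poly_data S Q + coefficient_hom \<kappa>
  for S and Q :: "(nat \<Rightarrow> int) \<Rightarrow> 'k::field_char_0 poly set" and \<kappa> :: "'k \<Rightarrow> 's::comm_ring_1" +
  fixes U :: "(nat \<Rightarrow> int) \<Rightarrow> 's" and X :: 's
  assumes U_zero: "U 0 = 1" and U_add: "m \<in> S \<Longrightarrow> m' \<in> S \<Longrightarrow> U (m + m') = U m * U m'"
begin

definition R :: "((nat \<Rightarrow> int) \<Rightarrow>\<^sub>0 'k poly) \<Rightarrow> 's" where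
  "R g = (\<Sum>m\<in>keys g. U m * eval_at X (lookup g m))"

lemma R_superset:
  assumes "finite A" "keys g \<subseteq> A"
  shows "R g = (\<Sum>m\<in>A. U m * eval_at X (lookup g m))"
  unfolding R_def using assms by (intro sum.mono_neutral_left) (auto simp: in_keys_iff)

lemma R_zero: "R 0 = 0"
  by (simp add: R_def)

lemma R_add: "R (g + h) = R g + R h"
proof -
  let ?A = "keys g \<union> keys h"
  have "R (g + h) = (\<Sum>m\<in>?A. U m * eval_at X (lookup (g + h) m))"
    using Poly_Mapping.keys_add[of g h] by (intro R_superset) auto
  also have "\<dots> = R g + R h"
    unfolding R_superset[of ?A g, simplified] R_superset[of ?A h, simplified]
    by (simp add: lookup_add eval_at_add distrib_left sum.distrib)
  finally show ?thesis .
qed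

lemma R_sum: "R (\<Sum>i\<in>I. f i) = (\<Sum>i\<in>I. R (f i))"
  by (induction I rule: infinite_finite_induct) (simp_all add: R_zero R_add)

lemma R_single: "R (single m p) = U m * eval_at X p"
  by (subst R_superset[of "{m}"]) auto

lemma R_const: "R (poly_const c) = \<kappa> c"
  by (simp add: poly_const_def R_single U_zero)

lemma R_mult:
  assumes "g \<in> G" "h \<in> G"
  shows "R (g * h) = R g * R h"
proof -
  have "R (g * h) = (\<Sum>m\<in>keys g. \<Sum>m'\<in>keys h.
      U (m + m') * eval_at X (lookup g m * lookup h m'))"
    unfolding mult_expand[of g h] by (simp add: R_sum R_single)
  also have "\<dots> = (\<Sum>m\<in>keys g. \<Sum>m'\<in>keys h.
      (U m * eval_at X (lookup g m)) * (U m' * eval_at X (lookup h m')))"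
    using assms by (intro sum.cong refl) (simp add: U_add G_keys eval_at_mult mult_ac)
  also have "\<dots> = R g * R h"
    by (simp add: R_def sum_product)
  finally show ?thesis .
qed

lemma R_algebra_iso:
  assumes "bij_betw R G B"
  shows "algebra_iso poly_const G \<kappa> B R"
  using assms by (simp add: algebra_iso_def R_add R_mult R_const)

lemma R_commutes_derivation:
  assumes "\<And>a b. a \<in> R ` G \<Longrightarrow> b \<in> R ` G \<Longrightarrow> \<delta> (a + b) = \<delta> a + \<delta> b"
    and "\<And>m p. m \<in> S \<Longrightarrow> p \<in> Q m \<Longrightarrow> \<delta> (U m * eval_at X p) = U m * eval_at X (pderiv p)"
    and g: "g \<in> G"
  shows "\<delta> (R g) = R (coeff_deriv g)"
proof -
  let ?f = "\<lambda>m. single m (lookup g m)"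
  have zero: "\<delta> 0 = 0"
    using assms(1)[of 0 0] R_zero G_zero by (metis add_cancel_right_right add.right_neutral image_eqI)
  have memf: "?f m \<in> G" if "m \<in> S" for m
    using that g by (intro G_single G_lookup)
  have "\<delta> (R (\<Sum>m\<in>A. ?f m)) = (\<Sum>m\<in>A. U m * eval_at X (pderiv (lookup g m)))"
    if "finite A" "A \<subseteq> S" for A
    using that
  proof (induction A rule: finite_induct)
    case empty
    then show ?case
      by (simp add: R_zero zero)
  next
    case (insert m A)
    have "R (?f m) \<in> R ` G" "R (\<Sum>m\<in>A. ?f m) \<in> R ` G"
      using insert memf by (auto intro!: imageI G_sum)
    then have "\<delta> (R (?f m) + R (\<Sum>m\<in>A. ?f m)) = \<delta> (R (?f m)) + \<delta> (R (\<Sum>m\<in>A. ?f m))"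
      by (rule assms(1))
    moreover have "\<delta> (R (?f m)) = U m * eval_at X (pderiv (lookup g m))"
      unfolding R_single using insert g by (intro assms(2) G_lookup) auto
    ultimately show ?case
      using insert by (simp add: R_add)
  qed
  from this[of "keys g"] have "\<delta> (R g) = (\<Sum>m\<in>keys g. U m * eval_at X (pderiv (lookup g m)))"
    using g poly_mapping_expand[of g] by (auto simp: graded_polys_def)
  also have "\<dots> = R (coeff_deriv g)"
    by (subst R_superset[of "keys g"]) (auto simp: lookup_coeff_deriv in_keys_iff)
  finally show ?thesis .
qed

end

section \<open>The coordinate algebras as graded evaluations\<close>

lemma coefficient_hom_group_alg:
  assumes "coefficient_hom \<iota>"
  shows "coefficient_hom (group_alg_const \<iota>)"
proof -
  interpret coefficient_hom \<iota> by fact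
  show ?thesis
    by unfold_locales
      (simp_all add: group_alg_const_def hom_one hom_add hom_mult single_add mult_single)
qed

text \<open>Coefficients of a polyhedral divisor whose pieces are \<open>u m Q m\<close> in the coordinate \<open>q\<close>.\<close>

locale pdiv_generators = graded_poly_data S Q
  for S and Q :: "(nat \<Rightarrow> int) \<Rightarrow> 'k::field_char_0 poly set" +
  fixes \<iota> :: "'k \<Rightarrow> 'f::field" and q :: 'f and u :: "(nat \<Rightarrow> int) \<Rightarrow> 'f"
    and n :: nat and \<sigma> :: "(nat \<Rightarrow> rat) set" and C :: "('f \<Rightarrow> int) set"
    and D :: "('f \<Rightarrow> int) \<Rightarrow> (nat \<Rightarrow> rat) set"
  assumes emb: "field_embedding \<iota>" and q: "transcendental_elt \<iota> q"
    and S: "S = dual_lattice n \<sigma>"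
    and u_nonzero: "m \<in> S \<Longrightarrow> u m \<noteq> 0" and u_zero: "u 0 = 1"
    and u_add: "m \<in> S \<Longrightarrow> m' \<in> S \<Longrightarrow> u (m + m') = u m * u m'"
    and pieces: "m \<in> S \<Longrightarrow> pdiv_piece n C D m = {u m * coefficient_hom.eval_at \<iota> q p | p. p \<in> Q m}"
begin

interpretation base: coefficient_hom \<iota>
  by (rule coefficient_hom_embedding[OF emb])

abbreviation "A \<equiv> pdiv_algebra n \<sigma> C D"

sublocale W: graded_evaluation S Q "group_alg_const \<iota>" "\<lambda>m. single m (u m)"
  "single 0 q"
proof -
  interpret coefficient_hom "group_alg_const \<iota>"
    by (intro coefficient_hom_group_alg base.coefficient_hom_axioms)
  show "graded_evaluation S Q (group_alg_const \<iota>) (\<lambda>m. single m (u m))"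
    by unfold_locales (simp_all add: u_zero u_add mult_single)
qed

lemma eval_single: "W.eval_at (single 0 q) p = single 0 (base.eval_at q p)"
proof (induction p)
  case (pCons c p)
  then show ?case
    by (simp only: W.eval_at_pCons base.eval_at_pCons group_alg_const_def[of \<iota> c] mult_single single_add add_0)
qed (simp only: W.eval_at_zero base.eval_at_zero single_zero)

lemma W_single: "W.R (single m p) = single m (u m * base.eval_at q p)"
  by (simp add: W.R_single eval_single mult_single)

lemma lookup_W: "lookup (W.R g) m = u m * base.eval_at q (lookup g m)"
proof -
  have "lookup (W.R g) m =
      (\<Sum>m'\<in>keys g. if m' = m then u m * base.eval_at q (lookup g m) else 0)"
    unfolding W.R_def lookup_sum
    by (intro sum.cong) (auto simp: eval_single mult_single lookup_single when_def)
  then show ?thesis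
    by (simp add: in_keys_iff)
qed

lemma W_bij: "bij_betw W.R G A"
  unfolding bij_betw_def
proof (intro conjI equalityI subsetI)
  show "inj_on W.R G"
  proof
    fix g h assume gh: "g \<in> G" "h \<in> G" "W.R g = W.R h"
    show "g = h"
    proof (rule poly_mapping_eqI)
      fix m
      show "lookup g m = lookup h m"
      proof (cases "m \<in> S")
        case True
        have "u m * base.eval_at q (lookup g m) = u m * base.eval_at q (lookup h m)"
          using gh(3) lookup_W by metis
        then have "base.eval_at q (lookup g m - lookup h m) = 0"
          using u_nonzero[OF True] by (simp add: base.eval_at_diff)
        then show ?thesis
          using transcendental_eval[OF emb q] by simp
      next
        case False
        then have "m \<notin> keys g" "m \<notin> keys h"
          using gh G_keys by blast+
        then show ?thesis
          by (simp add: in_keys_iff)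
      qed
    qed
  qed
  show "a \<in> A" if "a \<in> W.R ` G" for a
  proof -
    obtain g where g: "g \<in> G" "a = W.R g"
      using \<open>a \<in> W.R ` G\<close> by blast
    have "keys a \<subseteq> keys g"
      by (auto simp: in_keys_iff g(2) lookup_W)
    then have "keys a \<subseteq> S"
      using G_keys[OF g(1)] by blast
    moreover have "lookup a m \<in> pdiv_piece n C D m" if "m \<in> S" for m
      unfolding pieces[OF that] using G_lookup[OF g(1)] by (auto simp: g(2) lookup_W)
    ultimately show ?thesis
      by (auto simp: pdiv_algebra_def S)
  qed
  show "a \<in> W.R ` G" if a: "a \<in> A" for a
  proof -
    have "\<exists>p. p \<in> Q m \<and> lookup a m = u m * base.eval_at q p" if "m \<in> S" for m
      using a that pieces[OF that] by (auto simp: pdiv_algebra_def S)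
    then obtain p where p: "\<And>m. m \<in> S \<Longrightarrow> p m \<in> Q m \<and> lookup a m = u m * base.eval_at q (p m)"
      by metis
    have keys: "keys a \<subseteq> S"
      using a by (auto simp: pdiv_algebra_def S)
    define g where "g = (\<Sum>m\<in>keys a. single m (p m))"
    have "g \<in> G"
      unfolding g_def using p keys by (intro G_sum G_single) auto
    moreover have "W.R g = (\<Sum>m\<in>keys a. single m (lookup a m))"
      unfolding g_def W.R_sum by (intro sum.cong refl) (use p keys in \<open>auto simp: W_single\<close>)
    ultimately show ?thesis
      using poly_mapping_expand[of a] by (metis image_eqI)
  qed
qed

lemma W_iso: "algebra_iso poly_const G (group_alg_const \<iota>) A W.R"
  by (rule W.R_algebra_iso[OF W_bij])

text \<open>
  The inverse of \<open>W.R\<close> reads an element of \<open>A\<close> as a family of polynomials in \<open>q\<close>. All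
  isomorphisms from \<open>A\<close> are compositions of \<open>T\<close> with an evaluation.
\<close>

definition T where "T = inv_into G W.R"

lemma T_iso: "algebra_iso (group_alg_const \<iota>) A poly_const G T"
  unfolding T_def by (rule algebra_iso_inverse[OF W_iso G_add G_mult G_const])

lemma T_W: "g \<in> G \<Longrightarrow> T (W.R g) = g"
  unfolding T_def using W_bij by (simp add: bij_betw_inv_into_left)

lemma T_mem: "a \<in> A \<Longrightarrow> T a \<in> G"
  using T_iso by (auto simp: algebra_iso_def bij_betw_def)

lemma W_T: "a \<in> A \<Longrightarrow> W.R (T a) = a"
  unfolding T_def using W_bij by (simp add: bij_betw_inv_into_right)

lemma T_single:
  assumes "single m f \<in> A"
  obtains p where "T (single m f) = single m p" "p = 0 \<or> m \<in> S"
proof (cases "f = 0")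
  case True
  have "T (W.R 0) = 0"
    by (rule T_W[OF G_zero])
  then show thesis
    using that[of 0] True by (simp add: W.R_zero)
next
  case False
  then have m: "m \<in> S"
    using assms by (auto simp: pdiv_algebra_def S)
  then have "f \<in> pdiv_piece n C D m"
    using assms by (auto simp: pdiv_algebra_def S dest!: bspec[of _ _ m])
  then obtain p where p: "p \<in> Q m" "f = u m * base.eval_at q p"
    using pieces[OF m] by blast
  then have "T (single m f) = single m p"
    using T_W[OF G_single[OF m p(1)]] by (simp add: W_single)
  then show thesis
    using that m by blast
qed

lemma A_closed:
  "a \<in> A \<Longrightarrow> b \<in> A \<Longrightarrow> a + b \<in> A" "a \<in> A \<Longrightarrow> b \<in> A \<Longrightarrow> a * b \<in> A" "group_alg_const \<iota> c \<in> A" "0 \<in> A"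
proof -
  have img: "W.R g \<in> A" if "g \<in> G" for g
    using W_bij that by (auto simp: bij_betw_def)
  show "group_alg_const \<iota> c \<in> A" "0 \<in> A"
    using img[OF G_const, of c] img[OF G_zero] by (simp_all add: W.R_const W.R_zero)
  assume "a \<in> A" "b \<in> A"
  then have "a \<in> W.R ` G" "b \<in> W.R ` G"
    using W_bij by (simp_all add: bij_betw_def)
  then obtain g h where "g \<in> G" "a = W.R g" "h \<in> G" "b = W.R h"
    by blast
  then show "a + b \<in> A" "a * b \<in> A"
    using img[OF G_add, of g h] img[OF G_mult, of g h] by (simp_all add: W.R_add W.R_mult)
qed

text \<open>A derivation killing all generators \<open>u m\<close> and sending \<open>q\<close> to \<open>1\<close> is \<open>d/dq\<close> on coefficients.\<close>

lemma derivation_is_coeff_deriv: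
  assumes "derivation_on (group_alg_const \<iota>) A \<delta>"
    and "\<And>m p. m \<in> S \<Longrightarrow> p \<in> Q m \<Longrightarrow> \<delta> (single m (u m * base.eval_at q p)) =
      single m (u m * base.eval_at q (pderiv p))"
    and a: "a \<in> A"
  shows "coeff_deriv (T a) = T (\<delta> a)"
proof -
  have "\<delta> (W.R (T a)) = W.R (coeff_deriv (T a))"
  proof (rule W.R_commutes_derivation)
    have "W.R ` G = A"
      using W_bij by (simp add: bij_betw_def)
    then show "\<delta> (a + b) = \<delta> a + \<delta> b" if "a \<in> W.R ` G" "b \<in> W.R ` G" for a b
      using that assms(1) by (simp add: derivation_on_def)
    show "\<delta> (single m (u m) * W.eval_at (single 0 q) p) =
        single m (u m) * W.eval_at (single 0 q) (pderiv p)" if "m \<in> S" "p \<in> Q m" for m p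
      using assms(2)[OF that] by (simp add: eval_single mult_single)
    show "T a \<in> G"
      by (rule T_mem[OF a])
  qed
  then have "\<delta> a = W.R (coeff_deriv (T a))"
    by (simp add: W_T[OF a])
  then show ?thesis
    using T_W[OF G_coeff_deriv[OF T_mem[OF a]]] by simp
qed

lemma T_ga_action:
  assumes "lnd_on (group_alg_const \<iota>) A \<delta>"
    and "\<And>m p. m \<in> S \<Longrightarrow> p \<in> Q m \<Longrightarrow> \<delta> (single m (u m * base.eval_at q p)) =
      single m (u m * base.eval_at q (pderiv p))"
    and a: "a \<in> A"
  shows "T (ga_action (group_alg_const \<iota>) \<delta> s a) = ga_action poly_const coeff_deriv s (T a)"
proof (rule ga_action_intertwined[OF T_iso A_closed assms(1) _ a])
  show "coeff_deriv (T a) = T (\<delta> a)" if "a \<in> A" for a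
    using assms(1) by (intro derivation_is_coeff_deriv assms(2) that) (auto simp: lnd_on_def)
qed

end

text \<open>Evaluation at a new variable gives the coordinate algebra of \<open>Y \<times> \<bbbA>\<^sup>1\<close>.\<close>

locale line_evaluation = graded_poly_data S Q
  for S and Q :: "(nat \<Rightarrow> int) \<Rightarrow> 'k::field_char_0 poly set" +
  fixes n :: nat and \<sigma> :: "(nat \<Rightarrow> rat) set"
  assumes S: "S = dual_lattice n \<sigma>" and Q: "Q m = UNIV"
begin

abbreviation line_const :: "'k \<Rightarrow> ((nat \<Rightarrow> int) \<Rightarrow>\<^sub>0 'k) poly" where
  "line_const \<equiv> \<lambda>c. [:group_alg_const id c:]"

sublocale L: graded_evaluation S Q line_const "\<lambda>m. [:single m 1:]" "[:0, 1:]"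
proof -
  interpret base: coefficient_hom "group_alg_const (id :: 'k \<Rightarrow> 'k)"
    by (intro coefficient_hom_group_alg) (simp add: coefficient_hom_def)
  interpret coefficient_hom line_const
    by unfold_locales (simp_all add: base.hom_one base.hom_add base.hom_mult pCons_one)
  show "graded_evaluation S Q line_const (\<lambda>m. [:single m 1:])"
    by unfold_locales (simp_all add: mult_single pCons_one add.commute)
qed

lemma coeff_eval: "coeff (L.eval_at [:0, 1:] p) i = single 0 (coeff p i)"
proof (induction p arbitrary: i)
  case (pCons c p)
  have "L.eval_at [:0, 1:] (pCons c p) = pCons (single 0 c) (L.eval_at [:0, 1:] p)"
    by (simp add: L.eval_at_pCons[of _ c p] group_alg_const_def[of id c])
  then show ?case
    by (cases i) (simp_all only: coeff_pCons_0 coeff_pCons_Suc pCons.IH)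
qed (simp only: L.eval_at_zero coeff_0 single_zero)

lemma coeff_marked_eval:
  "coeff ([:single m 1:] * L.eval_at [:0, 1:] p) i = single m (coeff p i)"
  by (simp add: coeff_eval mult_single)

lemma lookup_coeff_L: "lookup (coeff (L.R g) i) m = coeff (lookup g m) i"
proof -
  have "lookup (coeff (L.R g) i) m =
      (\<Sum>m'\<in>keys g. if m' = m then coeff (lookup g m) i else 0)"
    unfolding L.R_def coeff_sum lookup_sum coeff_marked_eval
    by (intro sum.cong) (auto simp: lookup_single when_def)
  then show ?thesis
    by (simp add: in_keys_iff)
qed

lemma L_bij: "bij_betw L.R G (toric_times_line n \<sigma>)"
  unfolding bij_betw_def
proof (intro conjI equalityI subsetI)
  show "inj_on L.R G"
  proof
    fix g h assume eq: "L.R g = L.R h"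
    show "g = h"
    proof (intro poly_mapping_eqI poly_eqI)
      fix m i
      show "coeff (lookup g m) i = coeff (lookup h m) i"
        using lookup_coeff_L[of g i m] lookup_coeff_L[of h i m] by (simp add: eq)
    qed
  qed
  show "P \<in> toric_times_line n \<sigma>" if P: "P \<in> L.R ` G" for P
  proof -
    obtain g where g: "g \<in> G" "P = L.R g"
      using P by blast
    have "m \<in> S" if "lookup (coeff P i) m \<noteq> 0" for m i
    proof -
      have "coeff (lookup g m) i \<noteq> 0"
        using that unfolding g(2) lookup_coeff_L .
      moreover have "lookup g m = 0" if "m \<notin> S"
        using G_keys[OF g(1), of m] that by (auto simp: in_keys_iff)
      ultimately show ?thesis
        by (metis coeff_0)
    qed
    then show ?thesis
      by (auto simp: toric_times_line_def toric_algebra_def in_keys_iff S)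
  qed
  show "P \<in> L.R ` G" if P: "P \<in> toric_times_line n \<sigma>" for P
  proof -
    define K where "K = (\<Union>i\<le>degree P. keys (coeff P i))"
    define p where "p m = (\<Sum>i\<le>degree P. monom (lookup (coeff P i) m) i)" for m
    have K: "finite K" "K \<subseteq> S"
      using P by (auto simp: K_def toric_times_line_def toric_algebra_def S)
    have coeff_p: "coeff (p m) i = lookup (coeff P i) m" for m i
    proof -
      have "coeff (p m) i = (\<Sum>j\<le>degree P. if j = i then lookup (coeff P i) m else 0)"
        unfolding p_def coeff_sum by (intro sum.cong) auto
      then show ?thesis
        using le_degree[of P i] by (cases "coeff P i = 0") auto
    qed
    define g where "g = (\<Sum>m\<in>K. single m (p m))"
    have "g \<in> G"
      unfolding g_def using K by (intro G_sum G_single) (auto simp: Q)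
    have lookup_g: "lookup g m = p m" for m
    proof -
      have "lookup g m = (\<Sum>m'\<in>K. if m' = m then p m else 0)"
        unfolding g_def lookup_sum by (intro sum.cong) (auto simp: lookup_single when_def)
      also have "\<dots> = p m"
      proof (cases "m \<in> K")
        case False
        then have "p m = 0"
          unfolding p_def K_def by (intro sum.neutral) (auto simp: in_keys_iff)
        then show ?thesis
          using K by simp
      qed (use K in simp)
      finally show ?thesis .
    qed
    have "L.R g = P"
      by (intro poly_eqI poly_mapping_eqI) (simp add: lookup_coeff_L lookup_g coeff_p)
    then show ?thesis
      using \<open>g \<in> G\<close> by blast
  qed
qed

lemma L_iso: "algebra_iso poly_const G line_const (toric_times_line n \<sigma>) L.R"
  by (rule L.R_algebra_iso[OF L_bij])

lemma L_translation:
  "L.R (Poly_Mapping.map (\<lambda>p. pcompose p [:s, 1:]) g) = pcompose (L.R g) [:group_alg_const id s, 1:]"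
proof -
  have eval: "L.eval_at [:0, 1:] (pcompose p [:s, 1:]) = pcompose (L.eval_at [:0, 1:] p) [:group_alg_const id s, 1:]" for p
  proof (induction p)
    case (pCons c p)
    have s: "L.eval_at [:0, 1:] [:s, 1:] = [:group_alg_const id s, 1:]"
      by (simp add: L.eval_at_pCons[of _ s] L.hom_one)
    have "L.eval_at [:0, 1:] (pcompose (pCons c p) [:s, 1:]) =
        [:group_alg_const id c:] + [:group_alg_const id s, 1:] * L.eval_at [:0, 1:] (pcompose p [:s, 1:])"
      unfolding pcompose_pCons L.eval_at_add L.eval_at_mult L.eval_at_const s ..
    also have "\<dots> = pcompose ([:group_alg_const id c:] + [:0, 1:] * L.eval_at [:0, 1:] p) [:group_alg_const id s, 1:]"
      unfolding pCons.IH pcompose_add pcompose_mult by (simp add: pcompose_pCons)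
    finally show ?case
      unfolding L.eval_at_pCons .
  qed (simp only: pcompose_0 L.eval_at_zero)
  have map0: "lookup (Poly_Mapping.map (\<lambda>p. pcompose p [:s, 1:]) g) m = pcompose (lookup g m) [:s, 1:]" for m
    by (rule lookup_map_zero) simp
  have "L.R (Poly_Mapping.map (\<lambda>p. pcompose p [:s, 1:]) g) =
      (\<Sum>m\<in>keys g. [:single m 1:] * L.eval_at [:0, 1:] (pcompose (lookup g m) [:s, 1:]))"
    by (subst L.R_superset[of "keys g"]) (auto simp: in_keys_iff map0)
  also have "\<dots> = pcompose (L.R g) [:group_alg_const id s, 1:]"
    unfolding L.R_def pcompose_sum by (intro sum.cong refl) (simp add: eval pcompose_mult pcompose_smult)
  finally show ?thesis .
qed

end

text \<open>
  Evaluation at the character \<open>(0, 1)\<close> gives the coordinate algebra of a toric variety, the degree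
  of the polynomials becoming the last coordinate.
\<close>

locale toric_evaluation = graded_poly_data S Q
  for S and Q :: "(nat \<Rightarrow> int) \<Rightarrow> 'k::field_char_0 poly set" +
  fixes N :: "(nat \<Rightarrow> int) \<Rightarrow> int" and n :: nat and \<tau> :: "(nat \<Rightarrow> rat) set"
  assumes S: "S \<subseteq> int_lattice n" and Q: "m \<in> S \<Longrightarrow> Q m = {p. p = 0 \<or> int (degree p) \<le> N m}"
    and \<tau>: "dual_lattice (Suc n) \<tau> = {m(n := k) | m k. m \<in> S \<and> k \<ge> 0 \<and> k \<le> N m}"
begin

abbreviation X :: "(nat \<Rightarrow> int) \<Rightarrow>\<^sub>0 'k" where
  "X \<equiv> single (0(n := 1)) 1"

sublocale V: graded_evaluation S Q "group_alg_const (id :: 'k \<Rightarrow> 'k)" "\<lambda>m. single m 1" X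
proof -
  interpret coefficient_hom "group_alg_const (id :: 'k \<Rightarrow> 'k)"
    by (intro coefficient_hom_group_alg) (simp add: coefficient_hom_def)
  show "graded_evaluation S Q (group_alg_const (id :: 'k \<Rightarrow> 'k)) (\<lambda>m. single m 1)"
    by unfold_locales (simp_all add: mult_single)
qed

lemma S_last: "m \<in> S \<Longrightarrow> m n = 0"
  using S by (auto simp: int_lattice_def)

text \<open>
  Stated for a monomial with any last coordinate, since the induction on the polynomial shifts it.
\<close>

lemma lookup_marked_eval:
  "lookup (single m 1 * V.eval_at X p) v =
    (if v(n := 0) = m(n := 0) \<and> v n \<ge> m n then coeff p (nat (v n - m n)) else 0)"
proof (induction p arbitrary: m)
  case (pCons c p)
  let ?m = "m + 0(n := 1)"
  have split: "single m 1 * V.eval_at X (pCons c p) =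
      single m c + single ?m 1 * V.eval_at X p"
    unfolding V.eval_at_pCons distrib_left group_alg_const_def mult.assoc[symmetric] mult_single by simp
  have m: "?m(n := 0) = m(n := 0)" "?m n = m n + 1"
    by auto
  have IH: "lookup (single ?m 1 * V.eval_at X p) v =
      (if v(n := 0) = m(n := 0) \<and> v n \<ge> m n + 1 then coeff p (nat (v n - (m n + 1))) else 0)"
    using pCons.IH[of ?m] unfolding m .
  have mv: "m = v \<longleftrightarrow> v(n := 0) = m(n := 0) \<and> v n = m n"
    by (metis fun_upd_triv fun_upd_upd)
  have "lookup (single m 1 * V.eval_at X (pCons c p)) v = (c when m = v) +
      (if v(n := 0) = m(n := 0) \<and> v n \<ge> m n + 1 then coeff p (nat (v n - (m n + 1))) else 0)"
    unfolding split lookup_add IH lookup_single ..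
  also have "\<dots> = (if v(n := 0) = m(n := 0) \<and> v n \<ge> m n then coeff (pCons c p) (nat (v n - m n)) else 0)"
  proof (cases "v(n := 0) = m(n := 0)")
    case True
    consider "v n < m n" | "v n = m n" | "v n > m n"
      by linarith
    then show ?thesis
    proof cases
      case 3
      then have "nat (v n - m n) = Suc (nat (v n - (m n + 1)))"
        by simp
      then show ?thesis
        using True 3 mv by (simp only: coeff_pCons) (auto simp: when_def)
    qed (use True mv in \<open>auto simp: when_def\<close>)
  qed (use mv in \<open>auto simp: when_def\<close>)
  finally show ?case .
qed simp

lemma lookup_V:
  assumes "g \<in> G"
  shows "lookup (V.R g) v =
    (if v n \<ge> 0 then coeff (lookup g (v(n := 0))) (nat (v n)) else 0)"
proof -
  have upd: "m(n := 0) = m" if "m \<in> keys g" for m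
    using S_last[OF G_keys[OF assms that]] by auto
  have "lookup (V.R g) v = (\<Sum>m\<in>keys g. if m = v(n := 0) then
      (if v n \<ge> 0 then coeff (lookup g (v(n := 0))) (nat (v n)) else 0) else 0)"
    unfolding V.R_def lookup_sum
  proof (rule sum.cong[OF refl])
    fix m assume m: "m \<in> keys g"
    show "lookup (single m 1 * V.eval_at X (lookup g m)) v =
      (if m = v(n := 0) then (if v n \<ge> 0 then coeff (lookup g (v(n := 0))) (nat (v n)) else 0) else 0)"
      unfolding lookup_marked_eval upd[OF m] using S_last[OF G_keys[OF assms m]] by auto
  qed
  then show ?thesis
    by (simp add: in_keys_iff)
qed

lemma V_bij: "bij_betw V.R G (toric_algebra (Suc n) \<tau>)"
  unfolding bij_betw_def
proof (intro conjI equalityI subsetI)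
  show "inj_on V.R G"
  proof
    fix g h assume gh: "g \<in> G" "h \<in> G" "V.R g = V.R h"
    show "g = h"
    proof (intro poly_mapping_eqI poly_eqI)
      fix m i
      show "coeff (lookup g m) i = coeff (lookup h m) i"
      proof (cases "m \<in> S")
        case True
        then have "(m(n := int i))(n := 0) = m"
          using S_last by auto
        then show ?thesis
          using lookup_V[OF gh(1), of "m(n := int i)"] lookup_V[OF gh(2), of "m(n := int i)"] gh(3) by simp
      next
        case False
        then have "m \<notin> keys g" "m \<notin> keys h"
          using gh G_keys by blast+
        then show ?thesis
          by (simp add: in_keys_iff)
      qed
    qed
  qed
  show "b \<in> toric_algebra (Suc n) \<tau>" if b: "b \<in> V.R ` G" for b
  proof -
    obtain g where g: "g \<in> G" "b = V.R g"
      using b by blast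
    have "v \<in> dual_lattice (Suc n) \<tau>" if "lookup b v \<noteq> 0" for v
    proof -
      let ?m = "v(n := 0)"
      have v: "v n \<ge> 0" "coeff (lookup g ?m) (nat (v n)) \<noteq> 0"
        using that by (auto simp: g(2) lookup_V[OF g(1)] split: if_splits)
      then have m: "?m \<in> S"
        by (intro G_keys[OF g(1)]) (auto simp: in_keys_iff)
      have "nat (v n) \<le> degree (lookup g ?m)"
        using v(2) by (rule le_degree)
      moreover have "int (degree (lookup g ?m)) \<le> N ?m"
        using G_lookup[OF g(1), of ?m] v(2) unfolding Q[OF m] by auto
      ultimately have "v n \<le> N ?m"
        by linarith
      moreover have "v = ?m(n := v n)"
        by simp
      ultimately show ?thesis
        unfolding \<tau> using m v(1) by blast
    qed
    then show ?thesis
      by (auto simp: toric_algebra_def in_keys_iff)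
  qed
  show "b \<in> V.R ` G" if b: "b \<in> toric_algebra (Suc n) \<tau>" for b
  proof -
    let ?g = "\<Sum>v\<in>keys b. single (v(n := 0)) (monom (lookup b v) (nat (v n)))"
    have v: "v(n := 0) \<in> S" "v n \<ge> 0" "v n \<le> N (v(n := 0))" if v: "v \<in> keys b" for v
    proof -
      obtain m k where "m \<in> S" "k \<ge> 0" "k \<le> N m" "v = m(n := k)"
        using b v unfolding toric_algebra_def \<tau> by blast
      moreover from this have "v(n := 0) = m"
        using S_last[of m] by auto
      ultimately show "v(n := 0) \<in> S" "v n \<ge> 0" "v n \<le> N (v(n := 0))"
        by auto
    qed
    have "?g \<in> G"
    proof (intro G_sum G_single)
      fix v assume k: "v \<in> keys b"
      show "v(n := 0) \<in> S"
        by (rule v[OF k])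
      show "monom (lookup b v) (nat (v n)) \<in> Q (v(n := 0))"
        unfolding Q[OF v(1)[OF k]] using v(2,3)[OF k] degree_monom_le[of "lookup b v" "nat (v n)"] by auto
    qed
    moreover have "V.R ?g = b"
    proof -
      have "V.R ?g = (\<Sum>v\<in>keys b. single v (lookup b v))"
        unfolding V.R_sum
      proof (rule sum.cong[OF refl])
        fix v assume k: "v \<in> keys b"
        show "V.R (single (v(n := 0)) (monom (lookup b v) (nat (v n)))) =
            single v (lookup b v)"
          unfolding V.R_single
        proof (rule poly_mapping_eqI)
          fix w
          have "v = w \<longleftrightarrow> w(n := 0) = v(n := 0) \<and> w n = v n"
            by (metis fun_upd_triv fun_upd_upd)
          then show "lookup (single (v(n := 0)) 1 *
              V.eval_at X (monom (lookup b v) (nat (v n)))) w =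
              lookup (single v (lookup b v)) w"
            unfolding lookup_marked_eval using v(2)[OF k] by (auto simp: lookup_single when_def)
        qed
      qed
      then show ?thesis
        using poly_mapping_expand[of b] by simp
    qed
    ultimately show ?thesis
      by (intro image_eqI[of b V.R ?g]) (simp_all only:)
  qed
qed

lemma V_iso: "algebra_iso poly_const G (group_alg_const id) (toric_algebra (Suc n) \<tau>) V.R"
  by (rule V.R_algebra_iso[OF V_bij])

lemma lookup_demazure_lnd:
  "lookup (demazure_lnd (Suc n) (0(n := 1)) (0(n := - 1)) b) v =
    of_int (v n + 1) * lookup b (v(n := v n + 1))"
proof -
  have w: "pairing (Suc n) (0(n := 1)) m = m n" for m :: "nat \<Rightarrow> int"
    by (simp add: pairing_def)
  have shift: "m + 0(n := - 1) = v \<longleftrightarrow> m = v(n := v n + 1)" for m :: "nat \<Rightarrow> int"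
    by (auto simp: fun_eq_iff)
  have "lookup (demazure_lnd (Suc n) (0(n := 1)) (0(n := - 1)) b) v =
      (\<Sum>m\<in>keys b. if m = v(n := v n + 1) then
        of_int (v n + 1) * lookup b (v(n := v n + 1)) else 0)"
    unfolding demazure_lnd_def lookup_sum
    by (rule sum.cong[OF refl]) (auto simp: lookup_single when_def shift w)
  then show ?thesis
    by (simp add: in_keys_iff)
qed

text \<open>
  Both sides multiply the coefficient of \<open>X\<^sup>k\<close> by \<open>k\<close> and lower the exponent by one.
\<close>

lemma V_demazure:
  assumes "g \<in> G"
  shows "demazure_lnd (Suc n) (0(n := 1)) (0(n := - 1)) (V.R g) = V.R (coeff_deriv g)"
proof (rule poly_mapping_eqI)
  fix v :: "nat \<Rightarrow> int"
  consider "v n \<ge> 0" | "v n = - 1" | "v n < - 1"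
    by linarith
  then show "lookup (demazure_lnd (Suc n) (0(n := 1)) (0(n := - 1)) (V.R g)) v =
      lookup (V.R (coeff_deriv g)) v"
  proof cases
    case 1
    then have "nat (v n + 1) = Suc (nat (v n))" "of_int (v n) = (of_nat (nat (v n)) :: 'k)"
      by simp_all
    then show ?thesis
      using 1 assms by (simp add: lookup_demazure_lnd lookup_V G_coeff_deriv lookup_coeff_deriv coeff_pderiv)
  qed (use assms in \<open>simp_all add: lookup_demazure_lnd lookup_V G_coeff_deriv\<close>)
qed

end

section \<open>Invariant quotients\<close>

definition character :: "nat \<Rightarrow> (nat \<Rightarrow> 'k::field) \<Rightarrow> (nat \<Rightarrow> int) \<Rightarrow> 'k" where
  "character n t m = (\<Prod>i<n. t i powi m i)"

lemma character_mult: "character n (\<lambda>i. t i * s i) m = character n t m * character n s m"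
  by (simp add: character_def power_int_mult_distrib prod.distrib)

text \<open>
  The point with one coordinate \<open>2\<close> and all others \<open>1\<close> works: in characteristic zero
  different powers of \<open>2\<close> are different.
\<close>

lemma characters_separate_points:
  assumes "m \<in> int_lattice n" "m' \<in> int_lattice n" "m \<noteq> m'"
  obtains t :: "nat \<Rightarrow> 'k::field_char_0" where "t \<in> torus n" "character n t m \<noteq> character n t m'"
proof -
  obtain j where j: "m j \<noteq> m' j"
    using assms(3) by blast
  have jn: "j < n"
  proof (rule ccontr)
    assume "\<not> j < n"
    then have "m j = 0" "m' j = 0"
      using assms(1,2) by (simp_all add: int_lattice_def)
    then show False
      using j by simp
  qed
  define t where "t = (\<lambda>i. if i = j then 2 else 1 :: 'k)"
  have char: "character n t k = 2 powi k j" for k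
  proof -
    have "character n t k = (\<Prod>i<n. if i = j then 2 powi k j else 1)"
      unfolding character_def t_def by (rule prod.cong) auto
    then show ?thesis
      using jn by simp
  qed
  have inj: "a = b" if "(2 :: 'k) powi a = 2 powi b" for a b
  proof -
    have "(2 :: 'k) powi (a - b) = 1"
      using that by (simp add: power_int_diff)
    then have "2 ^ nat \<bar>a - b\<bar> = (1 :: 'k)"
      by (cases "a \<ge> b") (auto simp: power_int_def power_one_over)
    then have "of_nat (2 ^ nat \<bar>a - b\<bar>) = (of_nat 1 :: 'k)"
      by simp
    then have "(2 :: nat) ^ nat \<bar>a - b\<bar> = 1"
      by (simp only: of_nat_eq_iff)
    then show ?thesis
      by simp
  qed
  show thesis
    by (rule that[of t]) (use char inj j in \<open>auto simp: torus_def t_def\<close>)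
qed

text \<open>Dedekind's independence of characters.\<close>

lemma characters_independent:
  fixes \<iota> :: "'k::field_char_0 \<Rightarrow> 'f::field"
  assumes emb: "field_embedding \<iota>" and "finite A" "A \<subseteq> int_lattice n"
    and "\<And>t. t \<in> torus n \<Longrightarrow> (\<Sum>m\<in>A. \<iota> (character n t m) * c m) = 0"
  shows "\<forall>m\<in>A. c m = 0"
  using assms(2-)
proof (induction A arbitrary: c rule: finite_induct)
  case (insert m0 A)
  interpret coefficient_hom \<iota>
    by (rule coefficient_hom_embedding[OF emb])
  have diff: "\<iota> (a - b) = \<iota> a - \<iota> b" for a b
    using hom_add[of "a - b" b] by simp
  have A0: "c m1 = 0" if m1: "m1 \<in> A" for m1
  proof -
    have "m1 \<noteq> m0" "m1 \<in> int_lattice n" "m0 \<in> int_lattice n"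
      using insert m1 by auto
    then obtain s :: "nat \<Rightarrow> 'k" where s: "s \<in> torus n" "character n s m1 \<noteq> character n s m0"
      using characters_separate_points by metis
    \<comment> \<open>Translating by \<open>s\<close> and subtracting removes the term of \<open>m0\<close>.\<close>
    have "\<forall>m\<in>A. \<iota> (character n s m - character n s m0) * c m = 0"
    proof (rule insert.IH)
      show "A \<subseteq> int_lattice n"
        using insert by simp
      fix t :: "nat \<Rightarrow> 'k" assume t: "t \<in> torus n"
      then have "(\<lambda>i. s i * t i) \<in> torus n"
        using s(1) by (simp add: torus_def)
      then have "(\<Sum>m\<in>insert m0 A. \<iota> (character n (\<lambda>i. s i * t i) m) * c m) = 0"
        by (rule insert.prems(2))
      moreover have "(\<Sum>m\<in>insert m0 A. \<iota> (character n t m) * c m) = 0"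
        using t by (rule insert.prems(2))
      ultimately have "(\<Sum>m\<in>insert m0 A. \<iota> (character n (\<lambda>i. s i * t i) m) * c m) -
          \<iota> (character n s m0) * (\<Sum>m\<in>insert m0 A. \<iota> (character n t m) * c m) = 0"
        by simp
      then show "(\<Sum>m\<in>A. \<iota> (character n t m) * (\<iota> (character n s m - character n s m0) * c m)) = 0"
        using insert.hyps
        by (simp add: character_mult hom_mult diff sum_distrib_left sum_subtractf algebra_simps)
    qed
    then have "\<iota> (character n s m1 - character n s m0) * c m1 = 0"
      using m1 by blast
    then show ?thesis
      using s(2) embedding_eq_0_iff[OF emb] by simp
  qed
  have "(\<lambda>_. 1) \<in> torus n"
    by (simp add: torus_def)
  then have "(\<Sum>m\<in>insert m0 A. \<iota> (character n (\<lambda>_. 1) m) * c m) = 0"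
    by (rule insert.prems(2))
  then have "c m0 = 0"
    using insert.hyps A0 by (simp add: character_def hom_one)
  then show ?case
    using A0 by simp
qed simp

lemma lookup_mult_left:
  fixes f g :: "(nat \<Rightarrow> int) \<Rightarrow>\<^sub>0 'f::comm_ring_1"
  assumes "finite A" "keys f \<subseteq> A"
  shows "lookup (f * g) s = (\<Sum>m\<in>A. lookup f m * lookup g (s - m))"
proof -
  have "f = (\<Sum>m\<in>A. single m (lookup f m))"
    by (subst poly_mapping_expand[of f], rule sum.mono_neutral_left) (use assms in \<open>auto simp: in_keys_iff\<close>)
  then have "f * g = (\<Sum>m\<in>A. single m (lookup f m)) * g"
    by simp
  also have "\<dots> = (\<Sum>m\<in>A. single m (lookup f m) * g)"
    by (rule sum_distrib_right)
  finally have "f * g = (\<Sum>m\<in>A. single m (lookup f m) * g)" .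
  moreover have "lookup (single m c * g) s = c * lookup g (s - m)" for m c
  proof -
    have eq: "single m c * g = (\<Sum>k\<in>keys g. single (m + k) (c * lookup g k))"
      by (subst poly_mapping_expand[of g]) (simp add: sum_distrib_left mult_single)
    have "lookup (single m c * g) s =
        (\<Sum>k\<in>keys g. if k = s - m then c * lookup g (s - m) else 0)"
      unfolding eq lookup_sum by (rule sum.cong) (auto simp: lookup_single when_def algebra_simps)
    then show ?thesis
      by (simp add: in_keys_iff)
  qed
  ultimately show ?thesis
    by (simp add: lookup_sum)
qed

text \<open>
  The invariance of \<open>a / b\<close> says that, for fixed total degree, two combinations of characters
  agree; independence then makes the coefficients of \<open>a\<close> and \<open>b\<close> proportional.
\<close>

theorem invariant_quotient_proportional:
  fixes \<iota> :: "'k::field_char_0 \<Rightarrow> 'f::field"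
  assumes emb: "field_embedding \<iota>"
    and keys: "keys a \<subseteq> int_lattice n" "keys b \<subseteq> int_lattice n"
    and inv: "\<And>t. t \<in> torus n \<Longrightarrow> torus_act \<iota> n t a * b = a * torus_act \<iota> n t b"
  shows "lookup a m * lookup b m' = lookup a m' * lookup b m"
proof -
  let ?A = "keys a \<union> keys b"
  let ?a = "lookup a" and ?b = "lookup b"
  have act: "lookup (torus_act \<iota> n t f) k = \<iota> (character n t k) * lookup f k" for t f k
    by (simp add: torus_act_def lookup_mapp character_def when_def in_keys_iff)
  have act_keys: "keys (torus_act \<iota> n t f) \<subseteq> keys f" for t f
    unfolding torus_act_def by (rule keys_mapp_subset)
  have agree: "\<forall>k\<in>?A. ?a k * ?b (m + m' - k) - ?b k * ?a (m + m' - k) = 0"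
  proof (rule characters_independent[OF emb])
    show "finite ?A" "?A \<subseteq> int_lattice n"
      using keys by auto
    fix t :: "nat \<Rightarrow> 'k" assume t: "t \<in> torus n"
    have "lookup (torus_act \<iota> n t a * b) (m + m') =
        (\<Sum>k\<in>?A. \<iota> (character n t k) * ?a k * ?b (m + m' - k))"
      using act_keys[of t a] by (subst lookup_mult_left[of ?A]) (auto simp: act)
    moreover have "lookup (torus_act \<iota> n t b * a) (m + m') =
        (\<Sum>k\<in>?A. \<iota> (character n t k) * ?b k * ?a (m + m' - k))"
      using act_keys[of t b] by (subst lookup_mult_left[of ?A]) (auto simp: act)
    ultimately have "(\<Sum>k\<in>?A. \<iota> (character n t k) * ?a k * ?b (m + m' - k)) =
        (\<Sum>k\<in>?A. \<iota> (character n t k) * ?b k * ?a (m + m' - k))"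
      using inv[OF t] by (simp add: mult.commute)
    then show "(\<Sum>k\<in>?A. \<iota> (character n t k) * (?a k * ?b (m + m' - k) - ?b k * ?a (m + m' - k))) = 0"
      by (simp add: right_diff_distrib sum_subtractf mult.assoc)
  qed
  have "?a m * ?b (m + m' - m) = ?b m * ?a (m + m' - m)"
  proof (cases "m \<in> ?A")
    case True
    show ?thesis
      using bspec[OF agree True] by (simp only: right_minus_eq)
  next
    case False
    then show ?thesis
      by (simp add: in_keys_iff)
  qed
  then show ?thesis
    by (simp add: mult.commute)
qed

section \<open>Additive functions and integrality\<close>

lemma common_denominator:
  fixes R :: "rat set"
  assumes "finite R"
  shows "\<exists>k>0. \<forall>r\<in>R. of_int k * r \<in> \<int>"
  using assms
proof (induction R rule: finite_induct)
  case empty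
  then show ?case
    by (intro exI[of _ 1]) simp
next
  case (insert r R)
  then obtain k where k: "k > 0" "\<forall>r\<in>R. of_int k * r \<in> \<int>"
    by blast
  obtain a b where ab: "r = of_int a / of_int b" "b > 0"
    by (cases r) (auto simp: Fract_of_int_quotient)
  have "of_int (k * b) * r = of_int (k * a)"
    using ab by simp
  then have "of_int (k * b) * r \<in> \<int>"
    by (metis Ints_of_int)
  moreover have "of_int (k * b) * s \<in> \<int>" if "s \<in> R" for s
  proof -
    have "of_int k * s \<in> \<int>"
      using k(2) that by blast
    then have "of_int b * (of_int k * s) \<in> \<int>"
      by (rule Ints_mult[OF Ints_of_int])
    then show ?thesis
      by (simp add: mult_ac)
  qed
  ultimately show ?case
    using k(1) ab(2) by (intro exI[of _ "k * b"]) auto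
qed

lemma of_int_floor_Ints: "r \<in> \<int> \<Longrightarrow> of_int \<lfloor>r\<rfloor> = (r :: rat)"
  by (elim Ints_cases) simp

text \<open>
  Rounding down hides part of the support functions, but only finitely much: a multiple
  \<open>k m\<close> has integral values, and adding many copies of a degree \<open>m1\<close> with \<open>N m1 \<ge> 1\<close> makes
  every \<open>N\<close> nonnegative. So additivity of the rounded functions where \<open>N\<close> is nonnegative
  forces the functions themselves to be additive and integral everywhere.
\<close>

locale rounded_additive =
  fixes S :: "(nat \<Rightarrow> int) set" and h :: "'a \<Rightarrow> (nat \<Rightarrow> int) \<Rightarrow> rat" and B :: "'a set"
    and hi :: "(nat \<Rightarrow> int) \<Rightarrow> rat" and N :: "(nat \<Rightarrow> int) \<Rightarrow> int" and m1
  assumes S_add: "m \<in> S \<Longrightarrow> m' \<in> S \<Longrightarrow> m + m' \<in> S"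
    and S_mult: "m \<in> S \<Longrightarrow> k \<ge> 0 \<Longrightarrow> (\<lambda>i. k * m i) \<in> S"
    and finB: "finite B"
    and N: "m \<in> S \<Longrightarrow> N m = (\<Sum>a\<in>B. \<lfloor>h a m\<rfloor>) + \<lfloor>hi m\<rfloor>"
    and superadd: "m \<in> S \<Longrightarrow> m' \<in> S \<Longrightarrow> h a m + h a m' \<le> h a (m + m')"
      "m \<in> S \<Longrightarrow> m' \<in> S \<Longrightarrow> hi m + hi m' \<le> hi (m + m')"
    and mult: "m \<in> S \<Longrightarrow> k \<ge> 0 \<Longrightarrow> h a (\<lambda>i. k * m i) = of_int k * h a m"
      "m \<in> S \<Longrightarrow> k \<ge> 0 \<Longrightarrow> hi (\<lambda>i. k * m i) = of_int k * hi m"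
    and total: "m \<in> S \<Longrightarrow> (\<Sum>a\<in>B. h a m) + hi m \<ge> 0"
    and good_add: "m \<in> S \<Longrightarrow> m' \<in> S \<Longrightarrow> N m \<ge> 0 \<Longrightarrow> N m' \<ge> 0 \<Longrightarrow> N (m + m') \<ge> 0"
    and floor_add: "m \<in> S \<Longrightarrow> m' \<in> S \<Longrightarrow> N m \<ge> 0 \<Longrightarrow> N m' \<ge> 0 \<Longrightarrow> a \<in> B \<Longrightarrow>
      \<lfloor>h a (m + m')\<rfloor> = \<lfloor>h a m\<rfloor> + \<lfloor>h a m'\<rfloor>"
    and m1: "m1 \<in> S" "N m1 \<ge> 1"
begin

lemma integral_multiple:
  assumes "finite R" "R \<subseteq> S"
  shows "\<exists>k>0. (\<forall>m\<in>R. \<forall>a\<in>B. of_int k * h a m \<in> \<int>) \<and> (\<forall>m\<in>R. of_int k * hi m \<in> \<int>)"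
proof -
  have "finite ((\<lambda>(a, m). h a m) ` (B \<times> R) \<union> hi ` R)"
    using assms finB by simp
  then obtain k where k: "k > 0" "\<forall>r\<in>(\<lambda>(a, m). h a m) ` (B \<times> R) \<union> hi ` R. of_int k * r \<in> \<int>"
    using common_denominator by blast
  then show ?thesis
    by (intro exI[of _ k]) force
qed

text \<open>
  On such a multiple nothing is rounded, and \<open>N\<close> is a multiple of the nonnegative total.
\<close>

lemma good_multiple:
  assumes "m \<in> S" "k \<ge> 0" "\<And>a. a \<in> B \<Longrightarrow> of_int k * h a m \<in> \<int>" "of_int k * hi m \<in> \<int>"
  shows "N (\<lambda>i. k * m i) \<ge> 0"
proof -
  have "of_int (N (\<lambda>i. k * m i)) = (\<Sum>a\<in>B. of_int k * h a m) + of_int k * hi m"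
    using assms by (simp add: N S_mult mult of_int_floor_Ints)
  also have "\<dots> = of_int k * ((\<Sum>a\<in>B. h a m) + hi m)"
    by (simp add: sum_distrib_left distrib_left)
  also have "\<dots> \<ge> 0"
    using assms(1,2) total by simp
  finally show ?thesis
    by simp
qed

lemma additive:
  assumes m: "m \<in> S" "m' \<in> S" and a: "a \<in> B"
  shows "h a (m + m') = h a m + h a m'"
proof -
  have fin: "finite {m, m', m + m'}" "{m, m', m + m'} \<subseteq> S"
    using m S_add by auto
  obtain k where k: "k > 0"
    "\<forall>l\<in>{m, m', m + m'}. \<forall>a\<in>B. of_int k * h a l \<in> \<int>" "\<forall>l\<in>{m, m', m + m'}. of_int k * hi l \<in> \<int>"
    using integral_multiple[OF fin] by blast
  let ?k = "\<lambda>l :: nat \<Rightarrow> int. \<lambda>i. k * l i"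
  have floor: "of_int \<lfloor>h a (?k l)\<rfloor> = of_int k * h a l" if l: "l \<in> {m, m', m + m'}" for l
  proof -
    have "l \<in> S"
      using l fin(2) by blast
    then have "h a (?k l) = of_int k * h a l"
      using k(1) by (intro mult) simp_all
    moreover have "of_int k * h a l \<in> \<int>"
      using k(2) l a by blast
    ultimately show ?thesis
      by (simp only: of_int_floor_Ints)
  qed
  have sum: "?k (m + m') = ?k m + ?k m'"
    by (simp add: fun_eq_iff distrib_left)
  have "\<lfloor>h a (?k m + ?k m')\<rfloor> = \<lfloor>h a (?k m)\<rfloor> + \<lfloor>h a (?k m')\<rfloor>"
    using m k a by (intro floor_add S_mult good_multiple) auto
  then have "of_int \<lfloor>h a (?k (m + m'))\<rfloor> = of_int \<lfloor>h a (?k m)\<rfloor> + (of_int \<lfloor>h a (?k m')\<rfloor> :: rat)"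
    unfolding sum by simp
  moreover have "of_int \<lfloor>h a (?k (m + m'))\<rfloor> = of_int k * h a (m + m')"
    "of_int \<lfloor>h a (?k m)\<rfloor> = of_int k * h a m" "of_int \<lfloor>h a (?k m')\<rfloor> = of_int k * h a m'"
    using floor[of "m + m'"] floor[of m] floor[of m'] by blast+
  ultimately have "of_int k * h a (m + m') = of_int k * (h a m + h a m')"
    by (simp only: distrib_left)
  then show ?thesis
    using k(1) by simp
qed

text \<open>
  The rounded value is multiplied by \<open>k\<close> when \<open>m\<close> is, and for a suitable \<open>k\<close> the multiple is
  not rounded.
\<close>

lemma integral_if_good:
  assumes m: "m \<in> S" "N m \<ge> 0" and a: "a \<in> B"
  shows "h a m \<in> \<int>"
proof -
  have multiple: "N (\<lambda>i. int (Suc j) * m i) \<ge> 0 \<and> \<lfloor>h a (\<lambda>i. int (Suc j) * m i)\<rfloor> = int (Suc j) * \<lfloor>h a m\<rfloor>" for j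
  proof (induction j)
    case 0
    then show ?case
      using m by simp
  next
    case (Suc j)
    have split: "(\<lambda>i. int (Suc (Suc j)) * m i) = m + (\<lambda>i. int (Suc j) * m i)"
      by (simp add: fun_eq_iff algebra_simps)
    have mem: "(\<lambda>i. int (Suc j) * m i) \<in> S"
      using m(1) by (rule S_mult) simp
    show ?case
      unfolding split using good_add[OF m(1) mem m(2)] floor_add[OF m(1) mem m(2) _ a] Suc
      by (simp add: algebra_simps)
  qed
  have fin: "finite {m}" "{m} \<subseteq> S"
    using m(1) by auto
  obtain k where k: "k > 0" "\<forall>l\<in>{m}. \<forall>a\<in>B. of_int k * h a l \<in> \<int>"
    using integral_multiple[OF fin] by blast
  then obtain j where j: "k = int (Suc j)"
    using zero_less_imp_eq_int by (metis gr0_implies_Suc)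
  have "of_int k * h a m = of_int \<lfloor>h a (\<lambda>i. k * m i)\<rfloor>"
    using k a m(1) by (simp add: mult of_int_floor_Ints)
  also have "\<dots> = of_int k * of_int \<lfloor>h a m\<rfloor>"
    using multiple[of j] by (simp add: j del: of_nat_Suc)
  finally have "h a m = of_int \<lfloor>h a m\<rfloor>"
    using k(1) by simp
  then show ?thesis
    by (metis Ints_of_int)
qed

theorem integral:
  assumes m: "m \<in> S" and a: "a \<in> B"
  shows "h a m \<in> \<int>"
proof -
  have fin: "finite {m1}" "{m1} \<subseteq> S"
    using m1 by auto
  obtain k where k: "k > 0" "\<forall>l\<in>{m1}. \<forall>a\<in>B. of_int k * h a l \<in> \<int>"
      "\<forall>l\<in>{m1}. of_int k * hi l \<in> \<int>"
    using integral_multiple[OF fin] by blast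
  \<comment> \<open>The rounding at the points of \<open>B\<close> and at infinity loses less than \<open>card B + 1\<close>.\<close>
  define j where "j = k * (int (card B) + 1)"
  have jk: "j \<ge> int (card B) + 1"
    using mult_right_mono[of 1 k "int (card B) + 1"] k(1) by (simp add: j_def)
  then have j0: "j \<ge> 0"
    by simp
  let ?j = "\<lambda>i. j * m1 i"
  have jS: "?j \<in> S"
    by (rule S_mult[OF m1(1) j0])
  have "of_int j * r \<in> \<int>" if "of_int k * r \<in> \<int>" for r :: rat
  proof -
    have "of_int (int (card B) + 1) * (of_int k * r) \<in> \<int>"
      using that by (rule Ints_mult[OF Ints_of_int])
    then show ?thesis
      by (simp add: j_def mult_ac)
  qed
  then have good_j: "N ?j \<ge> 0"
    using k by (intro good_multiple m1 j0) auto
  have large: "(\<Sum>a\<in>B. h a m1) + hi m1 \<ge> 1"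
  proof -
    have "of_int (N m1) \<le> (\<Sum>a\<in>B. h a m1) + hi m1"
      unfolding N[OF m1(1)] of_int_add of_int_sum by (intro add_mono sum_mono of_int_floor_le)
    moreover have "of_int (N m1) \<ge> (1 :: rat)"
      using m1(2) by simp
    ultimately show ?thesis
      by linarith
  qed
  have "N (m + ?j) \<ge> 0"
  proof -
    have "of_int j \<le> of_int j * ((\<Sum>a\<in>B. h a m1) + hi m1)"
      using large j0 by (simp add: mult_le_cancel_left1)
    also have "\<dots> = (\<Sum>a\<in>B. h a ?j) + hi ?j"
      using m1(1) j0 by (simp add: mult distrib_left sum_distrib_left)
    also have "\<dots> \<le> ((\<Sum>a\<in>B. h a m) + hi m) + ((\<Sum>a\<in>B. h a ?j) + hi ?j)"
      using total[OF m] by simp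
    also have "\<dots> = (\<Sum>a\<in>B. h a m + h a ?j) + (hi m + hi ?j)"
      by (simp add: sum.distrib)
    also have "\<dots> \<le> (\<Sum>a\<in>B. h a (m + ?j)) + hi (m + ?j)"
      by (intro add_mono sum_mono superadd m jS)
    also have "\<dots> \<le> (\<Sum>a\<in>B. of_int \<lfloor>h a (m + ?j)\<rfloor> + 1) + hi (m + ?j)"
      by (intro add_mono sum_mono order.refl) linarith
    also have "\<dots> < (\<Sum>a\<in>B. of_int \<lfloor>h a (m + ?j)\<rfloor> + 1) + (of_int \<lfloor>hi (m + ?j)\<rfloor> + 1)"
      by linarith
    also have "\<dots> = of_int (N (m + ?j) + int (card B) + 1)"
      using m jS by (simp add: N S_add sum.distrib)
    finally have "j < N (m + ?j) + int (card B) + 1"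
      by (simp only: of_int_less_iff)
    then show ?thesis
      using jk by linarith
  qed
  then have "h a (m + ?j) \<in> \<int>" "h a ?j \<in> \<int>"
    using integral_if_good a m jS S_add good_j by blast+
  then have "h a (m + ?j) - h a ?j \<in> \<int>"
    by (rule Ints_diff)
  then show ?thesis
    by (simp add: additive[OF m jS a])
qed

end

text \<open>
  The lattice points of the dual of a strongly convex cone generate the lattice, so an additive
  integral function on them is the pairing with a lattice vector.
\<close>

theorem additive_function_is_pairing:
  fixes H :: "(nat \<Rightarrow> int) \<Rightarrow> int"
  assumes cone: "polyhedral_cone n \<sigma>" "strongly_convex \<sigma>"
    and H: "\<And>m m'. m \<in> dual_lattice n \<sigma> \<Longrightarrow> m' \<in> dual_lattice n \<sigma> \<Longrightarrow> H (m + m') = H m + H m'"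
  obtains p where "p \<in> int_lattice n" "\<And>m. m \<in> dual_lattice n \<sigma> \<Longrightarrow> H m = pairing n p m"
proof -
  let ?S = "dual_lattice n \<sigma>"
  obtain m1 where m1: "m1 \<in> ?S" "\<And>v. v \<in> \<sigma> \<Longrightarrow> v \<noteq> 0 \<Longrightarrow> pairing n v m1 > 0"
    using interior_lattice_point[OF cone] by blast
  define e where "e i = (0 :: nat \<Rightarrow> int)(i := 1)" for i :: nat
  obtain G where G: "finite G" "G \<subseteq> rat_space n" "\<sigma> = cone_hull G"
    using cone(1) unfolding polyhedral_cone_def by blast
  \<comment> \<open>For large \<open>k\<close> the points \<open>e i + k m1\<close> lie in the dual cone, because \<open>m1\<close> is an interior point.\<close>
  have "\<exists>k\<ge>0. \<forall>g\<in>G. \<forall>i<n. pairing n g (e i) + of_int k * pairing n g m1 \<ge> 0"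
  proof -
    have "\<exists>k\<ge>0. pairing n g (e i) + of_int k * pairing n g m1 \<ge> 0" if "g \<in> G" for g i
    proof (cases "g = 0")
      case True
      then show ?thesis
        by (intro exI[of _ 0]) simp
    next
      case False
      then have pos: "pairing n g m1 > 0"
        using m1(2)[of g] that cone_hull_superset[of G] by (auto simp: G(3))
      obtain k :: nat where "- pairing n g (e i) < of_nat k * pairing n g m1"
        using reals_Archimedean3[OF pos] by blast
      then show ?thesis
        by (intro exI[of _ "int k"]) simp
    qed
    then obtain k where k: "\<And>g i. g \<in> G \<Longrightarrow> k g i \<ge> 0 \<and> pairing n g (e i) + of_int (k g i) * pairing n g m1 \<ge> 0"
      by metis
    define K where "K = (\<Sum>g\<in>G. \<Sum>i<n. k g i)"
    have K: "k g i \<le> K" if "g \<in> G" "i < n" for g i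
    proof -
      have "k g i \<le> (\<Sum>i<n. k g i)"
        using that k by (intro member_le_sum) auto
      also have "\<dots> \<le> K"
        unfolding K_def using that k G(1) by (intro member_le_sum[of g G "\<lambda>g. \<Sum>i<n. k g i"] sum_nonneg) auto
      finally show ?thesis .
    qed
    have "pairing n g (e i) + of_int K * pairing n g m1 \<ge> 0" if "g \<in> G" "i < n" for g i
    proof -
      have "pairing n g m1 \<ge> 0"
        using m1(1) that(1) cone_hull_superset[of G] by (auto simp: dual_lattice_def G(3))
      then have "of_int (k g i) * pairing n g m1 \<le> of_int K * pairing n g m1"
        using K[OF that] by (intro mult_right_mono) auto
      then show ?thesis
        using k[OF that(1), of i] by linarith
    qed
    moreover have "K \<ge> 0"
      unfolding K_def using k by (intro sum_nonneg) auto
    ultimately show ?thesis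
      by blast
  qed
  then obtain k where k: "k \<ge> 0" "\<And>g i. g \<in> G \<Longrightarrow> i < n \<Longrightarrow> pairing n g (e i) + of_int k * pairing n g m1 \<ge> 0"
    by blast
  define K where "K = (\<lambda>i. k * m1 i)"
  have KS: "K \<in> ?S"
    unfolding K_def by (rule dual_lattice_closed(3)[OF m1(1) k(1)])
  have eS: "e i + K \<in> ?S" if i: "i < n" for i
  proof -
    have "cone_hull G \<subseteq> {v. dot n v (rat_vec (e i + K)) \<ge> 0}"
    proof (rule cone_hull_minimal[OF _ convex_cone_halfspace])
      show "G \<subseteq> {v. dot n v (rat_vec (e i + K)) \<ge> 0}"
        using k(2)[OF _ i] by (auto simp: pairing_eq_dot[symmetric] pairing_add_right K_def pairing_scale_right)
    qed
    moreover have "e i + K \<in> int_lattice n"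
      using KS i by (auto simp: dual_lattice_def int_lattice_def e_def)
    ultimately show ?thesis
      by (auto simp: dual_lattice_def G(3) pairing_eq_dot)
  qed
  have H0: "H 0 = 0"
    using H[of 0 0] dual_lattice_closed(1)[of n \<sigma>] by simp
  have H_mult: "H (\<lambda>i. int j * m i) = int j * H m \<and> (\<lambda>i. int j * m i) \<in> ?S" if m: "m \<in> ?S" for j m
  proof (induction j)
    case 0
    have "(\<lambda>i. int 0 * m i) = 0"
      by (simp add: fun_eq_iff)
    then show ?case
      using H0 dual_lattice_closed(1)[of n \<sigma>] by simp
  next
    case (Suc j)
    have split: "(\<lambda>i. int (Suc j) * m i) = m + (\<lambda>i. int j * m i)"
      by (simp add: fun_eq_iff algebra_simps)
    show ?case
      unfolding split using Suc H m by (simp add: dual_lattice_closed algebra_simps)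
  qed
  have H_sum: "H (\<Sum>i\<in>I. f i) = (\<Sum>i\<in>I. H (f i)) \<and> (\<Sum>i\<in>I. f i) \<in> ?S"
    if "finite I" "\<And>i. i \<in> I \<Longrightarrow> f i \<in> ?S" for I :: "nat set" and f
    using that
  proof (induction I rule: finite_induct)
    case empty
    show ?case
      unfolding sum.empty using H0 dual_lattice_closed(1)[of n \<sigma>] by blast
  next
    case (insert i I)
    then have IH: "H (\<Sum>i\<in>I. f i) = (\<Sum>i\<in>I. H (f i))" "(\<Sum>i\<in>I. f i) \<in> ?S" "f i \<in> ?S"
      by blast+
    show ?case
      unfolding sum.insert[OF insert(1,2)] IH(1)[symmetric]
      by (intro conjI H dual_lattice_closed(2) IH(2,3))
  qed
  define p where "p i = (if i < n then H (e i + K) - H K else 0)" for i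
  show thesis
  proof
    show "p \<in> int_lattice n"
      by (simp add: p_def int_lattice_def)
    fix m assume m: "m \<in> ?S"
    \<comment> \<open>Moving the negative parts to the other side gives an identity within the semigroup.\<close>
    define pos neg where "pos i = int (nat (m i))" and "neg i = int (nat (- m i))" for i
    have pn: "pos i - neg i = m i" for i
      by (simp add: pos_def neg_def)
    define L where "L = m + (\<Sum>i<n. (\<lambda>j. neg i * (e i + K) j)) + (\<Sum>i<n. (\<lambda>j. pos i * K j))"
    have L: "L = (\<Sum>i<n. (\<lambda>j. pos i * (e i + K) j)) + (\<Sum>i<n. (\<lambda>j. neg i * K j))"
    proof
      fix j
      have app: "(\<Sum>i<n. f i) j = (\<Sum>i<n. f i j)" for f :: "nat \<Rightarrow> nat \<Rightarrow> int"
        by (induction n) simp_all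
      have "m j = (\<Sum>i<n. m i * e i j)"
      proof -
        have "(\<Sum>i<n. m i * e i j) = (\<Sum>i<n. if i = j then m j else 0)"
          by (rule sum.cong) (auto simp: e_def)
        then show ?thesis
          using m by (auto simp: dual_lattice_def int_lattice_def)
      qed
      also have "\<dots> = (\<Sum>i<n. pos i * e i j) - (\<Sum>i<n. neg i * e i j)"
        by (simp add: pn[symmetric] left_diff_distrib sum_subtractf)
      finally have "m j = (\<Sum>i<n. pos i * e i j) - (\<Sum>i<n. neg i * e i j)" .
      then show "L j = ((\<Sum>i<n. (\<lambda>j. pos i * (e i + K) j)) + (\<Sum>i<n. (\<lambda>j. neg i * K j))) j"
        unfolding L_def plus_fun_apply app by (simp add: distrib_left sum.distrib)
    qed
    have parts: "H (\<Sum>i<n. (\<lambda>j. int (f i) * v i j)) = (\<Sum>i<n. int (f i) * H (v i)) \<and>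
        (\<Sum>i<n. (\<lambda>j. int (f i) * v i j)) \<in> ?S" if v: "\<And>i. i < n \<Longrightarrow> v i \<in> ?S" for f v
    proof -
      have mem: "H (\<lambda>j. int (f i) * v i j) = int (f i) * H (v i)" "(\<lambda>j. int (f i) * v i j) \<in> ?S" if "i < n" for i
        using H_mult[OF v[OF that]] by blast+
      have sum: "H (\<Sum>i<n. (\<lambda>j. int (f i) * v i j)) = (\<Sum>i<n. H (\<lambda>j. int (f i) * v i j)) \<and>
          (\<Sum>i<n. (\<lambda>j. int (f i) * v i j)) \<in> ?S"
        by (rule H_sum) (use mem in auto)
      have "(\<Sum>i<n. H (\<lambda>j. int (f i) * v i j)) = (\<Sum>i<n. int (f i) * H (v i))"
        by (rule sum.cong) (use mem(1) in auto)
      then show ?thesis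
        using sum by (simp only:)
    qed
    define A where "A f = (\<Sum>i<n. (\<lambda>j. f i * (e i + K) j))" for f
    define A' where "A' f = (\<Sum>i<n. (\<lambda>j. f i * K j))" for f :: "nat \<Rightarrow> int"
    have A: "H (A (\<lambda>i. int (f i))) = (\<Sum>i<n. int (f i) * H (e i + K))" "A (\<lambda>i. int (f i)) \<in> ?S" for f
      unfolding A_def using parts[of "\<lambda>i. e i + K" f] eS by blast+
    have A': "H (A' (\<lambda>i. int (f i))) = (\<Sum>i<n. int (f i) * H K)" "A' (\<lambda>i. int (f i)) \<in> ?S" for f
      unfolding A'_def using parts[of "\<lambda>i. K" f] KS by blast+
    have pos: "pos = (\<lambda>i. int (nat (m i)))" and neg: "neg = (\<lambda>i. int (nat (- m i)))"
      by (auto simp: pos_def neg_def)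
    have "H L = H (m + A neg) + H (A' pos)"
      unfolding L_def A_def[symmetric] A'_def[symmetric]
      by (intro H dual_lattice_closed(2) m) (simp_all only: pos neg A A')
    also have "H (m + A neg) = H m + H (A neg)"
      by (intro H m) (simp only: neg A)
    finally have "H L = H m + (\<Sum>i<n. neg i * H (e i + K)) + (\<Sum>i<n. pos i * H K)"
      by (simp only: pos neg A A')
    moreover have "H L = H (A pos) + H (A' neg)"
      unfolding L A_def[symmetric] A'_def[symmetric] by (intro H) (simp_all only: pos neg A A')
    then have "H L = (\<Sum>i<n. pos i * H (e i + K)) + (\<Sum>i<n. neg i * H K)"
      by (simp only: pos neg A A')
    ultimately have "H m = (\<Sum>i<n. pos i * H (e i + K)) + (\<Sum>i<n. neg i * H K) -
        (\<Sum>i<n. neg i * H (e i + K)) - (\<Sum>i<n. pos i * H K)"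
      by linarith
    also have "\<dots> = (\<Sum>i<n. (pos i - neg i) * (H (e i + K) - H K))"
      by (simp add: algebra_simps sum.distrib sum_subtractf)
    also have "\<dots> = pairing n p m"
      unfolding pn pairing_def by (rule sum.cong) (auto simp: p_def)
    finally show "H m = pairing n p m" .
  qed
qed

section \<open>Graded pieces in a coordinate\<close>

lemma ratfun_with_orders_add:
  fixes e e' :: "'k::alg_closed_field \<Rightarrow> int"
  assumes "finite {a. e a \<noteq> 0}" "finite {a. e' a \<noteq> 0}"
  shows "ratfun_with_orders (\<lambda>a. e a + e' a) = ratfun_with_orders e * ratfun_with_orders e'"
proof -
  let ?A = "{a. e a \<noteq> 0} \<union> {a. e' a \<noteq> 0}"
  have super: "ratfun_with_orders f = (\<Prod>a\<in>?A. Fract [:- a, 1:] 1 powi f a)" if "{a. f a \<noteq> 0} \<subseteq> ?A" for f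
    unfolding ratfun_with_orders_def using assms that by (intro prod.mono_neutral_left) auto
  have "{a. e a + e' a \<noteq> 0} \<subseteq> ?A"
    by auto
  then show ?thesis
    by (subst (1 2 3) super) (auto simp: prod.distrib[symmetric] power_int_add Zero_fract_def eq_fract)
qed

lemma ratfun_with_orders_zero: "ratfun_with_orders (\<lambda>_. 0) = 1"
  by (simp add: ratfun_with_orders_def)

context
  fixes \<iota> :: "'k::alg_closed_field \<Rightarrow> 'f::field" and q and \<psi> :: "'k poly fract \<Rightarrow> 'f"
  assumes emb: "field_embedding \<iota>"
    and \<psi>: "bij \<psi>" "field_embedding \<psi>" "\<And>p. \<psi> (Fract p 1) = coefficient_hom.eval_at \<iota> q p"
begin

lemma order_condition: "of_int k + r \<ge> (0 :: rat) \<longleftrightarrow> k \<ge> - \<lfloor>r\<rfloor>"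
  by linarith

lemma piece_over_A1:
  fixes r :: "('f \<Rightarrow> int) \<Rightarrow> rat"
  assumes C: "C = (\<lambda>z. z \<circ> inv \<psi>) ` A1" and fin: "finite {a. \<lfloor>r (ord_at a \<circ> inv \<psi>)\<rfloor> \<noteq> 0}"
  shows "{f. f = 0 \<or> (\<forall>z\<in>C. of_int (z f) + r z \<ge> 0)} =
    {\<psi> (ratfun_with_orders (\<lambda>a. - \<lfloor>r (ord_at a \<circ> inv \<psi>)\<rfloor>)) * coefficient_hom.eval_at \<iota> q p | p. True}"
proof -
  let ?e = "\<lambda>a. - \<lfloor>r (ord_at a \<circ> inv \<psi>)\<rfloor>"
  have surj: "\<psi> (inv \<psi> f) = f" for f
    using \<psi>(1) by (simp add: bij_is_surj surj_f_inv_f)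
  have inv0: "inv \<psi> f = 0 \<longleftrightarrow> f = 0" for f
    by (metis surj embedding_eq_0_iff[OF \<psi>(2)])
  have mult: "\<psi> (a * b) = \<psi> a * \<psi> b" for a b
    using \<psi>(2) by (simp add: field_embedding_def)
  have "f = 0 \<or> (\<forall>z\<in>C. of_int (z f) + r z \<ge> 0) \<longleftrightarrow>
      (\<exists>p. f = \<psi> (ratfun_with_orders ?e) * coefficient_hom.eval_at \<iota> q p)" for f
  proof -
    have "f = 0 \<or> (\<forall>z\<in>C. of_int (z f) + r z \<ge> 0) \<longleftrightarrow>
        inv \<psi> f = 0 \<or> (\<forall>a. ord_at a (inv \<psi> f) \<ge> ?e a)"
      unfolding C A1_eq by (simp add: inv0 order_condition)
    also have "\<dots> \<longleftrightarrow> (\<exists>p. inv \<psi> f = ratfun_with_orders ?e * Fract p 1)"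
      using fin by (intro ratfun_orders_bounded_iff) simp
    also have "\<dots> \<longleftrightarrow> (\<exists>p. f = \<psi> (ratfun_with_orders ?e) * coefficient_hom.eval_at \<iota> q p)"
    proof -
      have "inv \<psi> f = g \<longleftrightarrow> f = \<psi> g" for g
        using bij_inv_eq_iff[OF \<psi>(1)] by metis
      then show ?thesis
        unfolding \<psi>(3)[symmetric] mult[symmetric] by simp
    qed
    finally show ?thesis .
  qed
  then show ?thesis
    by auto
qed

text \<open>
  The order at infinity of \<open>u\<close> times a polynomial falls with the degree, so the condition
  at infinity on a function that is admissible at the finite points bounds the degree.
\<close>

lemma piece_over_P1:
  fixes r :: "('f \<Rightarrow> int) \<Rightarrow> rat"
  assumes C: "C = (\<lambda>z. z \<circ> inv \<psi>) ` P1"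
    and B: "finite B" "{a. \<lfloor>r (ord_at a \<circ> inv \<psi>)\<rfloor> \<noteq> 0} \<subseteq> B"
  shows "{f. f = 0 \<or> (\<forall>z\<in>C. of_int (z f) + r z \<ge> 0)} =
    {\<psi> (ratfun_with_orders (\<lambda>a. - \<lfloor>r (ord_at a \<circ> inv \<psi>)\<rfloor>)) * coefficient_hom.eval_at \<iota> q p | p.
      p = 0 \<or> int (degree p) \<le> (\<Sum>a\<in>B. \<lfloor>r (ord_at a \<circ> inv \<psi>)\<rfloor>) + \<lfloor>r (P1_infinity \<circ> inv \<psi>)\<rfloor>}"
proof -
  interpret coefficient_hom \<iota>
    by (rule coefficient_hom_embedding[OF emb])
  let ?e = "\<lambda>a. - \<lfloor>r (ord_at a \<circ> inv \<psi>)\<rfloor>"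
  let ?u = "\<psi> (ratfun_with_orders ?e)"
  let ?C = "(\<lambda>z. z \<circ> inv \<psi>) ` A1"
  let ?N = "(\<Sum>a\<in>B. \<lfloor>r (ord_at a \<circ> inv \<psi>)\<rfloor>) + \<lfloor>r (P1_infinity \<circ> inv \<psi>)\<rfloor>"
  have fin: "finite {a. \<lfloor>r (ord_at a \<circ> inv \<psi>)\<rfloor> \<noteq> 0}"
    using B finite_subset by blast
  then have fin': "finite {a. ?e a \<noteq> 0}"
    by simp
  have Csplit: "C = insert (P1_infinity \<circ> inv \<psi>) ?C"
    unfolding C P1_eq A1_eq by simp
  have deg: "(P1_infinity \<circ> inv \<psi>) (?u * eval_at q p) = (\<Sum>a\<in>B. \<lfloor>r (ord_at a \<circ> inv \<psi>)\<rfloor>) - int (degree p)"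
    if p: "p \<noteq> 0" for p
  proof -
    have "?u * eval_at q p = \<psi> (ratfun_with_orders ?e * Fract p 1)"
      using \<psi>(2,3) by (simp add: field_embedding_def)
    then have "(P1_infinity \<circ> inv \<psi>) (?u * eval_at q p) = P1_infinity (ratfun_with_orders ?e * Fract p 1)"
      using \<psi>(1) by (simp add: bij_is_inj inv_f_f)
    also have "\<dots> = - (\<Sum>a | ?e a \<noteq> 0. ?e a) - int (degree p)"
      by (rule P1_infinity_with_orders_mult[OF fin' p])
    also have "(\<Sum>a | ?e a \<noteq> 0. ?e a) = (\<Sum>a\<in>B. ?e a)"
      using B by (intro sum.mono_neutral_left) auto
    finally show ?thesis
      by (simp only: sum_negf minus_minus)
  qed
  have u: "?u * eval_at q p = 0 \<longleftrightarrow> p = 0" for p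
  proof -
    have "\<psi> (Fract p 1) = 0 \<longleftrightarrow> p = 0"
      using embedding_eq_0_iff[OF \<psi>(2)] by (simp add: Zero_fract_def eq_fract)
    then show ?thesis
      using embedding_eq_0_iff[OF \<psi>(2)] ratfun_with_orders_nonzero[OF fin'] \<psi>(3)[of p] by simp
  qed
  have "f = 0 \<or> (\<forall>z\<in>C. of_int (z f) + r z \<ge> 0) \<longleftrightarrow>
      (\<exists>p. f = ?u * eval_at q p \<and> (p = 0 \<or> int (degree p) \<le> ?N))" for f
  proof -
    have "f = 0 \<or> (\<forall>z\<in>C. of_int (z f) + r z \<ge> 0) \<longleftrightarrow> f \<in> {f. f = 0 \<or> (\<forall>z\<in>?C. of_int (z f) + r z \<ge> 0)} \<and>
        (f = 0 \<or> (P1_infinity \<circ> inv \<psi>) f \<ge> - \<lfloor>r (P1_infinity \<circ> inv \<psi>)\<rfloor>)"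
      unfolding Csplit by (auto simp: order_condition)
    also have "\<dots> \<longleftrightarrow> (\<exists>p. f = ?u * eval_at q p) \<and>
        (f = 0 \<or> (P1_infinity \<circ> inv \<psi>) f \<ge> - \<lfloor>r (P1_infinity \<circ> inv \<psi>)\<rfloor>)"
      unfolding piece_over_A1[OF refl fin] by simp
    also have "\<dots> \<longleftrightarrow> (\<exists>p. f = ?u * eval_at q p \<and> (p = 0 \<or> int (degree p) \<le> ?N))"
    proof -
      have "f = 0 \<or> (P1_infinity \<circ> inv \<psi>) f \<ge> - \<lfloor>r (P1_infinity \<circ> inv \<psi>)\<rfloor> \<longleftrightarrow> p = 0 \<or> int (degree p) \<le> ?N"
        if f: "f = ?u * eval_at q p" for p
        unfolding f u using deg[of p] by (cases "p = 0") (simp, linarith)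
      then show ?thesis
        by blast
    qed
    finally show ?thesis .
  qed
  then show ?thesis
    by blast
qed

end

section \<open>Horizontal derivations of degree zero\<close>

text \<open>
  The points of the affine line can be recovered from its coordinate alone, as the places where it
  has no pole. This allows replacing one coordinate by another.
\<close>

lemma places_isomorphic:
  fixes \<iota> :: "'k::alg_closed_field \<Rightarrow> 'f::field" and \<psi> :: "'k poly fract \<Rightarrow> 'f"
  assumes "bij \<psi>" "field_embedding \<psi>" "\<And>c. \<psi> (ratfun_const c) = \<iota> c"
  shows "(\<lambda>z. z \<circ> inv \<psi>) ` P1 = places \<iota>"
    and "(\<lambda>z. z \<circ> inv \<psi>) ` A1 = {z \<in> places \<iota>. z (\<psi> (Fract [:0, 1:] 1)) \<ge> 0}"
proof -
  have inv: "inv \<psi> (\<psi> f) = f" "\<psi> (inv \<psi> g) = g" for f g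
    using assms(1) by (simp_all add: bij_is_inj inv_f_f bij_is_surj surj_f_inv_f)
  have inv_const: "inv \<psi> (\<iota> c) = ratfun_const c" for c
    by (metis assms(3) inv(1))
  have to_F: "z \<circ> inv \<psi> \<in> places \<iota>" if "z \<in> P1" for z
    using that assms(1) unfolding P1_def
    by (intro places_comp[OF field_embedding_inv[OF assms(2,1)] inv_const])
      (simp_all add: bij_imp_bij_inv bij_is_surj)
  have from_F: "z \<circ> \<psi> \<in> P1" if "z \<in> places \<iota>" for z
    using that assms(1) unfolding P1_def by (intro places_comp[OF assms(2,3)]) (simp_all add: bij_is_surj)
  have roundtrip: "(z \<circ> \<psi>) \<circ> inv \<psi> = z" for z :: "'f \<Rightarrow> int"
    by (simp add: fun_eq_iff inv)
  show P1: "(\<lambda>z. z \<circ> inv \<psi>) ` P1 = places \<iota>"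
  proof (intro equalityI subsetI)
    fix z assume "z \<in> places \<iota>"
    then show "z \<in> (\<lambda>z. z \<circ> inv \<psi>) ` P1"
      using from_F roundtrip by (metis (no_types, lifting) image_eqI)
  qed (use to_F in blast)
  show "(\<lambda>z. z \<circ> inv \<psi>) ` A1 = {z \<in> places \<iota>. z (\<psi> (Fract [:0, 1:] 1)) \<ge> 0}"
  proof (intro equalityI subsetI)
    fix z assume "z \<in> (\<lambda>z. z \<circ> inv \<psi>) ` A1"
    then obtain w where w: "w \<in> P1" "w (Fract [:0, 1:] 1) \<ge> 0" "z = w \<circ> inv \<psi>"
      unfolding A1_eq_integral by blast
    then show "z \<in> {z \<in> places \<iota>. z (\<psi> (Fract [:0, 1:] 1)) \<ge> 0}"
      using to_F by (simp add: inv)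
  next
    fix z assume z: "z \<in> {z \<in> places \<iota>. z (\<psi> (Fract [:0, 1:] 1)) \<ge> 0}"
    then have "z \<circ> \<psi> \<in> A1"
      unfolding A1_eq_integral using from_F by simp
    then show "z \<in> (\<lambda>z. z \<circ> inv \<psi>) ` A1"
      using roundtrip by (metis (no_types, lifting) image_eqI)
  qed
qed

lemma isomorphism_coordinate:
  fixes \<iota> :: "'k::field \<Rightarrow> 'f::field" and \<psi> :: "'k poly fract \<Rightarrow> 'f"
  assumes \<iota>: "field_embedding \<iota>" and "bij \<psi>" "field_embedding \<psi>" "\<And>c. \<psi> (ratfun_const c) = \<iota> c"
  shows "\<psi> (Fract p 1) = coefficient_hom.eval_at \<iota> (\<psi> (Fract [:0, 1:] 1)) p"
    and "coordinate \<iota> (\<psi> (Fract [:0, 1:] 1))"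
proof -
  interpret coefficient_hom \<iota>
    by (rule coefficient_hom_embedding[OF \<iota>])
  let ?x = "\<psi> (Fract [:0, 1:] 1)"
  have hom: "\<psi> (f + g) = \<psi> f + \<psi> g" "\<psi> (f * g) = \<psi> f * \<psi> g" "\<psi> 1 = 1" for f g
    using assms(3) by (simp_all add: field_embedding_def)
  have zero: "\<psi> f = 0 \<longleftrightarrow> f = 0" for f
    by (rule embedding_eq_0_iff[OF assms(3)])
  show eval: "\<psi> (Fract p 1) = eval_at ?x p" for p
  proof (induction p)
    case 0
    then show ?case
      using zero[of 0] by (simp add: Zero_fract_def)
  next
    case (pCons c p)
    show ?case
      unfolding Fract_pCons[of c p] eval_at_pCons hom assms(4) pCons.IH ..
  qed
  have fr: "Fract p 1 = 0 \<longleftrightarrow> p = 0" for p :: "'k poly"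
    by (simp add: Zero_fract_def eq_fract)
  have "transcendental_elt \<iota> ?x"
    using eval zero fr unfolding transcendental_elt_def eval_at_def by metis
  moreover have "y \<in> simple_ext \<iota> ?x" for y
  proof -
    obtain f where f: "y = \<psi> f"
      using assms(2) by (metis bij_pointE)
    obtain p r where pr: "f = Fract p r" "r \<noteq> 0"
      by (cases f) auto
    have "Fract p 1 = f * Fract r 1"
      using pr by (simp add: eq_fract)
    then have "eval_at ?x p = y * eval_at ?x r"
      unfolding eval[symmetric] f by (simp add: hom(2)[symmetric] del: mult_fract)
    moreover have "eval_at ?x r \<noteq> 0"
      using pr(2) zero fr by (simp add: eval[symmetric])
    ultimately show ?thesis
      unfolding simple_ext_eval[OF \<iota>] by (intro exI[of _ p] exI[of _ r]) simp
  qed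
  ultimately show "coordinate \<iota> ?x"
    by (auto simp: coordinate_def)
qed

locale pdiv_lnd =
  fixes \<iota> :: "'k::{alg_closed_field, field_char_0} \<Rightarrow> 'f::field"
    and C :: "('f \<Rightarrow> int) set"
    and n :: nat
    and \<sigma> :: "(nat \<Rightarrow> rat) set"
    and D :: "('f \<Rightarrow> int) \<Rightarrow> (nat \<Rightarrow> rat) set"
    and \<delta> :: "((nat \<Rightarrow> int) \<Rightarrow>\<^sub>0 'f) \<Rightarrow> ((nat \<Rightarrow> int) \<Rightarrow>\<^sub>0 'f)"
  assumes curve: "smooth_curve \<iota> C"
    and cone: "polyhedral_cone n \<sigma>" "strongly_convex \<sigma>"
    and proper: "proper_pdiv \<iota> n \<sigma> C D"
    and lnd: "lnd_on (group_alg_const \<iota>) (pdiv_algebra n \<sigma> C D) \<delta>"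
    and degree_zero: "homogeneous_of_degree (pdiv_algebra n \<sigma> C D) \<delta> 0"
    and horizontal: "horizontal \<iota> n (pdiv_algebra n \<sigma> C D) \<delta>"
begin

abbreviation "S \<equiv> dual_lattice n \<sigma>"
abbreviation "P \<equiv> pdiv_piece n C D"
abbreviation "A \<equiv> pdiv_algebra n \<sigma> C D"

definition d :: "(nat \<Rightarrow> int) \<Rightarrow> 'f \<Rightarrow> 'f" where
  "d m f = lookup (\<delta> (single m f)) m"

lemma field_embedding: "field_embedding \<iota>"
  using curve by (simp add: smooth_curve_def function_field_def)

lemma C_places: "z \<in> C \<Longrightarrow> z \<in> places \<iota>"
  using curve by (auto simp: smooth_curve_def)

lemma tailed: "z \<in> C \<Longrightarrow> tailed n \<sigma> (D z)"
  and finite_support: "finite {z \<in> C. D z \<noteq> \<sigma>}"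
  using proper by (auto simp: proper_pdiv_def polyhedral_divisor_def)

lemma convex: "convex_cone \<sigma>"
  by (rule polyhedral_cone_convex(1)[OF cone(1)])

lemma zero_in_P: "0 \<in> P m"
  by (simp add: pdiv_piece_def)

lemma single_in_A: "m \<in> S \<Longrightarrow> single m f \<in> A \<longleftrightarrow> f \<in> P m"
  by (auto simp: pdiv_algebra_def lookup_single when_def zero_in_P split: if_splits)

lemma lookup_in_P: "a \<in> A \<Longrightarrow> m \<in> S \<Longrightarrow> lookup a m \<in> P m"
  by (simp add: pdiv_algebra_def)

lemma keys_A: "a \<in> A \<Longrightarrow> keys a \<subseteq> S"
  by (simp add: pdiv_algebra_def)

lemma derivation:
  "a \<in> A \<Longrightarrow> \<delta> a \<in> A" "a \<in> A \<Longrightarrow> b \<in> A \<Longrightarrow> \<delta> (a + b) = \<delta> a + \<delta> b"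
  "a \<in> A \<Longrightarrow> \<delta> (group_alg_const \<iota> c * a) = group_alg_const \<iota> c * \<delta> a"
  "a \<in> A \<Longrightarrow> b \<in> A \<Longrightarrow> \<delta> (a * b) = \<delta> a * b + a * \<delta> b"
  using lnd by (simp_all add: lnd_on_def derivation_on_def)

lemma \<delta>_single:
  assumes "m \<in> S" "f \<in> P m"
  shows "\<delta> (single m f) = single m (d m f)"
proof -
  obtain g where "\<delta> (single m f) = single (m + 0) g"
    using degree_zero assms single_in_A unfolding homogeneous_of_degree_def by blast
  then have "\<delta> (single m f) = single m g"
    by simp
  then show ?thesis
    by (simp add: d_def)
qed

sublocale graded_lnd \<iota> S P d
proof
  show "field_embedding \<iota>"
    by (rule field_embedding)
  show "0 \<in> S"
    by (rule dual_lattice_closed)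
  show S_add: "m + m' \<in> S" if "m \<in> S" "m' \<in> S" for m m'
    using that by (rule dual_lattice_closed)
  show P_add: "f + g \<in> P m" if "m \<in> S" "f \<in> P m" "g \<in> P m" for m f g
  proof (cases "f = 0 \<or> g = 0 \<or> f + g = 0")
    case False
    have "of_int (z (f + g)) + support_fun n (D z) m \<ge> 0" if z: "z \<in> C" for z
    proof -
      have "z (f + g) \<ge> min (z f) (z g)"
        using False by (intro place_add[OF C_places[OF z]]) auto
      then have "z (f + g) \<ge> z f \<or> z (f + g) \<ge> z g"
        by linarith
      then have "of_int (z f) \<le> (of_int (z (f + g)) :: rat) \<or> of_int (z g) \<le> (of_int (z (f + g)) :: rat)"
        by simp
      moreover have "of_int (z f) + support_fun n (D z) m \<ge> 0" "of_int (z g) + support_fun n (D z) m \<ge> 0"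
        using \<open>f \<in> P m\<close> \<open>g \<in> P m\<close> False z by (auto simp: pdiv_piece_def)
      ultimately show ?thesis
        by linarith
    qed
    then show ?thesis
      by (simp add: pdiv_piece_def)
  qed (use that zero_in_P in auto)
  show P_smult: "\<iota> c * f \<in> P m" if "m \<in> S" "f \<in> P m" for m f c
  proof (cases "\<iota> c = 0 \<or> f = 0")
    case False
    then have same: "z (\<iota> c * f) = z f" if "z \<in> C" for z
      using place_mult[OF C_places[OF that], of "\<iota> c" f] place_const[OF C_places[OF that] field_embedding] by simp
    have "of_int (z (\<iota> c * f)) + support_fun n (D z) m \<ge> 0" if "z \<in> C" for z
      unfolding same[OF that] using \<open>f \<in> P m\<close> False that by (simp add: pdiv_piece_def)
    then show ?thesis
      by (simp add: pdiv_piece_def)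
  qed (use zero_in_P in auto)
  show P_mult: "f * g \<in> P (m + m')" if m: "m \<in> S" "m' \<in> S" and fg: "f \<in> P m" "g \<in> P m'" for m m' f g
  proof (cases "f = 0 \<or> g = 0")
    case False
    have "of_int (z (f * g)) + support_fun n (D z) (m + m') \<ge> 0" if z: "z \<in> C" for z
    proof -
      have "z (f * g) = z f + z g"
        using False by (intro place_mult[OF C_places[OF z]]) auto
      then have "of_int (z (f * g)) = of_int (z f) + (of_int (z g) :: rat)"
        by simp
      moreover have "of_int (z f) + support_fun n (D z) m \<ge> 0" "of_int (z g) + support_fun n (D z) m' \<ge> 0"
        using fg False z by (auto simp: pdiv_piece_def)
      ultimately show ?thesis
        using support_fun_superadditive[OF tailed[OF z] convex m] by linarith
    qed
    then show ?thesis
      by (simp add: pdiv_piece_def)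
  qed (use zero_in_P in auto)
  show "1 \<in> P 0"
  proof -
    have "of_int (z 1) + support_fun n (D z) 0 \<ge> 0" if z: "z \<in> C" for z
      unfolding place_one[OF C_places[OF z]] support_fun_zero[OF tailed[OF z] convex] by simp
    then show ?thesis
      by (simp add: pdiv_piece_def)
  qed
  show d_mem: "d m f \<in> P m" if "m \<in> S" "f \<in> P m" for m f
    using derivation(1)[of "single m f"] that by (simp add: \<delta>_single single_in_A)
  show "d m (f + g) = d m f + d m g" if "m \<in> S" "f \<in> P m" "g \<in> P m" for m f g
    using derivation(2)[of "single m f" "single m g"] that
    by (simp add: d_def single_in_A single_add lookup_add)
  show "d m (\<iota> c * f) = \<iota> c * d m f" if "m \<in> S" "f \<in> P m" for m f c
  proof -
    have "\<delta> (single m (\<iota> c * f)) = single m (\<iota> c * d m f)"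
      using derivation(3)[of "single m f" c] that
      by (simp add: \<delta>_single single_in_A group_alg_const_def mult_single)
    then show ?thesis
      by (simp add: d_def)
  qed
  show "d (m + m') (f * g) = d m f * g + f * d m' g"
    if "m \<in> S" "m' \<in> S" "f \<in> P m" "g \<in> P m'" for m m' f g
  proof -
    have "\<delta> (single (m + m') (f * g)) = single (m + m') (d m f * g + f * d m' g)"
      using derivation(4)[of "single m f" "single m' g"] that
      by (simp add: \<delta>_single single_in_A mult_single single_add)
    then show ?thesis
      by (simp add: d_def)
  qed
  show "\<exists>k. (d m ^^ k) f = 0" if m: "m \<in> S" and f: "f \<in> P m" for m f
  proof -
    have iter: "(d m ^^ k) f \<in> P m \<and> (\<delta> ^^ k) (single m f) = single m ((d m ^^ k) f)" for k
      by (induction k) (simp_all add: f d_mem m \<delta>_single)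
    obtain k where "(\<delta> ^^ k) (single m f) = 0"
      using lnd single_in_A[OF m] f by (auto simp: lnd_on_def)
    then have "lookup (single m ((d m ^^ k) f)) m = 0"
      using iter[of k] by (metis lookup_zero)
    then show ?thesis
      by (intro exI[of _ k]) simp
  qed
qed

lemma A_add: "a \<in> A \<Longrightarrow> b \<in> A \<Longrightarrow> a + b \<in> A"
  using Poly_Mapping.keys_add[of a b] by (auto simp: pdiv_algebra_def lookup_add P_add)

lemma A_zero: "0 \<in> A"
  by (simp add: pdiv_algebra_def zero_in_P)

lemma \<delta>_zero: "\<delta> 0 = 0"
  using derivation(2)[OF A_zero A_zero] by simp

lemma \<delta>_expand:
  assumes "a \<in> A"
  shows "\<delta> a = (\<Sum>m\<in>keys a. single m (d m (lookup a m)))"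
proof -
  let ?f = "\<lambda>m. single m (lookup a m)"
  have mem: "?f m \<in> A" "\<delta> (?f m) = single m (d m (lookup a m))" if "m \<in> S" for m
    using lookup_in_P[OF assms that] that by (simp_all add: single_in_A \<delta>_single)
  have "(\<Sum>m\<in>K. ?f m) \<in> A \<and> \<delta> (\<Sum>m\<in>K. ?f m) = (\<Sum>m\<in>K. single m (d m (lookup a m)))"
    if "finite K" "K \<subseteq> S" for K
    using that
  proof (induction K rule: finite_induct)
    case (insert m K)
    then show ?case
      using mem[of m] by (simp add: A_add derivation(2))
  qed (simp add: A_zero \<delta>_zero)
  from this[OF finite_keys keys_A[OF assms]] show ?thesis
    using poly_mapping_expand[of a] by simp
qed

text \<open>
  An invariant quotient \<open>a / b\<close> has proportional coefficients, so it is a quotient of elements of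
  any single piece in which \<open>b\<close> is nonzero; if all these had derivative zero, so would \<open>a / b\<close>.
\<close>

lemma horizontal_piece:
  obtains m f g where "m \<in> S" "f \<in> P m" "g \<in> P m" "d m f * g \<noteq> f * d m g"
proof (rule ccontr)
  assume contra: "\<not> thesis"
  note result = that
  have all: "d m f * g = f * d m g" if "m \<in> S" "f \<in> P m" "g \<in> P m" for m f g
    using contra result[OF that] by blast
  obtain a b where ab: "a \<in> A" "b \<in> A" "b \<noteq> 0"
      "\<And>t. t \<in> torus n \<Longrightarrow> torus_act \<iota> n t a * b = a * torus_act \<iota> n t b" "\<delta> a * b \<noteq> a * \<delta> b"
    using horizontal unfolding horizontal_def by blast
  let ?a = "lookup a" and ?b = "lookup b"
  have "S \<subseteq> int_lattice n"
    by (auto simp: dual_lattice_def)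
  then have proportional: "?a m * ?b m' = ?a m' * ?b m" for m m'
    using invariant_quotient_proportional[OF field_embedding _ _ ab(4)] keys_A ab(1,2) by blast
  obtain m0 where m0: "?b m0 \<noteq> 0"
    using ab(3) by (metis lookup_zero poly_mapping_eqI)
  define x where "x = ?a m0 / ?b m0"
  have ax: "?a m = x * ?b m" for m
    using proportional[of m m0] m0 by (simp add: x_def field_simps)
  have keys: "keys a \<subseteq> keys b"
    by (auto simp: in_keys_iff ax)
  have scale: "single 0 x * c = (\<Sum>m\<in>keys b. single m (x * lookup c m))"
    if "keys c \<subseteq> keys b" for c
  proof -
    have "c = (\<Sum>m\<in>keys b. single m (lookup c m))"
      by (subst poly_mapping_expand[of c], rule sum.mono_neutral_left) (use that in \<open>auto simp: in_keys_iff\<close>)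
    then have "single 0 x * c =
        single 0 x * (\<Sum>m\<in>keys b. single m (lookup c m))"
      by simp
    then show ?thesis
      by (simp add: sum_distrib_left mult_single)
  qed
  have a_eq: "a = single 0 x * b"
  proof -
    have "a = (\<Sum>m\<in>keys b. single m (?a m))"
      by (subst poly_mapping_expand[of a], rule sum.mono_neutral_left) (use keys in \<open>auto simp: in_keys_iff\<close>)
    then show ?thesis
      by (simp add: scale ax)
  qed
  have da: "d m (?a m) = x * d m (?b m)" if "m \<in> S" for m
  proof (cases "?b m = 0")
    case True
    then show ?thesis
      using d_zero[OF that zero_in_P] by (simp add: ax)
  next
    case False
    have "d m (?a m) * ?b m = ?a m * d m (?b m)"
      using that lookup_in_P ab(1,2) by (intro all) auto
    then have "d m (?a m) * ?b m = (x * d m (?b m)) * ?b m"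
      by (simp add: ax mult_ac)
    then show ?thesis
      using False by simp
  qed
  have "\<delta> a = single 0 x * \<delta> b"
  proof -
    have "\<delta> a = (\<Sum>m\<in>keys b. single m (d m (?a m)))"
      unfolding \<delta>_expand[OF ab(1)]
      by (rule sum.mono_neutral_left) (use keys keys_A[OF ab(2)] d_zero[OF _ zero_in_P] in \<open>auto simp: in_keys_iff\<close>)
    also have "\<dots> = (\<Sum>m\<in>keys b. single m (x * d m (?b m)))"
      using keys_A[OF ab(2)] da by (intro sum.cong refl) auto
    also have "\<dots> = single 0 x * \<delta> b"
      unfolding \<delta>_expand[OF ab(2)] by (simp add: sum_distrib_left mult_single)
    finally show ?thesis .
  qed
  then have "\<delta> a * b = a * \<delta> b"
    by (simp add: a_eq mult_ac)
  then show False
    using ab(5) by contradiction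
qed

text \<open>
  Horizontality enters here: it makes the derivation of the field nonzero, so that a slice exists.
\<close>

lemma slice:
  assumes "coordinate \<iota> x" "m \<in> S" "u \<noteq> 0" "u \<in> P m" "x * u \<in> P m"
  obtains q f where "coordinate \<iota> q" "E q = 1" "f \<noteq> 0" "f \<in> P m" "q * f \<in> P m" "d m f = 0"
    "\<And>v. v \<in> P m \<Longrightarrow> \<exists>p. v = f * eval_at q p" "\<And>y. \<exists>m f. denominator y m f"
proof -
  have full: "\<exists>m f. denominator y m f" for y
    by (rule denominators_exist[OF assms])
  interpret graded_lnd_full \<iota> S P d
    by unfold_locales (rule full)
  obtain m1 f1 g1 where "m1 \<in> S" "f1 \<in> P m1" "g1 \<in> P m1" "d m1 f1 * g1 \<noteq> f1 * d m1 g1"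
    by (rule horizontal_piece)
  then obtain y0 where "E y0 \<noteq> 0"
    by (rule E_nonzero)
  from slice_coordinate[OF assms(1) this assms(2-5)] show thesis
    using that full by metis
qed

end

text \<open>The divisor seen through an identification of its function field with \<open>\<bbbK>(t)\<close>.\<close>

locale pdiv_chart = pdiv_lnd +
  fixes q :: 'b and \<psi> :: "'a poly fract \<Rightarrow> 'b"
  assumes \<psi>: "bij \<psi>" "field_embedding \<psi>" "\<psi> (ratfun_const c) = \<iota> c" "\<psi> (Fract p 1) = eval_at q p"
    and A1_subset: "(\<lambda>z. z \<circ> inv \<psi>) ` A1 \<subseteq> C"
begin

definition h :: "'a \<Rightarrow> (nat \<Rightarrow> int) \<Rightarrow> rat" where
  "h a m = support_fun n (D (ord_at a \<circ> inv \<psi>)) m"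

definition B :: "'a set" where
  "B = {a. D (ord_at a \<circ> inv \<psi>) \<noteq> \<sigma>}"

text \<open>
  The function whose orders on the affine line are the least ones that the divisor admits.
\<close>

definition u :: "(nat \<Rightarrow> int) \<Rightarrow> 'b" where
  "u m = \<psi> (ratfun_with_orders (\<lambda>a. - \<lfloor>h a m\<rfloor>))"

lemma point_in_C: "ord_at a \<circ> inv \<psi> \<in> C"
  using A1_subset unfolding A1_eq by blast

lemma comp_inv_inj:
  assumes "z \<circ> inv \<psi> = z' \<circ> inv \<psi>"
  shows "z = z'"
proof
  fix f
  show "z f = z' f"
    using fun_cong[OF assms, of "\<psi> f"] \<psi>(1) by (simp add: bij_is_inj inv_f_f)
qed

lemma inj_points: "inj (\<lambda>a. ord_at a \<circ> inv \<psi>)"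
  by (rule injI) (metis comp_inv_inj injD[OF inj_ord_at])

lemma finite_B: "finite B"
proof -
  have "(\<lambda>a. ord_at a \<circ> inv \<psi>) ` B \<subseteq> {z \<in> C. D z \<noteq> \<sigma>}"
    using point_in_C by (auto simp: B_def)
  then show ?thesis
    using finite_support inj_points by (meson finite_imageD finite_subset inj_on_subset subset_UNIV)
qed

lemma h_outside_B: "a \<notin> B \<Longrightarrow> m \<in> S \<Longrightarrow> h a m = 0"
  by (simp add: B_def h_def support_fun_tail_cone[OF convex])

lemma floor_support: "m \<in> S \<Longrightarrow> {a. \<lfloor>h a m\<rfloor> \<noteq> 0} \<subseteq> B"
  using h_outside_B by force

lemma finite_floor: "m \<in> S \<Longrightarrow> finite {a. \<lfloor>h a m\<rfloor> \<noteq> 0}"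
  using floor_support finite_B finite_subset by blast

lemma h_superadditive: "m \<in> S \<Longrightarrow> m' \<in> S \<Longrightarrow> h a m + h a m' \<le> h a (m + m')"
  unfolding h_def by (rule support_fun_superadditive[OF tailed[OF point_in_C] convex])

lemma h_multiple: "m \<in> S \<Longrightarrow> k \<ge> 0 \<Longrightarrow> h a (\<lambda>i. k * m i) = of_int k * h a m"
  unfolding h_def by (rule support_fun_multiple[OF tailed[OF point_in_C] convex])

lemma h_zero: "h a 0 = 0"
  unfolding h_def by (rule support_fun_zero[OF tailed[OF point_in_C] convex])

lemma \<psi>_mult: "\<psi> (f * g) = \<psi> f * \<psi> g" and \<psi>_one: "\<psi> 1 = 1"
  using \<psi>(2) by (simp_all add: field_embedding_def)

lemma inv_\<psi>: "inv \<psi> (\<psi> f) = f"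
  using \<psi>(1) by (simp add: bij_is_inj inv_f_f)

lemma u_nonzero: "m \<in> S \<Longrightarrow> u m \<noteq> 0"
  unfolding u_def using embedding_eq_0_iff[OF \<psi>(2)] finite_floor
    ratfun_with_orders_nonzero[of "\<lambda>a. - \<lfloor>h a m\<rfloor>"] by simp

lemma u_zero: "u 0 = 1"
  by (simp add: u_def h_zero ratfun_with_orders_zero \<psi>_one)

lemma u_add:
  assumes "m \<in> S" "m' \<in> S" "\<And>a. \<lfloor>h a (m + m')\<rfloor> = \<lfloor>h a m\<rfloor> + \<lfloor>h a m'\<rfloor>"
  shows "u (m + m') = u m * u m'"
proof -
  have "ratfun_with_orders (\<lambda>a. - \<lfloor>h a m\<rfloor> + - \<lfloor>h a m'\<rfloor>) =
      ratfun_with_orders (\<lambda>a. - \<lfloor>h a m\<rfloor>) * ratfun_with_orders (\<lambda>a. - \<lfloor>h a m'\<rfloor>)"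
    using finite_floor assms(1,2) by (intro ratfun_with_orders_add) simp_all
  moreover have "(\<lambda>a. - \<lfloor>h a (m + m')\<rfloor>) = (\<lambda>a. - \<lfloor>h a m\<rfloor> + - \<lfloor>h a m'\<rfloor>)"
    using assms(3) by simp
  ultimately show ?thesis
    unfolding u_def \<psi>_mult[symmetric] by simp
qed

lemma order_u: "m \<in> S \<Longrightarrow> (ord_at a \<circ> inv \<psi>) (u m) = - \<lfloor>h a m\<rfloor>"
  unfolding u_def using finite_floor by (simp add: inv_\<psi> ord_at_ratfun_with_orders)

text \<open>
  Constants have order zero at every point, so it suffices that the generators multiply up to a
  constant.
\<close>

lemma floor_additive:
  assumes m: "m \<in> S" "m' \<in> S" and eq: "u m * u m' = u (m + m') * \<iota> c"
  shows "\<lfloor>h a (m + m')\<rfloor> = \<lfloor>h a m\<rfloor> + \<lfloor>h a m'\<rfloor>"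
proof -
  note z = C_places[OF point_in_C[of a]]
  have "\<iota> c \<noteq> 0"
    using eq u_nonzero m by auto
  then have "(ord_at a \<circ> inv \<psi>) (u (m + m') * \<iota> c) = - \<lfloor>h a (m + m')\<rfloor>"
    using place_mult[OF z u_nonzero[OF S_add[OF m]], of "\<iota> c"] place_const[OF z field_embedding, of c]
      order_u[OF S_add[OF m], of a] by linarith
  moreover have "(ord_at a \<circ> inv \<psi>) (u m * u m') = - \<lfloor>h a m\<rfloor> + - \<lfloor>h a m'\<rfloor>"
    using place_mult[OF z u_nonzero u_nonzero, OF m] order_u[of m a] order_u[of m' a] m by linarith
  ultimately show ?thesis
    unfolding eq by linarith
qed

text \<open>
  The sum of points at which the minima are attained is a point of the degree, hence of \<open>\<sigma>\<close>,
  where \<open>m\<close> is nonnegative.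
\<close>

lemma support_functions_of_degree:
  assumes C: "C = (\<lambda>z. z \<circ> inv \<psi>) ` P1" and deg: "pdiv_degree \<sigma> C D \<subseteq> \<sigma>" and m: "m \<in> S"
  shows "(\<Sum>a\<in>B. h a m) + support_fun n (D (P1_infinity \<circ> inv \<psi>)) m \<ge> 0"
proof -
  let ?r = "\<lambda>z. support_fun n (D z) m"
  let ?Z = "{z \<in> C. D z \<noteq> \<sigma>}" and ?inf = "P1_infinity \<circ> inv \<psi>"
  let ?pt = "\<lambda>a. ord_at a \<circ> inv \<psi>"
  have "\<exists>p. p \<in> D z \<and> ?r z = pairing n p m" if "z \<in> C" for z
    using support_fun_attained[OF tailed[OF that] convex m] by metis
  then obtain p where p: "\<And>z. z \<in> C \<Longrightarrow> p z \<in> D z \<and> ?r z = pairing n (p z) m"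
    by metis
  have "sum p ?Z \<in> sum D ?Z"
    unfolding set_sum_alt[OF finite_support] using p by blast
  then have "sum p ?Z + 0 \<in> pdiv_degree \<sigma> C D"
    unfolding pdiv_degree_def using convex_coneD(1)[OF convex] by (rule set_plus_intro)
  then have "pairing n (sum p ?Z + 0) m \<ge> 0"
    using deg m by (auto simp only: dual_lattice_def mem_Collect_eq)
  moreover have "pairing n (sum p K) m = (\<Sum>z\<in>K. pairing n (p z) m)" for K
    by (induction K rule: infinite_finite_induct)
      (simp_all only: sum.infinite sum.empty sum.insert pairing_zero pairing_add_left not_False_eq_True)
  moreover have "(\<Sum>z\<in>?Z. pairing n (p z) m) = (\<Sum>z\<in>?Z. ?r z)"
    using p by (intro sum.cong) auto
  ultimately have "(\<Sum>z\<in>?Z. ?r z) \<ge> 0"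
    by (simp only: add_0_right)
  also have "(\<Sum>z\<in>?Z. ?r z) = (\<Sum>z\<in>insert ?inf (?pt ` B). ?r z)"
  proof (rule sum.mono_neutral_left)
    show "finite (insert ?inf (?pt ` B))"
      using finite_B by simp
    show "?Z \<subseteq> insert ?inf (?pt ` B)"
      unfolding C P1_eq by (auto simp: B_def)
    show "\<forall>z\<in>insert ?inf (?pt ` B) - ?Z. ?r z = 0"
    proof
      fix z assume z: "z \<in> insert ?inf (?pt ` B) - ?Z"
      then have "z \<in> C"
        unfolding C P1_eq by auto
      then have "D z = \<sigma>"
        using z by blast
      then show "?r z = 0"
        using support_fun_tail_cone[OF convex m] by simp
    qed
  qed
  also have "\<dots> = ?r ?inf + (\<Sum>z\<in>?pt ` B. ?r z)"
  proof (rule sum.insert)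
    show "?inf \<notin> ?pt ` B"
      using comp_inv_inj ord_at_neq_P1_infinity by (metis (no_types, lifting) imageE)
  qed (use finite_B in simp)
  also have "(\<Sum>z\<in>?pt ` B. ?r z) = (\<Sum>a\<in>B. h a m)"
    using inj_points by (subst sum.reindex) (auto simp: h_def intro: inj_on_subset)
  finally show ?thesis
    by (simp only: add.commute)
qed

end

text \<open>A chart in whose coordinate the derivation is the ordinary derivative.\<close>

locale pdiv_lnd_coordinate = pdiv_chart +
  assumes full: "\<exists>m f. denominator y m f" and q: "coordinate \<iota> q" "E q = 1"
begin

sublocale graded_lnd_coordinate \<iota> S P d q
  by unfold_locales (use full q in auto)

text \<open>
  \<open>R\<close> stands for degrees whose piece contains its generator \<open>u m\<close>; over the projective line
  these are only the degrees with a nonzero piece. The derivation kills these generators, so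
  their products are generators again, up to constants.
\<close>

lemma generators_multiply:
  assumes gen: "\<And>m. m \<in> R \<Longrightarrow> m \<in> S \<and> u m \<in> P m" "\<And>m f. m \<in> R \<Longrightarrow> f \<in> P m \<Longrightarrow> \<exists>p. f = u m * ev p"
    and m: "m \<in> R" "m' \<in> R" "m + m' \<in> R"
  shows "\<lfloor>h a (m + m')\<rfloor> = \<lfloor>h a m\<rfloor> + \<lfloor>h a m'\<rfloor>"
proof -
  have kill: "d l (u l) = 0" if "l \<in> R" for l
    using gen that u_nonzero by (intro generator_in_kernel) auto
  obtain c where "u m * u m' = u (m + m') * \<iota> c"
    using product_of_generators[of m m' "u m" "u m'" "u (m + m')"] gen kill m u_nonzero S_add by metis
  then show ?thesis
    using floor_additive gen m by blast
qed

end

section \<open>The affine line\<close>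

context pdiv_lnd
begin

lemma curve_iso_chart:
  assumes "curve_iso \<iota> C ratfun_const C'"
  obtains \<psi> where "bij \<psi>" "field_embedding \<psi>" "\<And>c. \<psi> (ratfun_const c) = \<iota> c"
    "C = (\<lambda>z. z \<circ> inv \<psi>) ` C'"
proof -
  obtain \<phi> where \<phi>: "bij \<phi>" "field_embedding \<phi>" "\<And>c. \<phi> (\<iota> c) = ratfun_const c" "C = (\<lambda>z. z \<circ> \<phi>) ` C'"
    using assms unfolding curve_iso_def by blast
  show thesis
  proof
    show "bij (inv \<phi>)" "field_embedding (inv \<phi>)"
      using \<phi> by (simp_all add: bij_imp_bij_inv field_embedding_inv)
    show "inv \<phi> (ratfun_const c) = \<iota> c" for c
      using \<phi>(1) by (simp add: \<phi>(3)[symmetric] bij_is_inj inv_f_f)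
    show "C = (\<lambda>z. z \<circ> inv (inv \<phi>)) ` C'"
      using \<phi>(1,4) by (simp add: inv_inv_eq)
  qed
qed

lemma P_zero_iff: "f \<in> P 0 \<longleftrightarrow> f = 0 \<or> (\<forall>z\<in>C. z f \<ge> 0)"
  using support_fun_zero[OF tailed convex] by (simp add: pdiv_piece_def)

lemma d_one: "d 0 1 = 0"
proof -
  have "d 0 1 = d 0 1 + d 0 1"
    using d_mult[OF S_zero S_zero P_one P_one] by (simp only: add_0_right mult_1_right mult_1_left)
  then show ?thesis
    by (simp only: add_cancel_right_right)
qed

text \<open>
  Over the affine line the slice can be taken in the invariant functions themselves. They are the
  polynomials in the old coordinate \<open>x\<close> as well as in the new one \<open>q\<close>, so the new coordinate
  has the same pole.
\<close>

lemma affine_coordinate: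
  assumes "curve_iso \<iota> C ratfun_const A1"
  obtains q \<psi> where "pdiv_lnd_coordinate \<iota> C n \<sigma> D \<delta> q \<psi>" "C = (\<lambda>z. z \<circ> inv \<psi>) ` A1"
proof -
  obtain \<psi>0 where \<psi>0: "bij \<psi>0" "field_embedding \<psi>0" "\<And>c. \<psi>0 (ratfun_const c) = \<iota> c"
      "C = (\<lambda>z. z \<circ> inv \<psi>0) ` A1"
    by (rule curve_iso_chart[OF assms]) (rule that, assumption, assumption, blast+)
  define x where "x = \<psi>0 (Fract [:0, 1:] 1)"
  have x: "coordinate \<iota> x"
    unfolding x_def by (rule isomorphism_coordinate(2)[OF field_embedding \<psi>0(1-3)])
  have C: "C = {z \<in> places \<iota>. z x \<ge> 0}"
    unfolding \<psi>0(4) x_def by (rule places_isomorphic(2)[OF \<psi>0(1-3)])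
  have xP: "x * 1 \<in> P 0"
    unfolding P_zero_iff using C by simp
  obtain q f where q: "coordinate \<iota> q" "E q = 1" and f: "f \<noteq> 0" "f \<in> P 0" "q * f \<in> P 0" "d 0 f = 0"
    and gen: "\<And>v. v \<in> P 0 \<Longrightarrow> \<exists>p. v = f * eval_at q p" and full: "\<And>y. \<exists>m f. denominator y m f"
    by (rule slice[OF x S_zero one_neq_zero P_one xP]) (rule that, assumption, assumption, blast+)
  interpret F: graded_lnd_full \<iota> S P d
    by unfold_locales (rule full)
  have "E f = 0"
    using F.d_quotient[OF S_zero P_one, of f] f by (simp add: d_one)
  then obtain c where c: "f = \<iota> c"
    using F.E_kernel[OF q(1)] q(2) by (metis one_neq_zero)
  then have c0: "c \<noteq> 0"
    using f(1) by auto
  have "\<iota> (1 / c) * (q * f) = q"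
  proof -
    have "\<iota> (1 / c) * \<iota> c = 1"
      using c0 by (simp add: hom_mult[symmetric] hom_one)
    then show ?thesis
      unfolding c by (simp add: mult_ac)
  qed
  then have qP: "q \<in> P 0"
    using P_smult[OF S_zero f(3), of "1 / c"] by (simp only:)
  obtain p where "x = f * eval_at q p"
    using gen[of x] xP by auto
  then have xq: "x = eval_at q (smult c p)"
    by (simp add: c eval_at_smult)
  have C': "C = {z \<in> places \<iota>. z q \<ge> 0}"
  proof (intro equalityI subsetI)
    fix z assume z: "z \<in> C"
    then have "z q \<ge> 0"
      using qP place_zero[OF C_places[OF z]] unfolding P_zero_iff by auto
    then show "z \<in> {z \<in> places \<iota>. z q \<ge> 0}"
      using C_places[OF z] by simp
  next
    fix z assume "z \<in> {z \<in> places \<iota>. z q \<ge> 0}"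
    then show "z \<in> C"
      using place_eval_nonneg[OF field_embedding, of z q "smult c p"] by (simp add: C xq)
  qed
  obtain \<psi> where \<psi>: "bij \<psi>" "field_embedding \<psi>" "\<And>c. \<psi> (ratfun_const c) = \<iota> c"
      "\<And>p. \<psi> (Fract p 1) = eval_at q p"
    by (rule coordinate_isomorphism[OF field_embedding q(1)]) (rule that, assumption, assumption, blast+)
  have img: "C = (\<lambda>z. z \<circ> inv \<psi>) ` A1"
    unfolding places_isomorphic(2)[OF \<psi>(1-3)] \<psi>(4) eval_at_var by (rule C')
  have "pdiv_lnd_coordinate \<iota> C n \<sigma> D \<delta> q \<psi>"
    by unfold_locales (use \<psi> q full img in auto)
  then show thesis
    using that img by blast
qed

text \<open>
  Every piece is \<open>u m \<bbbK>[q]\<close> with multiplicative generators \<open>u m\<close> killed by the derivation. So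
  \<open>u m\<close> behaves like the character of degree \<open>m\<close> on \<open>Y\<close>, and the derivation is \<open>d/dq\<close>, whose
  exponential is the translation of \<open>q\<close>.
\<close>

theorem affine_line_case:
  assumes "curve_iso \<iota> C ratfun_const A1"
  shows "\<exists>\<Phi>. algebra_iso (group_alg_const \<iota>) A (\<lambda>c. [:group_alg_const id c:]) (toric_times_line n \<sigma>) \<Phi> \<and>
    graded_map A (\<lambda>m. {p. \<forall>i. keys (coeff p i) \<subseteq> {m}}) \<Phi> \<and>
    (\<forall>s. \<forall>a\<in>A. \<Phi> (ga_action (group_alg_const \<iota>) \<delta> s a) = pcompose (\<Phi> a) [:group_alg_const id s, 1:])"
proof -
  obtain q \<psi> where K: "pdiv_lnd_coordinate \<iota> C n \<sigma> D \<delta> q \<psi>" and C: "C = (\<lambda>z. z \<circ> inv \<psi>) ` A1"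
    using affine_coordinate[OF assms] .
  interpret K: pdiv_lnd_coordinate \<iota> C n \<sigma> D \<delta> q \<psi>
    by (rule K)
  have pieces: "P m = {K.u m * eval_at q p | p. p \<in> UNIV}" if m: "m \<in> S" for m
    unfolding pdiv_piece_def K.u_def K.h_def
    using piece_over_A1[OF field_embedding K.\<psi>(1,2,4) C, of "\<lambda>z. support_fun n (D z) m"]
      K.finite_floor[OF m] unfolding K.h_def by simp
  have uP: "K.u m \<in> P m" if "m \<in> S" for m
    unfolding pieces[OF that] by (auto intro!: exI[of _ 1])
  have gen: "\<exists>p. f = K.u m * eval_at q p" if "m \<in> S" "f \<in> P m" for m f
    using that pieces by blast
  have floors: "\<lfloor>K.h a (m + m')\<rfloor> = \<lfloor>K.h a m\<rfloor> + \<lfloor>K.h a m'\<rfloor>" if "m \<in> S" "m' \<in> S" for a m m'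
    by (rule K.generators_multiply[of S]) (use that uP gen S_add in auto)
  interpret X: pdiv_generators S "\<lambda>_. UNIV" \<iota> q K.u n \<sigma> C D
  proof unfold_locales
    show "K.u (m + m') = K.u m * K.u m'" if "m \<in> S" "m' \<in> S" for m m'
      using that floors by (intro K.u_add)
  qed (use S_zero S_add field_embedding K.q(1) K.u_nonzero K.u_zero pieces in \<open>auto simp: coordinate_def\<close>)
  interpret Y: line_evaluation S "\<lambda>_. UNIV :: 'k poly set" n \<sigma>
    by unfold_locales auto
  have deriv: "\<delta> (single m (K.u m * eval_at q p)) = single m (K.u m * eval_at q (pderiv p))"
    if m: "m \<in> S" for m p
  proof -
    have mem: "K.u m * eval_at q p \<in> P m"
      using pieces[OF m] by blast
    have "d m (K.u m) = 0"
      using K.generator_in_kernel[OF m uP[OF m] K.u_nonzero[OF m]] gen[OF m] by blast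
    then show ?thesis
      using K.d_constant_generator[OF m uP[OF m] _ mem] \<delta>_single[OF m mem] by simp
  qed
  show ?thesis
  proof (intro exI[of _ "Y.L.R \<circ> X.T"] conjI allI ballI)
    show "algebra_iso (group_alg_const \<iota>) A (\<lambda>c. [:group_alg_const id c:]) (toric_times_line n \<sigma>) (Y.L.R \<circ> X.T)"
      by (rule algebra_iso_comp[OF X.T_iso Y.L_iso])
    show "graded_map A (\<lambda>m. {p. \<forall>i. keys (coeff p i) \<subseteq> {m}}) (Y.L.R \<circ> X.T)"
      unfolding graded_map_def
    proof (intro allI impI)
      fix m f assume "single m f \<in> A"
      then obtain p where p: "X.T (single m f) = single m p"
        by (rule X.T_single)
      have "keys (coeff (Y.L.R (single m p)) i) \<subseteq> {m}" for i
        unfolding Y.L.R_single Y.coeff_marked_eval by simp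
      then show "(Y.L.R \<circ> X.T) (single m f) \<in> {p. \<forall>i. keys (coeff p i) \<subseteq> {m}}"
        by (simp add: p)
    qed
    fix s a assume a: "a \<in> A"
    have "X.T (ga_action (group_alg_const \<iota>) \<delta> s a) = ga_action poly_const X.coeff_deriv s (X.T a)"
      using deriv by (intro X.T_ga_action lnd a) simp_all
    then show "(Y.L.R \<circ> X.T) (ga_action (group_alg_const \<iota>) \<delta> s a) =
        pcompose ((Y.L.R \<circ> X.T) a) [:group_alg_const id s, 1:]"
      by (simp add: X.ga_action_coeff_deriv Y.L_translation)
  qed
qed

section \<open>The projective line\<close>

text \<open>
  Over the projective line two functions of the same degree with nonconstant quotient force the
  rounded degree to be at least one, so some piece contains \<open>u\<close> and \<open>x u\<close>.
\<close>

lemma projective_coordinate: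
  assumes "curve_iso \<iota> C ratfun_const P1"
  obtains q \<psi> m f where "pdiv_lnd_coordinate \<iota> C n \<sigma> D \<delta> q \<psi>" "C = (\<lambda>z. z \<circ> inv \<psi>) ` P1"
    "m \<in> S" "f \<noteq> 0" "f \<in> P m" "q * f \<in> P m"
proof -
  obtain \<psi>0 where \<psi>0: "bij \<psi>0" "field_embedding \<psi>0" "\<And>c. \<psi>0 (ratfun_const c) = \<iota> c"
      "C = (\<lambda>z. z \<circ> inv \<psi>0) ` P1"
    by (rule curve_iso_chart[OF assms]) (rule that, assumption, assumption, blast+)
  define x where "x = \<psi>0 (Fract [:0, 1:] 1)"
  have x: "coordinate \<iota> x" and ev: "\<And>p. \<psi>0 (Fract p 1) = eval_at x p"
    unfolding x_def by (rule isomorphism_coordinate[OF field_embedding \<psi>0(1-3)])+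
  have C: "C = places \<iota>"
    unfolding \<psi>0(4) by (rule places_isomorphic(1)[OF \<psi>0(1-3)])
  have A1P1: "A1 \<subseteq> P1"
    by (auto simp: A1_def)
  interpret K: pdiv_chart \<iota> C n \<sigma> D \<delta> x \<psi>0
    by unfold_locales (use \<psi>0 ev A1P1 in auto)
  obtain m f g where m: "m \<in> S" and fg: "f \<in> P m" "g \<in> P m" and W: "d m f * g \<noteq> f * d m g"
    by (rule horizontal_piece)
  define N where "N = (\<Sum>a\<in>K.B. \<lfloor>K.h a m\<rfloor>) + \<lfloor>support_fun n (D (P1_infinity \<circ> inv \<psi>0)) m\<rfloor>"
  have pieces: "P m = {K.u m * eval_at x p | p. p = 0 \<or> int (degree p) \<le> N}"
    unfolding pdiv_piece_def K.u_def K.h_def N_def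
    using piece_over_P1[OF field_embedding \<psi>0(1,2) ev \<psi>0(4) K.finite_B, of "\<lambda>z. support_fun n (D z) m"]
      K.floor_support[OF m] unfolding K.h_def by simp
  have g0: "g \<noteq> 0"
    using W d_zero[OF m zero_in_P] by auto
  have "N \<ge> 1"
  proof (rule ccontr)
    assume "\<not> N \<ge> 1"
    then have const: "\<exists>c. p = [:c:]" if "p = 0 \<or> int (degree p) \<le> N" for p :: "'k poly"
      using that by (cases "p = 0") (auto intro: degree_eq_zeroE[of p])
    have "\<exists>a. y = K.u m * \<iota> a" if y: "y \<in> P m" for y
    proof -
      obtain p where p: "y = K.u m * eval_at x p" "p = 0 \<or> int (degree p) \<le> N"
        using y unfolding pieces by blast
      obtain c where "p = [:c:]"
        using const[OF p(2)] by blast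
      then show ?thesis
        using p(1) by auto
    qed
    then obtain a b where ab: "f = K.u m * \<iota> a" "g = K.u m * \<iota> b"
      using fg by metis
    then have b0: "b \<noteq> 0"
      using g0 by auto
    have "\<iota> (a / b) * \<iota> b = \<iota> a"
      using b0 by (simp add: hom_mult[symmetric])
    then have f_eq: "f = \<iota> (a / b) * g"
      by (simp add: ab mult_ac)
    have "d m f = \<iota> (a / b) * d m g"
      unfolding f_eq by (rule d_smult[OF m fg(2)])
    then show False
      using W by (simp add: f_eq)
  qed
  then have "K.u m * eval_at x 1 \<in> P m" "K.u m * eval_at x [:0, 1:] \<in> P m"
    unfolding pieces by (force intro: exI[of _ 1], force intro: exI[of _ "[:0, 1:]"])
  then have uP: "K.u m \<in> P m" "x * K.u m \<in> P m"
    by (simp_all add: mult.commute)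
  obtain q f where q: "coordinate \<iota> q" "E q = 1" and f: "f \<noteq> 0" "f \<in> P m" "q * f \<in> P m"
    and full: "\<And>y. \<exists>m f. denominator y m f"
    by (rule slice[OF x m K.u_nonzero[OF m] uP]) (rule that, assumption, assumption, blast+)
  obtain \<psi> where \<psi>: "bij \<psi>" "field_embedding \<psi>" "\<And>c. \<psi> (ratfun_const c) = \<iota> c"
      "\<And>p. \<psi> (Fract p 1) = eval_at q p"
    by (rule coordinate_isomorphism[OF field_embedding q(1)]) (rule that, assumption, assumption, blast+)
  have img: "C = (\<lambda>z. z \<circ> inv \<psi>) ` P1"
    unfolding C by (rule places_isomorphic(1)[OF \<psi>(1-3), symmetric])
  have "pdiv_lnd_coordinate \<iota> C n \<sigma> D \<delta> q \<psi>"
    by unfold_locales (use \<psi> q full img A1P1 in auto)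
  then show thesis
    using that img m f by blast
qed

text \<open>
  The curve consists of all places, so it is not affine and properness bounds the degree.
\<close>

lemma projective_degree:
  assumes "curve_iso \<iota> C ratfun_const P1"
  shows "pdiv_degree \<sigma> C D \<subseteq> \<sigma>"
proof -
  obtain \<psi> where \<psi>: "bij \<psi>" "field_embedding \<psi>" "\<And>c. \<psi> (ratfun_const c) = \<iota> c"
      "C = (\<lambda>z. z \<circ> inv \<psi>) ` P1"
    by (rule curve_iso_chart[OF assms]) (rule that, assumption, assumption, blast+)
  have "C = places \<iota>"
    unfolding \<psi>(4) by (rule places_isomorphic(1)[OF \<psi>(1-3)])
  then show ?thesis
    using proper by (auto simp: proper_pdiv_def affine_curve_def)
qed

text \<open>
  In the coordinate \<open>q\<close> the piece of degree \<open>m\<close> is \<open>u m\<close> times the polynomials of degree at most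
  \<open>N m\<close>, the rounded degree of the divisor. The support functions at the finite points turn out to
  be integral and linear, so together they are the pairing with a lattice vector \<open>p\<close>, and
  \<open>N m\<close> is the rounded support function of the polyhedron at infinity translated by \<open>p\<close>. This
  translate is \<open>\<Delta>\<close>. The algebra of the divisor concentrated at infinity and the toric
  algebra of the extended cone consist of the same families of polynomials.
\<close>

theorem projective_line_case:
  assumes "curve_iso \<iota> C ratfun_const P1"
  shows "\<exists>\<Delta>. tailed n \<sigma> \<Delta> \<and> \<Delta> \<subset> \<sigma> \<and>
    (\<exists>\<Psi>. algebra_iso (group_alg_const \<iota>) A (group_alg_const ratfun_const)
        (pdiv_algebra n \<sigma> P1 (\<lambda>z. if z = P1_infinity then \<Delta> else \<sigma>)) \<Psi> \<and>
      graded_map A (\<lambda>m. range (single m)) \<Psi>) \<and>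
    polyhedral_cone (Suc n) (extended_cone n \<sigma> \<Delta>) \<and> strongly_convex (extended_cone n \<sigma> \<Delta>) \<and>
    (\<exists>w. demazure_root (Suc n) (extended_cone n \<sigma> \<Delta>) w (0(n := - 1)) \<and>
      (\<exists>\<Phi>. algebra_iso (group_alg_const \<iota>) A (group_alg_const id) (toric_algebra (Suc n) (extended_cone n \<sigma> \<Delta>)) \<Phi> \<and>
        graded_map A (\<lambda>m. {b. keys b \<subseteq> range (\<lambda>k. m(n := k))}) \<Phi> \<and>
        (\<forall>s. \<forall>a\<in>A. \<Phi> (ga_action (group_alg_const \<iota>) \<delta> s a) =
          ga_action (group_alg_const id) (demazure_lnd (Suc n) w (0(n := - 1))) s (\<Phi> a))))"
proof -
  obtain q \<psi> m1 f0 where K: "pdiv_lnd_coordinate \<iota> C n \<sigma> D \<delta> q \<psi>" and C: "C = (\<lambda>z. z \<circ> inv \<psi>) ` P1"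
    and m1: "m1 \<in> S" and f0: "f0 \<noteq> 0" "f0 \<in> P m1" "q * f0 \<in> P m1"
    using projective_coordinate[OF assms] .
  interpret K: pdiv_lnd_coordinate \<iota> C n \<sigma> D \<delta> q \<psi>
    by (rule K)
  let ?inf = "P1_infinity \<circ> inv \<psi>"
  have inf: "?inf \<in> C"
    unfolding C using P1_infinity_P1 by blast
  define hi where "hi m = support_fun n (D ?inf) m" for m
  define N where "N m = (\<Sum>a\<in>K.B. \<lfloor>K.h a m\<rfloor>) + \<lfloor>hi m\<rfloor>" for m
  define Q where "Q m = {p :: 'k poly. p = 0 \<or> int (degree p) \<le> N m}" for m
  have pieces: "P m = {K.u m * eval_at q p | p. p \<in> Q m}" if m: "m \<in> S" for m
    unfolding pdiv_piece_def K.u_def K.h_def N_def Q_def hi_def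
    using piece_over_P1[OF field_embedding K.\<psi>(1,2,4) C K.finite_B, of "\<lambda>z. support_fun n (D z) m"]
      K.floor_support[OF m] unfolding K.h_def by simp
  have gen: "\<exists>p. f = K.u m * eval_at q p" if "m \<in> S" "f \<in> P m" for m f
    using that pieces by blast
  have uP: "K.u m \<in> P m" if "m \<in> S" "N m \<ge> 0" for m
    unfolding pieces[OF that(1)] using that(2) by (auto intro!: exI[of _ 1] simp: Q_def)
  have N_nonneg: "N m \<ge> 0" if m: "m \<in> S" and f: "f \<in> P m" "f \<noteq> 0" for m f
    using f unfolding pieces[OF m] by (auto simp: Q_def)
  have N_m1: "N m1 \<ge> 1"
  proof -
    obtain p0 p1 where p: "f0 = K.u m1 * eval_at q p0" "q * f0 = K.u m1 * eval_at q p1" "p1 \<in> Q m1"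
      using f0 unfolding pieces[OF m1] by blast
    then have "K.u m1 * eval_at q p1 = K.u m1 * eval_at q ([:0, 1:] * p0)"
      by (simp only: eval_at_mult eval_at_var mult_ac)
    then have p1: "p1 = [:0, 1:] * p0"
      using K.u_nonzero[OF m1] K.ev_inject by (metis mult_left_cancel)
    have "p0 \<noteq> 0"
      using f0(1) p(1) by auto
    then have "degree p1 = Suc (degree p0)" "p1 \<noteq> 0"
      by (simp_all add: p1)
    then show ?thesis
      using p(3) by (simp add: Q_def)
  qed
  have good_add: "N (m + m') \<ge> 0" if "m \<in> S" "m' \<in> S" "N m \<ge> 0" "N m' \<ge> 0" for m m'
  proof (rule N_nonneg)
    show "K.u m * K.u m' \<in> P (m + m')"
      using that by (intro P_mult uP)
  qed (use that K.u_nonzero S_add in auto)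
  \<comment> \<open>The generators of the nonzero pieces multiply, which makes the divisor linear at finite points.\<close>
  interpret H: rounded_additive S K.h K.B hi N m1
  proof unfold_locales
    show "(\<Sum>a\<in>K.B. K.h a m) + hi m \<ge> 0" if "m \<in> S" for m
      unfolding hi_def by (rule K.support_functions_of_degree[OF C projective_degree[OF assms] that])
    show "hi m + hi m' \<le> hi (m + m')" if "m \<in> S" "m' \<in> S" for m m'
      unfolding hi_def by (rule support_fun_superadditive[OF tailed[OF inf] convex that])
    show "hi (\<lambda>i. k * m i) = of_int k * hi m" if "m \<in> S" "k \<ge> 0" for m k
      unfolding hi_def by (rule support_fun_multiple[OF tailed[OF inf] convex that])
    show "\<lfloor>K.h a (m + m')\<rfloor> = \<lfloor>K.h a m\<rfloor> + \<lfloor>K.h a m'\<rfloor>"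
      if "m \<in> S" "m' \<in> S" "N m \<ge> 0" "N m' \<ge> 0" for a m m'
      by (rule K.generators_multiply[of "{m \<in> S. N m \<ge> 0}"]) (use that uP gen good_add S_add in auto)
  qed (use S_add dual_lattice_closed(3) K.finite_B K.h_superadditive K.h_multiple good_add m1 N_m1 in \<open>auto simp: N_def\<close>)
  have h_integral: "K.h a m = of_int \<lfloor>K.h a m\<rfloor>" if "m \<in> S" for a m
    using H.integral[OF that, of a] K.h_outside_B[of a m] that by (cases "a \<in> K.B") (simp_all add: of_int_floor_Ints)
  have h_additive: "K.h a (m + m') = K.h a m + K.h a m'" if "m \<in> S" "m' \<in> S" for a m m'
    using H.additive[OF that, of a] K.h_outside_B that S_add by (cases "a \<in> K.B") simp_all
  have floors: "\<lfloor>K.h a (m + m')\<rfloor> = \<lfloor>K.h a m\<rfloor> + \<lfloor>K.h a m'\<rfloor>" if "m \<in> S" "m' \<in> S" for a m m'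
  proof -
    have "of_int \<lfloor>K.h a (m + m')\<rfloor> = (of_int \<lfloor>K.h a m\<rfloor> + of_int \<lfloor>K.h a m'\<rfloor> :: rat)"
      using h_integral that S_add h_additive by metis
    then show ?thesis
      by linarith
  qed
  define Hsum where "Hsum m = (\<Sum>a\<in>K.B. \<lfloor>K.h a m\<rfloor>)" for m
  obtain p where p: "p \<in> int_lattice n" "\<And>m. m \<in> S \<Longrightarrow> Hsum m = pairing n p m"
    using additive_function_is_pairing[OF cone, of Hsum] floors by (auto simp: Hsum_def sum.distrib)
  define \<Delta> where "\<Delta> = (\<lambda>v. v + rat_vec p) ` D ?inf"
  have tail: "tailed n \<sigma> \<Delta>"
    unfolding \<Delta>_def by (rule tailed_translate[OF tailed[OF inf] p(1)])
  interpret T: tailed_polyhedron n \<sigma> \<Delta>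
    by unfold_locales (rule cone(1), rule tail)
  have support: "support_fun n \<Delta> m = hi m + of_int (Hsum m)" if "m \<in> S" for m
    unfolding \<Delta>_def hi_def p(2)[OF that] by (rule support_fun_translate[OF tailed[OF inf] convex that])
  have N_floor: "N m = \<lfloor>support_fun n \<Delta> m\<rfloor>" if "m \<in> S" for m
    unfolding support[OF that] N_def Hsum_def[symmetric] by simp
  have support_nonneg: "support_fun n \<Delta> m \<ge> 0" if "m \<in> S" for m
  proof -
    have "of_int (Hsum m) = (\<Sum>a\<in>K.B. K.h a m)"
      unfolding Hsum_def of_int_sum by (rule sum.cong[OF refl]) (rule h_integral[OF that, symmetric])
    then show ?thesis
      using H.total[OF that] unfolding support[OF that] by simp
  qed
  have subset: "\<Delta> \<subset> \<sigma>"
  proof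
    show "\<Delta> \<subseteq> \<sigma>"
    proof
      fix v assume v: "v \<in> \<Delta>"
      show "v \<in> \<sigma>"
      proof (rule farkas[OF cone(1)])
        show "v \<in> rat_space n"
          using v T.polyhedron_rat_space by blast
        show "pairing n v m \<ge> 0" if "m \<in> S" for m
          using support_fun_le[OF tail convex that v] support_nonneg[OF that] by linarith
      qed
    qed
    show "\<Delta> \<noteq> \<sigma>"
    proof
      assume "\<Delta> = \<sigma>"
      then have "N m1 = 0"
        using N_floor[OF m1] support_fun_tail_cone[OF convex m1] by simp
      then show False
        using N_m1 by simp
    qed
  qed
  have N_add: "N m + N m' \<le> N (m + m')" if "m \<in> S" "m' \<in> S" for m m'
    using support_fun_superadditive[OF tail convex that] N_floor that S_add[OF that] by simp linarith
  have N0: "N 0 = 0"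
    using N_floor[OF S_zero] support_fun_zero[OF tail convex] by simp
  have data: "graded_poly_data S Q"
  proof
    show "p * r \<in> Q (m + m')" if "m \<in> S" "m' \<in> S" "p \<in> Q m" "r \<in> Q m'" for m m' p r
      using that N_add[of m m'] degree_mult_le[of p r] by (auto simp: Q_def)
    show "p + r \<in> Q m" if "p \<in> Q m" "r \<in> Q m" for m p r
      using that degree_add_le_max[of p r] by (auto simp: Q_def)
    show "pderiv p \<in> Q m" if "p \<in> Q m" for m p
      using that degree_pderiv[of p] by (auto simp: Q_def)
  qed (use S_zero S_add N0 in \<open>auto simp: Q_def\<close>)
  interpret X: pdiv_generators S Q \<iota> q K.u n \<sigma> C D
  proof (rule pdiv_generators.intro[OF data], unfold_locales)
    show "K.u (m + m') = K.u m * K.u m'" if "m \<in> S" "m' \<in> S" for m m'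
      using that floors by (intro K.u_add)
  qed (use field_embedding K.q(1) K.u_nonzero K.u_zero pieces in \<open>auto simp: coordinate_def\<close>)
  let ?D = "\<lambda>z. if z = P1_infinity then \<Delta> else \<sigma>"
  let ?t = "Fract [:0, 1:] 1 :: 'k poly fract"
  have target: "pdiv_piece n P1 ?D m = {1 * coefficient_hom.eval_at ratfun_const ?t p | p. p \<in> Q m}"
    if m: "m \<in> S" for m
  proof -
    note r = ord_at_neq_P1_infinity support_fun_tail_cone[OF convex m]
    have id: "bij (id :: 'k poly fract \<Rightarrow> _)" "field_embedding (id :: 'k poly fract \<Rightarrow> _)"
        "\<And>p :: 'k poly. id (Fract p 1) = coefficient_hom.eval_at ratfun_const ?t p"
        "(P1 :: ('k poly fract \<Rightarrow> int) set) = (\<lambda>z. z \<circ> inv id) ` P1"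
      by (simp_all add: field_embedding_def eval_at_ratfun)
    have "{a. \<lfloor>support_fun n (?D (ord_at a \<circ> inv id)) m\<rfloor> \<noteq> 0} \<subseteq> {}"
      by (simp add: r)
    from piece_over_P1[OF field_embedding_ratfun_const id finite.emptyI this]
    show ?thesis
      unfolding pdiv_piece_def Q_def N_floor[OF m] by (simp add: r ratfun_with_orders_zero)
  qed
  interpret X': pdiv_generators S Q ratfun_const ?t "\<lambda>_. 1" n \<sigma> P1 ?D
  proof (rule pdiv_generators.intro[OF data], unfold_locales)
    show "transcendental_elt ratfun_const ?t"
      using isomorphism_coordinate(2)[OF field_embedding_ratfun_const, of "id :: 'k poly fract \<Rightarrow> _"]
      by (simp add: coordinate_def field_embedding_def)
  qed (use field_embedding_ratfun_const target in auto)
  interpret V: toric_evaluation S Q N n "extended_cone n \<sigma> \<Delta>"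
  proof (rule toric_evaluation.intro[OF data], unfold_locales)
    show "dual_lattice (Suc n) (extended_cone n \<sigma> \<Delta>) = {m(n := k) | m k. m \<in> S \<and> k \<ge> 0 \<and> k \<le> N m}"
    proof -
      have "of_int k \<le> support_fun n \<Delta> m \<longleftrightarrow> k \<le> N m" if "m \<in> S" for m k
        by (simp only: N_floor[OF that] le_floor_iff)
      then show ?thesis
        unfolding T.dual_extended_cone by blast
    qed
  qed (auto simp: dual_lattice_def Q_def)
  let ?w = "0(n := 1) :: nat \<Rightarrow> int" and ?e = "0(n := - 1) :: nat \<Rightarrow> int"
  have deriv: "\<delta> (single m (K.u m * eval_at q p)) = single m (K.u m * eval_at q (pderiv p))"
    if m: "m \<in> S" and p: "p \<in> Q m" for m p
  proof (cases "p = 0")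
    case True
    then show ?thesis
      using \<delta>_zero by simp
  next
    case False
    then have N: "N m \<ge> 0"
      using p by (auto simp: Q_def)
    have mem: "K.u m * eval_at q p \<in> P m"
      using pieces[OF m] p by blast
    have "d m (K.u m) = 0"
      using K.generator_in_kernel[OF m uP[OF m N] K.u_nonzero[OF m]] gen[OF m] by blast
    then show ?thesis
      using K.d_constant_generator[OF m uP[OF m N] _ mem] \<delta>_single[OF m mem] by simp
  qed
  have \<Psi>: "algebra_iso (group_alg_const \<iota>) A (group_alg_const ratfun_const) (pdiv_algebra n \<sigma> P1 ?D) (X'.W.R \<circ> X.T) \<and>
      graded_map A (\<lambda>m. range (single m)) (X'.W.R \<circ> X.T)"
  proof
    show "algebra_iso (group_alg_const \<iota>) A (group_alg_const ratfun_const) (pdiv_algebra n \<sigma> P1 ?D) (X'.W.R \<circ> X.T)"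
      by (rule algebra_iso_comp[OF X.T_iso X'.W_iso])
    show "graded_map A (\<lambda>m. range (single m)) (X'.W.R \<circ> X.T)"
      unfolding graded_map_def
    proof (intro allI impI)
      fix m f assume "single m f \<in> A"
      then obtain p where p: "X.T (single m f) = single m p"
        by (rule X.T_single)
      show "(X'.W.R \<circ> X.T) (single m f) \<in> range (single m)"
        unfolding comp_apply p X'.W_single by blast
    qed
  qed
  have iso: "algebra_iso (group_alg_const \<iota>) A (group_alg_const id) (toric_algebra (Suc n) (extended_cone n \<sigma> \<Delta>)) (V.V.R \<circ> X.T)"
    by (rule algebra_iso_comp[OF X.T_iso V.V_iso])
  have \<Phi>_graded: "graded_map A (\<lambda>m. {b. keys b \<subseteq> range (\<lambda>k. m(n := k))}) (V.V.R \<circ> X.T)"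
    unfolding graded_map_def
  proof (intro allI impI)
    fix m f assume "single m f \<in> A"
    then obtain p where p: "X.T (single m f) = single m p"
      by (rule X.T_single)
    have "v \<in> range (\<lambda>k. m(n := k))" if "lookup (V.V.R (single m p)) v \<noteq> 0" for v
    proof -
      have "v(n := 0) = m(n := 0)"
        using that unfolding V.V.R_single V.lookup_marked_eval by (auto split: if_splits)
      then have "v = m(n := v n)"
        by (metis fun_upd_triv fun_upd_upd)
      then show ?thesis
        by blast
    qed
    then show "(V.V.R \<circ> X.T) (single m f) \<in> {b. keys b \<subseteq> range (\<lambda>k. m(n := k))}"
      unfolding comp_apply p by (auto simp only: in_keys_iff mem_Collect_eq subset_iff)
  qed
  have comm: "demazure_lnd (Suc n) ?w ?e ((V.V.R \<circ> X.T) a) = (V.V.R \<circ> X.T) (\<delta> a)" if a: "a \<in> A" for a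
  proof -
    have "X.coeff_deriv (X.T a) = X.T (\<delta> a)"
      using lnd deriv a by (intro X.derivation_is_coeff_deriv) (auto simp: lnd_on_def)
    then show ?thesis
      using V.V_demazure[OF X.T_mem[OF a]] by simp
  qed
  have action: "(V.V.R \<circ> X.T) (ga_action (group_alg_const \<iota>) \<delta> s a) =
      ga_action (group_alg_const id) (demazure_lnd (Suc n) ?w ?e) s ((V.V.R \<circ> X.T) a)" if "a \<in> A" for s a
    by (rule ga_action_intertwined[OF iso X.A_closed lnd comm that])
  show ?thesis
    by (intro exI[of _ \<Delta>] exI[of _ ?w] exI[of _ "V.V.R \<circ> X.T"] conjI tail subset
        exI[of _ "X'.W.R \<circ> X.T"] \<Psi> T.polyhedral_extended_cone
        T.strongly_convex_extended_cone[OF subset cone(2)]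
        T.demazure_root_extended_cone[OF subset cone(2)] iso \<Phi>_graded allI ballI action
        conjunct1[OF \<Psi>] conjunct2[OF \<Psi>])
qed

end

theorem proposition3:
  fixes \<iota> :: "'k::{alg_closed_field, field_char_0} \<Rightarrow> 'f::field"
    and C :: "('f \<Rightarrow> int) set"
    and n :: nat
    and \<sigma> :: "(nat \<Rightarrow> rat) set"
    and D :: "('f \<Rightarrow> int) \<Rightarrow> (nat \<Rightarrow> rat) set"
    and \<delta> :: "((nat \<Rightarrow> int) \<Rightarrow>\<^sub>0 'f) \<Rightarrow> ((nat \<Rightarrow> int) \<Rightarrow>\<^sub>0 'f)"
  assumes curve: "smooth_curve \<iota> C"
    and cone: "polyhedral_cone n \<sigma>" "strongly_convex \<sigma>"
    and proper: "proper_pdiv \<iota> n \<sigma> C D"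
    and lnd: "lnd_on (group_alg_const \<iota>) (pdiv_algebra n \<sigma> C D) \<delta>"
    and degree_zero: "homogeneous_of_degree (pdiv_algebra n \<sigma> C D) \<delta> 0"
    and horizontal: "horizontal \<iota> n (pdiv_algebra n \<sigma> C D) \<delta>"
  shows
    "(curve_iso \<iota> C ratfun_const A1 \<longrightarrow>
       (\<exists>\<Phi>. algebra_iso (group_alg_const \<iota>) (pdiv_algebra n \<sigma> C D)
              (\<lambda>c. [:group_alg_const id c:]) (toric_times_line n \<sigma>) \<Phi> \<and>
            graded_map (pdiv_algebra n \<sigma> C D)
              (\<lambda>m. {p. \<forall>i. Poly_Mapping.keys (coeff p i) \<subseteq> {m}}) \<Phi> \<and>
            (\<forall>s. \<forall>a \<in> pdiv_algebra n \<sigma> C D.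
               \<Phi> (ga_action (group_alg_const \<iota>) \<delta> s a) =
               pcompose (\<Phi> a) [:group_alg_const id s, 1:])))
     \<and>
     (curve_iso \<iota> C ratfun_const P1 \<longrightarrow>
       (\<exists>\<Delta>. tailed n \<sigma> \<Delta> \<and> \<Delta> \<subset> \<sigma> \<and>
         (\<exists>\<Psi>. algebra_iso (group_alg_const \<iota>) (pdiv_algebra n \<sigma> C D)
                (group_alg_const ratfun_const)
                (pdiv_algebra n \<sigma> P1 (\<lambda>z. if z = P1_infinity then \<Delta> else \<sigma>)) \<Psi> \<and>
              graded_map (pdiv_algebra n \<sigma> C D) (\<lambda>m. range (Poly_Mapping.single m)) \<Psi>) \<and>
         polyhedral_cone (Suc n) (extended_cone n \<sigma> \<Delta>) \<and>
         strongly_convex (extended_cone n \<sigma> \<Delta>) \<and>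
         (\<exists>w. demazure_root (Suc n) (extended_cone n \<sigma> \<Delta>) w (0(n := - 1)) \<and>
           (\<exists>\<Phi>. algebra_iso (group_alg_const \<iota>) (pdiv_algebra n \<sigma> C D)
                  (group_alg_const id) (toric_algebra (Suc n) (extended_cone n \<sigma> \<Delta>)) \<Phi> \<and>
                graded_map (pdiv_algebra n \<sigma> C D)
                  (\<lambda>m. {b. Poly_Mapping.keys b \<subseteq> range (\<lambda>k. m(n := k))}) \<Phi> \<and>
                (\<forall>s. \<forall>a \<in> pdiv_algebra n \<sigma> C D.
                   \<Phi> (ga_action (group_alg_const \<iota>) \<delta> s a) =
                   ga_action (group_alg_const id) (demazure_lnd (Suc n) w (0(n := - 1))) s (\<Phi> a))))))"
proof -
  interpret pdiv_lnd \<iota> C n \<sigma> D \<delta>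
    by unfold_locales (fact curve cone proper lnd degree_zero horizontal)+
  show ?thesis
    by (intro conjI impI affine_line_case projective_line_case)
qed

end
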